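(* There exist a number $\nu_2\ge\nu_1\ge\nu_0>1$ and a constant $C_1>0$, each depending only on $\mu_1,\mu_2,\max_{i,j}\|a_{ij}\|_{C^1(\overline{Q}_T)},Q_T,\overline{C}$, such that the following holds. Let $\delta_0\in(0,1)$ be such that $$\ln\left[\left(\ln(\delta_0^{-1/2})\right)^{1/\ln(T+1)}\right]\ge\nu_2 ,$$ let $\delta\in(0,\delta_0)$ and $\alpha=\alpha(\delta)=\delta^2$. Let $q^*\in L_2(Q_T)$ and let $v^*\in H_0^2(Q_T)$ satisfy $v^*_t=Lv^*+Av^*+q^*$ in $Q_T$. Let $q\in L_2(Q_T)$ satisfy $\|q-q^*\|_{L_2(Q_T)}<\delta$, and let $v_{\min}\in H_0^2(Q_T)$ be the unique minimizer over $H_0^2(Q_T)$ of the functional $$J_\alpha(v)=\int_{Q_T}(v_t-Lv-Av-q)^2\,dx\,dt+\alpha\|v\|_{H^2(Q_T)}^2 .$$ Then $w_\delta=v_{\min}-v^*$ satisfies, for every $\tau\in(0,T)$, $$\|w_\delta\|_{H^{1,0}(Q_{T\tau})}\le C_1\left(1+\|v^*\|_{H^2(Q_T)}\right)\exp\left[-\frac{1}{2^{c}}\left(\ln(\delta^{-1})\right)^{c}\right],\qquad c=c(\tau,T)=\frac{\ln(\tau+1)}{\ln(T+1)}\in(0,1).$$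
   Context: All functions are real valued. $\Omega\subset\mathbb{R}^n$ is a bounded domain with piecewise smooth boundary $\partial\Omega$, $T>0$, $Q_T=\Omega\times(0,T)$, $S_T=\partial\Omega\times(0,T)$, and $Q_{T\tau}=\Omega\times(\tau,T)$ for $\tau\in(0,T)$. $\nabla$ is the gradient in $x$ only. The functions $a_{ij}$, $i,j=1,\dots,n$, satisfy $a_{ij}=a_{ji}\in C^1(\overline{Q}_T)$ and, for constants $0<\mu_1\le\mu_2$, $\mu_1|\xi|^2\le\sum_{i,j=1}^n a_{ij}(x,t)\xi_i\xi_j\le\mu_2|\xi|^2$ for all $(x,t)\in\overline{Q}_T$, $\xi\in\mathbb{R}^n$. The operators are $Lu=\sum_{i,j=1}^n a_{ij}(x,t)u_{x_ix_j}$ and $Au=\sum_{j=1}^n b_j(x,t)u_{x_j}+c(x,t)u$, where $b_j,c\in C(\overline{Q}_T)$ (the coefficient $c(x,t)$ is not to be confused with the exponent $c(\tau,T)$). Put $F(\nabla u,u,x,t)=Au+p(x,t)$ with $p\in C(\overline{Q}_T)$; $\overline{C}>0$ is a Lipschitz constant of $F$ with respect to $(\nabla u,u)\in\mathbb{R}^{n+1}$, uniform in $(x,t)\in\overline{Q}_T$. $H^2(Q_T)$ is the Sobolev space over the $(n+1)$-dimensional domain $Q_T$, and $H_0^2(Q_T)=\{w\in H^2(Q_T): w|_{S_T}=0,\ w(x,T)=0\}$ (traces). $H^{1,0}(Q_{T\tau})$ has norm $\|u\|_{H^{1,0}(Q_{T\tau})}=\left[\int_{Q_{T\tau}}\left((\nabla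 u)^2+u^2\right)dx\,dt\right]^{1/2}$. For each $\alpha\in(0,1)$ and $q\in L_2(Q_T)$ the functional $J_\alpha$ has a unique minimizer on $H_0^2(Q_T)$. $\nu_0>1$ is a number depending only on $\mu_1,\mu_2,\max_{i,j}\|a_{ij}\|_{C^1(\overline{Q}_T)},Q_T$ such that, with some $C>0$ depending only on the same parameters, for all $\nu\ge\nu_0$ and all $u\in H^2(Q_T)$ with $u|_{S_T}=0$ the following Carleman estimate holds: $$\int_{Q_T}(u_t-Lu)^2e^{2(t+1)^{\nu}}dx\,dt\ge C\sqrt{\nu}\int_{Q_T}(\nabla u)^2e^{2(t+1)^{\nu}}dx\,dt+C\nu^2\int_{Q_T}u^2e^{2(t+1)^{\nu}}dx\,dt-Ce^{3(T+1)^{\nu}}\|u(x,T)\|_{L_2(\Omega)}^2-C\|\nabla u(x,0)\|_{L_2(\Omega)}^2.$$ $\nu_1\ge\nu_0$ is a number depending only on $\mu_1,\mu_2,\max_{i,j}\|a_{ij}\|_{C^1(\overline{Q}_T)},Q_T,\overline{C}$ for which the following stability estimate holds with some constant $C_1'>0$ depending only on the same parameters: if $\ln[(\ln(\delta_0^{-1/3}))^{1/\ln(T+1)}]\ge\nu_1$, $\delta\in(0,\delta_0)$, $M>0$, and $u_1,u_2\in H^2(Q_T)$ both solve $u_t=Lu+F(\nabla u,u,x,t)$ in $Q_T$, $u|_{S_T}=0$, with $\|u_1(x,T)-u_2(x,T)\|_{L_2(\Omega)}\le\delta$ and $\|\nabla u_i(x,0)\|_{L_2(\Omega)}\le M$,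 then $\|u_1-u_2\|_{H^{1,0}(Q_{T\tau})}\le C_1'(M+1)\exp[-3^{-c}(\ln(\delta^{-1}))^{c}]$ for all $\tau\in(0,T)$, with $c=\ln(\tau+1)/\ln(T+1)$. *)

theory Defs
  imports "HOL-Analysis.Analysis"
begin

section \<open>Smooth functions and Hausdorff measure\<close>

text \<open>Meaningful for open \<open>U\<close>: all partial derivatives up to order \<open>k\<close> exist and are continuous.\<close>

fun Ck_on :: "nat \<Rightarrow> 'a::euclidean_space set \<Rightarrow> ('a \<Rightarrow> real) \<Rightarrow> bool" where
  "Ck_on 0 U f \<longleftrightarrow> continuous_on U f"
| "Ck_on (Suc k) U f \<longleftrightarrow> f differentiable_on U \<and>
     (\<forall>b\<in>Basis. Ck_on k U (\<lambda>x. frechet_derivative f (at x) b))"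

definition smooth_on :: "'a::euclidean_space set \<Rightarrow> ('a \<Rightarrow> real) \<Rightarrow> bool" where
  "smooth_on U f \<longleftrightarrow> (\<forall>k. Ck_on k U f)"

text \<open>Normalised so that a set of diameter \<open>d\<close> weighs as much as a \<open>k\<close>-ball of diameter \<open>d\<close>.
  The case distinction is needed for \<open>k = 0\<close> only, where \<open>0 ^ 0 = 1\<close>.\<close>

definition hausdorff_weight :: "nat \<Rightarrow> 'a::metric_space set \<Rightarrow> ennreal" where
  "hausdorff_weight k C =
     (if C = {} then 0 else ennreal (unit_ball_vol (real k) * (diameter C / 2) ^ k))"

definition hausdorff_pre :: "nat \<Rightarrow> real \<Rightarrow> 'a::metric_space set \<Rightarrow> ennreal" where
  "hausdorff_pre k \<epsilon> A =
     (INF C\<in>{C :: nat \<Rightarrow> 'a set. A \<subseteq> (\<Union>i. C i) \<and> (\<forall>i. bounded (C i) \<and> diameter (C i) \<le> \<epsilon>)}.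
        \<Sum>i. hausdorff_weight k (C i))"

definition hausdorff_outer :: "nat \<Rightarrow> 'a::metric_space set \<Rightarrow> ennreal" where
  "hausdorff_outer k A = (SUP \<epsilon>\<in>{0<..}. hausdorff_pre k \<epsilon> A)"

definition hausdorff_measure :: "nat \<Rightarrow> 'a::metric_space measure" where
  "hausdorff_measure k = measure_of UNIV (sets borel) (hausdorff_outer k)"


section \<open>Domains\<close>

definition bounded_domain :: "'a::euclidean_space set \<Rightarrow> bool" where
  "bounded_domain \<Omega> \<longleftrightarrow> open \<Omega> \<and> connected \<Omega> \<and> bounded \<Omega> \<and> \<Omega> \<noteq> {}"

text \<open>Near \<open>x\<close> the boundary is a smooth hypersurface with \<open>\<Omega>\<close> on exactly one side of it.\<close>

definition smooth_boundary_point :: "'a::euclidean_space set \<Rightarrow> 'a \<Rightarrow> bool" where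
  "smooth_boundary_point \<Omega> x \<longleftrightarrow>
     (\<exists>V \<psi>. open V \<and> x \<in> V \<and> smooth_on V \<psi> \<and> \<psi> x = 0 \<and>
        frechet_derivative \<psi> (at x) \<noteq> (\<lambda>_. 0) \<and> \<Omega> \<inter> V = {y\<in>V. \<psi> y < 0})"

text \<open>The boundary is made up of finitely many smooth relatively open pieces; edges and corners
  are limits of the pieces and carry no surface measure. No Lipschitz condition is imposed.\<close>

definition piecewise_smooth_boundary :: "'a::euclidean_space set \<Rightarrow> bool" where
  "piecewise_smooth_boundary \<Omega> \<longleftrightarrow>
     (\<exists>\<S>. finite \<S> \<and>
        (\<forall>S\<in>\<S>. openin (top_of_set (frontier \<Omega>)) S \<and> connected S \<and>
               (\<forall>x\<in>S. smooth_boundary_point \<Omega> x)) \<and>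
        frontier \<Omega> = (\<Union>S\<in>\<S>. closure S) \<and>
        emeasure (hausdorff_measure (DIM('a) - 1)) (frontier \<Omega> - \<Union>\<S>) = 0 \<and>
        emeasure (hausdorff_measure (DIM('a) - 1)) (frontier \<Omega>) < \<infinity>)"

text \<open>Points of space-time are pairs \<open>(x, t)\<close>; \<open>cylinder \<Omega> 0 T\<close> is \<open>Q\<^sub>T\<close> and
  \<open>cylinder \<Omega> \<tau> T\<close> is \<open>Q\<^sub>T\<^sub>\<tau>\<close>.\<close>

definition cylinder :: "'a set \<Rightarrow> real \<Rightarrow> real \<Rightarrow> ('a \<times> real) set" where
  "cylinder \<Omega> s T = \<Omega> \<times> {s<..<T}"

definition lateral :: "'a::topological_space set \<Rightarrow> real \<Rightarrow> ('a \<times> real) set" where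
  "lateral \<Omega> T = frontier \<Omega> \<times> {0<..<T}"


section \<open>Sobolev spaces and traces\<close>

definition L2_on :: "'a::euclidean_space set \<Rightarrow> ('a \<Rightarrow> real) set" where
  "L2_on U = {u. u \<in> borel_measurable (lebesgue_on U) \<and> integrable (lebesgue_on U) (\<lambda>z. (u z)\<^sup>2)}"

definition L2_norm :: "'a::euclidean_space set \<Rightarrow> ('a \<Rightarrow> real) \<Rightarrow> real" where
  "L2_norm U u = sqrt (\<integral>z. (u z)\<^sup>2 \<partial>lebesgue_on U)"

definition test_function :: "'a::euclidean_space set \<Rightarrow> ('a \<Rightarrow> real) \<Rightarrow> bool" where
  "test_function U \<phi> \<longleftrightarrow> smooth_on UNIV \<phi> \<and>
     compact (closure {z. \<phi> z \<noteq> 0}) \<and> closure {z. \<phi> z \<noteq> 0} \<subseteq> U"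

definition has_weak_deriv ::
    "'a::euclidean_space set \<Rightarrow> 'a \<Rightarrow> ('a \<Rightarrow> real) \<Rightarrow> ('a \<Rightarrow> real) \<Rightarrow> bool" where
  "has_weak_deriv U b u g \<longleftrightarrow> u \<in> L2_on U \<and> g \<in> L2_on U \<and>
     (\<forall>\<phi>. test_function U \<phi> \<longrightarrow>
        (\<integral>z. u z * frechet_derivative \<phi> (at z) b \<partial>lebesgue_on U) = - (\<integral>z. g z * \<phi> z \<partial>lebesgue_on U))"

text \<open>A representative of the square integrable weak derivative in direction \<open>b\<close>, which is
  determined almost everywhere on \<open>U\<close>.\<close>

definition weak_deriv :: "'a::euclidean_space set \<Rightarrow> 'a \<Rightarrow> ('a \<Rightarrow> real) \<Rightarrow> 'a \<Rightarrow> real" where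
  "weak_deriv U b u = (SOME g. has_weak_deriv U b u g)"

definition H1 :: "'a::euclidean_space set \<Rightarrow> ('a \<Rightarrow> real) set" where
  "H1 U = {u \<in> L2_on U. \<forall>b\<in>Basis. \<exists>g. has_weak_deriv U b u g}"

definition H2 :: "'a::euclidean_space set \<Rightarrow> ('a \<Rightarrow> real) set" where
  "H2 U = {u \<in> L2_on U. \<forall>b\<in>Basis. \<exists>g. has_weak_deriv U b u g \<and> g \<in> H1 U}"

definition H2_norm :: "'a::euclidean_space set \<Rightarrow> ('a \<Rightarrow> real) \<Rightarrow> real" where
  "H2_norm U u = sqrt ((L2_norm U u)\<^sup>2 + (\<Sum>b\<in>Basis. (L2_norm U (weak_deriv U b u))\<^sup>2) +
     (\<Sum>b\<in>Basis. \<Sum>b'\<in>Basis. (L2_norm U (weak_deriv U b' (weak_deriv U b u)))\<^sup>2))"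

text \<open>\<open>g\<close> is the trace on \<open>\<Gamma> \<subseteq> frontier U\<close> of \<open>u\<close>: the \<open>L\<^sub>2\<close> limit with respect to surface
  measure of the boundary values of smooth functions converging to \<open>u\<close> in \<open>H\<^sup>1\<close>.\<close>

definition has_boundary_trace ::
    "'a::euclidean_space set \<Rightarrow> 'a set \<Rightarrow> ('a \<Rightarrow> real) \<Rightarrow> ('a \<Rightarrow> real) \<Rightarrow> bool" where
  "has_boundary_trace U \<Gamma> u g \<longleftrightarrow> u \<in> H1 U \<and> g \<in> borel_measurable borel \<and>
     (\<exists>\<phi> :: nat \<Rightarrow> 'a \<Rightarrow> real.
        (\<forall>k. smooth_on UNIV (\<phi> k) \<and> \<phi> k \<in> L2_on U \<and>
             (\<forall>b\<in>Basis. (\<lambda>z. frechet_derivative (\<phi> k) (at z) b) \<in> L2_on U)) \<and>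
        (\<lambda>k. L2_norm U (\<lambda>z. \<phi> k z - u z)) \<longlonglongrightarrow> 0 \<and>
        (\<forall>b\<in>Basis. (\<lambda>k. L2_norm U (\<lambda>z. frechet_derivative (\<phi> k) (at z) b - weak_deriv U b u z)) \<longlonglongrightarrow> 0) \<and>
        (\<lambda>k. \<integral>\<^sup>+z\<in>\<Gamma>. ennreal ((\<phi> k z - g z)\<^sup>2) \<partial>hausdorff_measure (DIM('a) - 1)) \<longlonglongrightarrow> 0)"

definition zero_lateral_trace ::
    "'a::euclidean_space set \<Rightarrow> real \<Rightarrow> ('a \<times> real \<Rightarrow> real) \<Rightarrow> bool" where
  "zero_lateral_trace \<Omega> T u \<longleftrightarrow> has_boundary_trace (cylinder \<Omega> 0 T) (lateral \<Omega> T) u (\<lambda>_. 0)"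

text \<open>\<open>g\<close> is the trace \<open>u(\<cdot>, s)\<close>, \<open>s \<in> [0,T]\<close>: the value at \<open>s\<close> of the representative of \<open>u\<close> in
  \<open>C([0,T]; L\<^sub>2(\<Omega>))\<close>. The given function \<open>u\<close> may be arbitrary on a null set of times.\<close>

definition has_time_trace ::
    "'a::euclidean_space set \<Rightarrow> real \<Rightarrow> ('a \<times> real \<Rightarrow> real) \<Rightarrow> real \<Rightarrow> ('a \<Rightarrow> real) \<Rightarrow> bool" where
  "has_time_trace \<Omega> T u s g \<longleftrightarrow> g \<in> L2_on \<Omega> \<and>
     (\<exists>N. negligible N \<and> (\<forall>t\<in>{0<..<T} - N. (\<lambda>x. u (x, t)) \<in> L2_on \<Omega>) \<and>
          ((\<lambda>t. L2_norm \<Omega> (\<lambda>x. u (x, t) - g x)) \<longlongrightarrow> 0) (at s within ({0<..<T} - N)))"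

definition time_trace ::
    "'a::euclidean_space set \<Rightarrow> real \<Rightarrow> ('a \<times> real \<Rightarrow> real) \<Rightarrow> real \<Rightarrow> 'a \<Rightarrow> real" where
  "time_trace \<Omega> T u s = (SOME g. has_time_trace \<Omega> T u s g)"

definition H2_0 :: "'a::euclidean_space set \<Rightarrow> real \<Rightarrow> ('a \<times> real \<Rightarrow> real) set" where
  "H2_0 \<Omega> T = {w \<in> H2 (cylinder \<Omega> 0 T).
     zero_lateral_trace \<Omega> T w \<and> has_time_trace \<Omega> T w T (\<lambda>_. 0)}"


section \<open>Spatial and temporal weak derivatives\<close>

definition dx :: "((real^'n) \<times> real) set \<Rightarrow> 'n::finite \<Rightarrow> ((real^'n) \<times> real \<Rightarrow> real)
    \<Rightarrow> (real^'n) \<times> real \<Rightarrow> real" where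
  "dx U i u = weak_deriv U (axis i 1, 0) u"

definition dt :: "((real^'n::finite) \<times> real) set \<Rightarrow> ((real^'n) \<times> real \<Rightarrow> real)
    \<Rightarrow> (real^'n) \<times> real \<Rightarrow> real" where
  "dt U u = weak_deriv U (0, 1) u"

definition grad :: "((real^'n::finite) \<times> real) set \<Rightarrow> ((real^'n) \<times> real \<Rightarrow> real)
    \<Rightarrow> (real^'n) \<times> real \<Rightarrow> real^'n" where
  "grad U u z = (\<chi> i. dx U i u z)"

definition H10_norm :: "((real^'n::finite) \<times> real) set \<Rightarrow> ((real^'n) \<times> real \<Rightarrow> real) \<Rightarrow> real" where
  "H10_norm U u = sqrt (\<integral>z. (norm (grad U u z))\<^sup>2 + (u z)\<^sup>2 \<partial>lebesgue_on U)"

text \<open>The \<open>L\<^sub>2(\<Omega>)\<close> norm of \<open>\<nabla>u(x, s)\<close>.\<close>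

definition grad_time_trace_norm :: "(real^'n::finite) set \<Rightarrow> real \<Rightarrow> ((real^'n) \<times> real \<Rightarrow> real)
    \<Rightarrow> real \<Rightarrow> real" where
  "grad_time_trace_norm \<Omega> T u s =
     sqrt (\<Sum>i\<in>UNIV. (L2_norm \<Omega> (time_trace \<Omega> T (dx (cylinder \<Omega> 0 T) i u) s))\<^sup>2)"


section \<open>Coefficients and operators\<close>

text \<open>\<open>f\<close> and its first derivatives on the open set \<open>U\<close> extend continuously to the closure.\<close>

definition C1_closure :: "'a::euclidean_space set \<Rightarrow> ('a \<Rightarrow> real) \<Rightarrow> bool" where
  "C1_closure U f \<longleftrightarrow> continuous_on (closure U) f \<and> f differentiable_on U \<and>
     (\<forall>b\<in>Basis. \<exists>g. continuous_on (closure U) g \<and> (\<forall>z\<in>U. g z = frechet_derivative f (at z) b))"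

definition C1_norm :: "'a::euclidean_space set \<Rightarrow> ('a \<Rightarrow> real) \<Rightarrow> real" where
  "C1_norm U f = (SUP z\<in>closure U. \<bar>f z\<bar>) +
     (\<Sum>b\<in>Basis. SUP z\<in>U. \<bar>frechet_derivative f (at z) b\<bar>)"

text \<open>The conditions on \<open>a\<^sub>i\<^sub>j\<close>, with \<open>K\<close> the value of the largest \<open>C\<^sup>1\<close> norm.\<close>

definition diffusion_coeffs :: "(real^'n::finite) set \<Rightarrow> real \<Rightarrow> real \<Rightarrow> real \<Rightarrow> real
    \<Rightarrow> ('n \<Rightarrow> 'n \<Rightarrow> (real^'n) \<times> real \<Rightarrow> real) \<Rightarrow> bool" where
  "diffusion_coeffs \<Omega> T \<mu>1 \<mu>2 K a \<longleftrightarrow>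
     (\<forall>i j. C1_closure (cylinder \<Omega> 0 T) (a i j)) \<and>
     (\<forall>i j. \<forall>z\<in>closure (cylinder \<Omega> 0 T). a i j z = a j i z) \<and>
     (\<forall>z\<in>closure (cylinder \<Omega> 0 T). \<forall>\<xi>::real^'n.
        \<mu>1 * (norm \<xi>)\<^sup>2 \<le> (\<Sum>i\<in>UNIV. \<Sum>j\<in>UNIV. a i j z * \<xi> $ i * \<xi> $ j) \<and>
        (\<Sum>i\<in>UNIV. \<Sum>j\<in>UNIV. a i j z * \<xi> $ i * \<xi> $ j) \<le> \<mu>2 * (norm \<xi>)\<^sup>2) \<and>
     Max (range (\<lambda>(i, j). C1_norm (cylinder \<Omega> 0 T) (a i j))) = K"

definition L_op :: "((real^'n::finite) \<times> real) set \<Rightarrow> ('n \<Rightarrow> 'n \<Rightarrow> (real^'n) \<times> real \<Rightarrow> real)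
    \<Rightarrow> ((real^'n) \<times> real \<Rightarrow> real) \<Rightarrow> (real^'n) \<times> real \<Rightarrow> real" where
  "L_op U a u z = (\<Sum>i\<in>UNIV. \<Sum>j\<in>UNIV. a i j z * dx U j (dx U i u) z)"

definition A_op :: "((real^'n::finite) \<times> real) set \<Rightarrow> ('n \<Rightarrow> (real^'n) \<times> real \<Rightarrow> real)
    \<Rightarrow> ((real^'n) \<times> real \<Rightarrow> real)
    \<Rightarrow> ((real^'n) \<times> real \<Rightarrow> real) \<Rightarrow> (real^'n) \<times> real \<Rightarrow> real" where
  "A_op U b c u z = (\<Sum>j\<in>UNIV. b j z * dx U j u z) + c z * u z"

definition F_fun :: "('n::finite \<Rightarrow> (real^'n) \<times> real \<Rightarrow> real) \<Rightarrow> ((real^'n) \<times> real \<Rightarrow> real)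
    \<Rightarrow> ((real^'n) \<times> real \<Rightarrow> real) \<Rightarrow> real^'n \<Rightarrow> real \<Rightarrow> (real^'n) \<times> real \<Rightarrow> real" where
  "F_fun b c p \<xi> s z = (\<Sum>j\<in>UNIV. b j z * \<xi> $ j) + c z * s + p z"

definition lower_order_coeffs :: "(real^'n::finite) set \<Rightarrow> real \<Rightarrow> real
    \<Rightarrow> ('n \<Rightarrow> (real^'n) \<times> real \<Rightarrow> real) \<Rightarrow> ((real^'n) \<times> real \<Rightarrow> real)
    \<Rightarrow> ((real^'n) \<times> real \<Rightarrow> real) \<Rightarrow> bool" where
  "lower_order_coeffs \<Omega> T Cbar b c p \<longleftrightarrow>
     (\<forall>j. continuous_on (closure (cylinder \<Omega> 0 T)) (b j)) \<and>
     continuous_on (closure (cylinder \<Omega> 0 T)) c \<and>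
     continuous_on (closure (cylinder \<Omega> 0 T)) p \<and>
     (\<forall>z\<in>closure (cylinder \<Omega> 0 T). Cbar-lipschitz_on UNIV (\<lambda>(\<xi>, s). F_fun b c p \<xi> s z))"

definition J_functional :: "((real^'n::finite) \<times> real) set
    \<Rightarrow> ('n \<Rightarrow> 'n \<Rightarrow> (real^'n) \<times> real \<Rightarrow> real)
    \<Rightarrow> ('n \<Rightarrow> (real^'n) \<times> real \<Rightarrow> real) \<Rightarrow> ((real^'n) \<times> real \<Rightarrow> real)
    \<Rightarrow> ((real^'n) \<times> real \<Rightarrow> real) \<Rightarrow> real \<Rightarrow> ((real^'n) \<times> real \<Rightarrow> real) \<Rightarrow> real" where
  "J_functional U a b c q \<alpha> v =
     (\<integral>z. (dt U v z - L_op U a v z - A_op U b c v z - q z)\<^sup>2 \<partial>lebesgue_on U) + \<alpha> * (H2_norm U v)\<^sup>2"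

text \<open>Uniqueness is that of elements of the function space, i.e. up to null sets.\<close>

definition unique_minimizer :: "'a::euclidean_space set \<Rightarrow> (('a \<Rightarrow> real) \<Rightarrow> real) \<Rightarrow> ('a \<Rightarrow> real) set
    \<Rightarrow> ('a \<Rightarrow> real) \<Rightarrow> bool" where
  "unique_minimizer U J X v \<longleftrightarrow> is_arg_min J (\<lambda>w. w \<in> X) v \<and>
     (\<forall>w. is_arg_min J (\<lambda>w. w \<in> X) w \<longrightarrow> (AE z in lebesgue_on U. w z = v z))"


section \<open>The Carleman and stability estimates\<close>

definition time_exponent :: "real \<Rightarrow> real \<Rightarrow> real" where
  "time_exponent \<tau> T = ln (\<tau> + 1) / ln (T + 1)"

text \<open>In both definitions the constant is chosen before the coefficients, i.e. it depends only on
  the arguments of the predicate.\<close>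

definition carleman_estimate :: "(real^'n::finite) set \<Rightarrow> real \<Rightarrow> real \<Rightarrow> real \<Rightarrow> real \<Rightarrow> real \<Rightarrow> bool" where
  "carleman_estimate \<Omega> T \<mu>1 \<mu>2 K \<nu>0 \<longleftrightarrow>
     (let Q = cylinder \<Omega> 0 T; W = (\<lambda>\<nu> z. exp (2 * (snd z + 1) powr \<nu>)) in
      \<exists>C>0. \<forall>a. diffusion_coeffs \<Omega> T \<mu>1 \<mu>2 K a \<longrightarrow>
        (\<forall>\<nu>\<ge>\<nu>0. \<forall>u\<in>H2 Q. zero_lateral_trace \<Omega> T u \<longrightarrow>
          (\<integral>z. (dt Q u z - L_op Q a u z)\<^sup>2 * W \<nu> z \<partial>lebesgue_on Q)
            \<ge> C * sqrt \<nu> * (\<integral>z. (norm (grad Q u z))\<^sup>2 * W \<nu> z \<partial>lebesgue_on Q)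
              + C * \<nu>\<^sup>2 * (\<integral>z. (u z)\<^sup>2 * W \<nu> z \<partial>lebesgue_on Q)
              - C * exp (3 * (T + 1) powr \<nu>) * (L2_norm \<Omega> (time_trace \<Omega> T u T))\<^sup>2
              - C * (grad_time_trace_norm \<Omega> T u 0)\<^sup>2))"

definition solves_pde :: "(real^'n::finite) set \<Rightarrow> real
    \<Rightarrow> ('n \<Rightarrow> 'n \<Rightarrow> (real^'n) \<times> real \<Rightarrow> real)
    \<Rightarrow> ('n \<Rightarrow> (real^'n) \<times> real \<Rightarrow> real) \<Rightarrow> ((real^'n) \<times> real \<Rightarrow> real)
    \<Rightarrow> ((real^'n) \<times> real \<Rightarrow> real) \<Rightarrow> ((real^'n) \<times> real \<Rightarrow> real) \<Rightarrow> bool" where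
  "solves_pde \<Omega> T a b c p u \<longleftrightarrow>
     (let Q = cylinder \<Omega> 0 T in u \<in> H2 Q \<and> zero_lateral_trace \<Omega> T u \<and>
       (AE z in lebesgue_on Q. dt Q u z = L_op Q a u z + F_fun b c p (grad Q u z) (u z) z))"

definition stability_estimate :: "(real^'n::finite) set \<Rightarrow> real \<Rightarrow> real \<Rightarrow> real \<Rightarrow> real \<Rightarrow> real \<Rightarrow> real \<Rightarrow> bool" where
  "stability_estimate \<Omega> T \<mu>1 \<mu>2 K Cbar \<nu>1 \<longleftrightarrow>
     (\<exists>C>0. \<forall>a b c p. diffusion_coeffs \<Omega> T \<mu>1 \<mu>2 K a \<and> lower_order_coeffs \<Omega> T Cbar b c p \<longrightarrow>
        (\<forall>\<delta>0 \<delta> M u1 u2.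
           0 < \<delta>0 \<and> \<delta>0 < 1 \<and> ln ((ln (\<delta>0 powr (-1/3))) powr (1 / ln (T + 1))) \<ge> \<nu>1 \<and>
           0 < \<delta> \<and> \<delta> < \<delta>0 \<and> 0 < M \<and>
           solves_pde \<Omega> T a b c p u1 \<and> solves_pde \<Omega> T a b c p u2 \<and>
           L2_norm \<Omega> (\<lambda>x. time_trace \<Omega> T u1 T x - time_trace \<Omega> T u2 T x) \<le> \<delta> \<and>
           grad_time_trace_norm \<Omega> T u1 0 \<le> M \<and> grad_time_trace_norm \<Omega> T u2 0 \<le> M \<longrightarrow>
           (\<forall>\<tau>\<in>{0<..<T}.
              H10_norm (cylinder \<Omega> \<tau> T) (\<lambda>z. u1 z - u2 z)
                \<le> C * (M + 1) * exp (- (3 powr (- time_exponent \<tau> T) *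
                                          (ln (1 / \<delta>)) powr time_exponent \<tau> T)))))"

end

theory Submission
  imports Defs
begin

text \<open>Let \<open>P u = u\<^sub>t - L u - A u\<close> and \<open>w = v_min - v_star\<close>. Comparing the functional at its
  minimizer with its value at \<open>v_star\<close>, where \<open>P v_star = q_star\<close>, shows that \<open>P w\<close> is of order
  \<open>\<delta>\<close> in \<open>L\<^sub>2\<close>, whereas \<open>w\<close> stays bounded in \<open>H\<^sup>2\<close>, both up to the factor
  \<open>1 + \<parallel>v_star\<parallel>\<close> (\<open>minimizer_bounds\<close>). The Carleman estimate converts smallness of \<open>P w\<close> into
  smallness of \<open>w\<close> at positive times. As \<open>w\<close> vanishes at time \<open>T\<close>, the only term at the ends of
  the time interval that survives is \<open>\<nabla>w(x, 0)\<close>, which is not small, but bounded by the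
  \<open>H\<^sup>2\<close> norm of \<open>w\<close>. For large \<open>\<nu>\<close> the lower order operator \<open>A\<close> is absorbed, and the weight,
  which increases in time, gives on times later than \<open>\<tau>\<close> (\<open>carleman_imp_H10_bound\<close>)
  \<open>\<parallel>w\<parallel>\<^sup>2 \<le> C exp (- 2 (\<tau> + 1)\<^sup>\<nu>) (exp (2 (T + 1)\<^sup>\<nu>) \<parallel>P w\<parallel>\<^sup>2 + \<parallel>\<nabla>w(x, 0)\<parallel>\<^sup>2)\<close>.
  With \<open>(T + 1)\<^sup>\<nu> = ln (1 / \<delta>) / 2\<close> the large exponential is \<open>1 / \<delta>\<close>, which \<open>\<parallel>P w\<parallel>\<^sup>2\<close> of
  order \<open>\<delta>\<^sup>2\<close> outweighs. The bracket is then bounded, and \<open>(\<tau> + 1)\<^sup>\<nu>\<close> is the power \<open>c\<close> of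
  \<open>(T + 1)\<^sup>\<nu>\<close>, which is the claimed rate. The condition on \<open>\<delta>0\<close> ensures that this
  \<open>\<nu>\<close> is at least \<open>\<nu>2\<close>, so that the Carleman estimate and the absorption of \<open>A\<close> apply.

  Two properties of the function spaces carry this argument. First, \<open>w\<close> is admissible in the Carleman
  estimate and all operators are linear: weak derivatives are chosen representatives, so this
  holds up to null sets by the uniqueness of weak derivatives (\<open>has_weak_deriv_unique\<close>), a consequence of
  the fundamental lemma of the calculus of variations
  (\<open>AE_lborel_eq_0_if_bump_integrals_0\<close>). Second, \<open>\<nabla>w(x, 0)\<close> exists as a trace and is
  controlled: a square integrable \<open>g\<close> with square integrable weak time derivative \<open>h\<close> is almost everywhere
  a function \<open>G(x)\<close> plus the primitive of \<open>h\<close> in time, and \<open>G\<close> is the trace at time \<open>0\<close>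
  (\<open>weak_time_derivative_representation\<close>, \<open>grad_time_trace_norm_le\<close>).\<close>


section \<open>Calculus of smooth functions\<close>

lemma Ck_on_SucI:
  assumes "\<And>x. (f has_derivative F x) (at x)" "\<And>b. b \<in> Basis \<Longrightarrow> Ck_on k UNIV (\<lambda>x. F x b)"
  shows "Ck_on (Suc k) UNIV f"
proof -
  have "frechet_derivative f (at x) = F x" for x
    using frechet_derivative_at[OF assms(1)] by simp
  moreover have "f differentiable_on UNIV"
    using assms(1) by (auto simp: differentiable_on_def differentiable_def)
  ultimately show ?thesis using assms(2) by simp
qed

lemma Ck_on_Suc_has_derivative:
  "Ck_on (Suc k) UNIV f \<Longrightarrow> (f has_derivative frechet_derivative f (at x)) (at x)"
  by (auto simp: differentiable_on_def frechet_derivative_works)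

lemma Ck_on_Suc_imp_Ck_on: "Ck_on (Suc k) UNIV f \<Longrightarrow> Ck_on k UNIV f"
proof (induction k arbitrary: f)
  case 0
  then show ?case by (simp add: differentiable_imp_continuous_on)
next
  case (Suc k)
  then show ?case by (metis Ck_on.simps(2))
qed

lemma Ck_on_continuous: "Ck_on k UNIV f \<Longrightarrow> continuous_on UNIV f"
proof (cases k)
  case (Suc m)
  assume "Ck_on k UNIV f"
  then show ?thesis using Suc by (auto simp: differentiable_imp_continuous_on)
qed simp

lemma Ck_on_const: "Ck_on k UNIV (\<lambda>_. c)"
proof (induction k arbitrary: c)
  case (Suc k)
  show ?case by (rule Ck_on_SucI[where F="\<lambda>x b. 0"]) (auto simp: Suc)
qed simp

lemma Ck_on_add: "Ck_on k UNIV f \<Longrightarrow> Ck_on k UNIV g \<Longrightarrow> Ck_on k UNIV (\<lambda>x. f x + g x)"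
proof (induction k arbitrary: f g)
  case (Suc k)
  note d = Ck_on_Suc_has_derivative[OF Suc.prems(1)] Ck_on_Suc_has_derivative[OF Suc.prems(2)]
  show ?case
    by (rule Ck_on_SucI[OF has_derivative_add[OF d]]) (use Suc in auto)
qed (simp add: continuous_on_add)

text \<open>The Leibniz rule turns a derivative of order \<open>k + 1\<close> of a product into products of
  functions that are still \<open>k\<close> times differentiable; this is where the nesting of the classes enters.\<close>

lemma Ck_on_mult: "Ck_on k UNIV f \<Longrightarrow> Ck_on k UNIV g \<Longrightarrow> Ck_on k UNIV (\<lambda>x. f x * g x)"
proof (induction k arbitrary: f g)
  case (Suc k)
  note d = Ck_on_Suc_has_derivative[OF Suc.prems(1)] Ck_on_Suc_has_derivative[OF Suc.prems(2)]
  show ?case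
  proof (rule Ck_on_SucI[OF has_derivative_mult[OF d]])
    fix b :: 'a assume b: "b \<in> Basis"
    have "Ck_on k UNIV (\<lambda>x. frechet_derivative f (at x) b)"
      "Ck_on k UNIV (\<lambda>x. frechet_derivative g (at x) b)"
      using Suc.prems b by auto
    moreover have "Ck_on k UNIV f" "Ck_on k UNIV g"
      using Suc.prems Ck_on_Suc_imp_Ck_on by blast+
    ultimately show "Ck_on k UNIV (\<lambda>x. f x * frechet_derivative g (at x) b +
        frechet_derivative f (at x) b * g x)"
      by (intro Ck_on_add Suc.IH)
  qed
qed (simp add: continuous_on_mult)

lemma Ck_on_sum: "(\<And>i. i \<in> I \<Longrightarrow> Ck_on k UNIV (f i)) \<Longrightarrow> Ck_on k UNIV (\<lambda>x. \<Sum>i\<in>I. f i x)"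
  by (induction I rule: infinite_finite_induct) (auto intro: Ck_on_const Ck_on_add)

lemma Ck_on_prod: "(\<And>i. i \<in> I \<Longrightarrow> Ck_on k UNIV (f i)) \<Longrightarrow> Ck_on k UNIV (\<lambda>x. \<Prod>i\<in>I. f i x)"
  by (induction I rule: infinite_finite_induct) (auto intro: Ck_on_const Ck_on_mult)

text \<open>By the chain rule the partial derivatives of the composition are fixed linear combinations of
  the partial derivatives of \<open>f\<close>, composed with the same affine map, so that the induction closes.
  Projections and coordinate functions are the instances of interest.\<close>

lemma Ck_on_affine:
  fixes l :: "'a::euclidean_space \<Rightarrow> 'b::euclidean_space"
  assumes l: "bounded_linear l"
  shows "Ck_on k UNIV f \<Longrightarrow> Ck_on k UNIV (\<lambda>x. f (l x + c))"
proof (induction k arbitrary: f)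
  case 0
  then show ?case
    by (auto intro!: continuous_on_compose2[of UNIV f] continuous_intros
        bounded_linear.continuous_on[OF l])
next
  case (Suc k)
  have d: "((\<lambda>x. f (l x + c)) has_derivative
      (\<lambda>h. \<Sum>i\<in>Basis. (l h \<bullet> i) * frechet_derivative f (at (l x + c)) i)) (at x)" for x
  proof -
    have D: "(f has_derivative frechet_derivative f (at (l x + c))) (at (l x + c))"
      using Ck_on_Suc_has_derivative[OF Suc.prems] .
    interpret F: bounded_linear "frechet_derivative f (at (l x + c))"
      using D by (rule has_derivative_bounded_linear)
    have e: "frechet_derivative f (at (l x + c)) (l h) =
        (\<Sum>i\<in>Basis. (l h \<bullet> i) * frechet_derivative f (at (l x + c)) i)" for h
    proof -
      have "frechet_derivative f (at (l x + c)) (l h) =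
        frechet_derivative f (at (l x + c)) (\<Sum>i\<in>Basis. (l h \<bullet> i) *\<^sub>R i)"
        by (simp add: euclidean_representation)
      then show ?thesis by (simp add: F.sum F.scaleR)
    qed
    have "((\<lambda>x. l x + c) has_derivative l) (at x)"
      by (auto intro!: derivative_eq_intros bounded_linear_imp_has_derivative[OF l])
    from has_derivative_compose[OF this D]
    show ?thesis by (simp add: e)
  qed
  show ?case
    by (rule Ck_on_SucI[OF d]) (use Suc in \<open>auto intro!: Ck_on_sum Ck_on_mult Ck_on_const\<close>)
qed

lemma Ck_on_real_SucI:
  fixes f :: "real \<Rightarrow> real"
  assumes "\<And>x. (f has_real_derivative f' x) (at x)" "Ck_on k UNIV f'"
  shows "Ck_on (Suc k) UNIV f"
  by (rule Ck_on_SucI[where F="\<lambda>x h. f' x * h"])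
     (use assms in \<open>auto simp: has_field_derivative_def\<close>)

lemma smooth_on_add: "smooth_on UNIV f \<Longrightarrow> smooth_on UNIV g \<Longrightarrow> smooth_on UNIV (\<lambda>x. f x + g x)"
  by (simp add: smooth_on_def Ck_on_add)

lemma smooth_on_mult: "smooth_on UNIV f \<Longrightarrow> smooth_on UNIV g \<Longrightarrow> smooth_on UNIV (\<lambda>x. f x * g x)"
  by (simp add: smooth_on_def Ck_on_mult)

lemma smooth_on_cmult: "smooth_on UNIV f \<Longrightarrow> smooth_on UNIV (\<lambda>x. c * f x)"
  by (simp add: smooth_on_def Ck_on_mult Ck_on_const)

lemma smooth_on_diff: "smooth_on UNIV f \<Longrightarrow> smooth_on UNIV g \<Longrightarrow> smooth_on UNIV (\<lambda>x. f x - g x)"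
  using smooth_on_add[OF _ smooth_on_cmult[of g "-1"], of f] by simp

lemma smooth_on_prod:
  "(\<And>i. i \<in> I \<Longrightarrow> smooth_on UNIV (f i)) \<Longrightarrow> smooth_on UNIV (\<lambda>x. \<Prod>i\<in>I. f i x)"
  by (simp add: smooth_on_def Ck_on_prod)

lemma smooth_on_affine:
  fixes l :: "'a::euclidean_space \<Rightarrow> 'b::euclidean_space"
  shows "bounded_linear l \<Longrightarrow> smooth_on UNIV f \<Longrightarrow> smooth_on UNIV (\<lambda>x. f (l x + c))"
  by (simp add: smooth_on_def Ck_on_affine)

lemma smooth_on_linear:
  fixes l :: "'a::euclidean_space \<Rightarrow> 'b::euclidean_space"
  shows "bounded_linear l \<Longrightarrow> smooth_on UNIV f \<Longrightarrow> smooth_on UNIV (\<lambda>x. f (l x))"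
  using smooth_on_affine[of l f 0] by simp

lemma smooth_on_has_derivative:
  "smooth_on UNIV f \<Longrightarrow> (f has_derivative frechet_derivative f (at x)) (at x)"
  by (rule Ck_on_Suc_has_derivative[of 0]) (simp only: smooth_on_def)

lemma smooth_on_continuous: "smooth_on UNIV f \<Longrightarrow> continuous_on UNIV f"
  using Ck_on_continuous by (auto simp: smooth_on_def)

lemma smooth_on_frechet_derivative:
  "smooth_on UNIV f \<Longrightarrow> b \<in> Basis \<Longrightarrow> smooth_on UNIV (\<lambda>x. frechet_derivative f (at x) b)"
  by (metis Ck_on.simps(2) smooth_on_def)

lemma smooth_on_antiderivative:
  fixes f :: "real \<Rightarrow> real"
  assumes "\<And>x. (f has_real_derivative f' x) (at x)" "smooth_on UNIV f'"
  shows "smooth_on UNIV f"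
  unfolding smooth_on_def
proof
  fix k
  have "Ck_on k UNIV f'" using assms(2) by (simp add: smooth_on_def)
  from Ck_on_Suc_imp_Ck_on[OF Ck_on_real_SucI[OF assms(1) this]] show "Ck_on k UNIV f" .
qed

section \<open>Smooth bump functions\<close>

text \<open>The family is closed under differentiation up to linear combinations, which is why powers
  of \<open>1 / x\<close> are included: the member with \<open>n = 0\<close> is the classical flat function.\<close>

definition flat_exp :: "nat \<Rightarrow> real \<Rightarrow> real" where
  "flat_exp n x = (if 0 < x then exp (- (1 / x)) / x ^ n else 0)"

text \<open>With \<open>y = 1 / x\<close> this is the fact that the exponential beats every power.\<close>

lemma flat_exp_tendsto_0: "((\<lambda>x. exp (- (1 / x)) / x ^ n) \<longlongrightarrow> (0::real)) (at_right 0)"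
proof -
  have "((\<lambda>y. y ^ n / exp y) \<longlongrightarrow> (0::real)) at_top"
    by (rule tendsto_power_div_exp_0)
  from filterlim_compose[OF this filterlim_inverse_at_top_right]
  show ?thesis
    by (simp add: exp_minus field_simps)
qed

text \<open>Away from \<open>0\<close> this is the quotient rule; at \<open>0\<close> the difference quotient is the next
  member of the family and tends to \<open>0\<close>.\<close>

lemma flat_exp_has_derivative:
  "(flat_exp n has_real_derivative flat_exp (n + 2) x - real n * flat_exp (n + 1) x) (at x)"
proof -
  consider "x < 0" | "x = 0" | "0 < x" by linarith
  then show ?thesis
  proof cases
    case 1
    have "((\<lambda>_. 0) has_real_derivative 0) (at x)" by simp
    then have "(flat_exp n has_real_derivative 0) (at x)"
      by (rule has_field_derivative_transform_within_open[of _ _ _ "{..<0}"])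
         (use 1 in \<open>auto simp: flat_exp_def\<close>)
    then show ?thesis using 1 by (simp add: flat_exp_def)
  next
    case 2
    have "((\<lambda>y. flat_exp n y / y) \<longlongrightarrow> 0) (at 0)"
    proof (rule filterlim_split_at)
      have "eventually (\<lambda>y. 0 = flat_exp n y / y) (at_left 0)"
        by (auto simp: eventually_at_left_field flat_exp_def intro!: exI[of _ "-1"])
      then show "((\<lambda>y. flat_exp n y / y) \<longlongrightarrow> 0) (at_left 0)"
        by (rule Lim_transform_eventually[rotated]) simp
      have "eventually (\<lambda>y. exp (- (1 / y)) / y ^ Suc n = flat_exp n y / y) (at_right 0)"
        by (auto simp: eventually_at_right_field flat_exp_def intro!: exI[of _ "1"])
      then show "((\<lambda>y. flat_exp n y / y) \<longlongrightarrow> 0) (at_right 0)"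
        by (rule Lim_transform_eventually[rotated]) (rule flat_exp_tendsto_0)
    qed
    then have "(flat_exp n has_real_derivative 0) (at 0)"
      by (simp add: has_field_derivative_iff flat_exp_def)
    then show ?thesis using 2 by (simp add: flat_exp_def)
  next
    case 3
    have "((\<lambda>x. exp (- (1 / x)) / x ^ n) has_real_derivative
        exp (- (1 / x)) / x ^ (n + 2) - real n * (exp (- (1 / x)) / x ^ (n + 1))) (at x)"
    proof -
      have 1: "((\<lambda>x. exp (- (1 / x))) has_real_derivative exp (- (1 / x)) * (1 / x ^ 2)) (at x)"
        using 3 by (auto intro!: derivative_eq_intros simp: power2_eq_square)
      have "((\<lambda>x. x ^ n) has_real_derivative real n * x ^ (n - 1)) (at x)"
        using DERIV_pow[of n x] by simp
      from DERIV_divide[OF 1 this] 3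
      have "((\<lambda>x. exp (- (1 / x)) / x ^ n) has_real_derivative
        (exp (- (1 / x)) * (1 / x\<^sup>2) * x ^ n - exp (- (1 / x)) * (real n * x ^ (n - 1))) /
        (x ^ n * x ^ n)) (at x)" by simp
      moreover have "(exp (- (1 / x)) * (1 / x\<^sup>2) * x ^ n - exp (- (1 / x)) * (real n * x ^ (n - 1))) /
        (x ^ n * x ^ n) = exp (- (1 / x)) / x ^ (n + 2) - real n * (exp (- (1 / x)) / x ^ (n + 1))"
      proof -
        have "E * (1 / x\<^sup>2) * x ^ n / (x ^ n * x ^ n) = E / x ^ (n + 2)"
          "E * (real n * x ^ (n - 1)) / (x ^ n * x ^ n) = real n * (E / x ^ (n + 1))" for E :: real
          using 3 by (cases n; simp add: power_add power2_eq_square)+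
        then show ?thesis by (simp add: diff_divide_distrib)
      qed
      ultimately show ?thesis by simp
    qed
    then have "(flat_exp n has_real_derivative
        exp (- (1 / x)) / x ^ (n + 2) - real n * (exp (- (1 / x)) / x ^ (n + 1))) (at x)"
      by (rule has_field_derivative_transform_within_open[of _ _ _ "{0<..}"])
         (use 3 in \<open>auto simp: flat_exp_def\<close>)
    then show ?thesis using 3 by (simp add: flat_exp_def)
  qed
qed

lemma smooth_on_flat_exp: "smooth_on UNIV (flat_exp n)"
  unfolding smooth_on_def
proof
  fix k
  show "Ck_on k UNIV (flat_exp n)"
  proof (induction k arbitrary: n)
    case 0
    show ?case
      using DERIV_isCont[OF flat_exp_has_derivative]
      by (auto intro!: continuous_at_imp_continuous_on)
  next
    case (Suc k)
    have "Ck_on k UNIV (\<lambda>x. flat_exp (n + 2) x + (- real n) * flat_exp (n + 1) x)"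
      by (intro Ck_on_add Ck_on_mult Ck_on_const Suc)
    then show ?case
      by (intro Ck_on_real_SucI[OF flat_exp_has_derivative]) simp
  qed
qed

text \<open>The parameter \<open>k\<close> squeezes the two flat transitions towards the endpoints: the support
  stays \<open>[a, b]\<close>, while the values tend to \<open>1\<close> inside. Thus indicator functions of boxes are
  pointwise limits of test functions.\<close>

definition bump1 :: "nat \<Rightarrow> real \<Rightarrow> real \<Rightarrow> real \<Rightarrow> real" where
  "bump1 k a b x = flat_exp 0 (real (Suc k) * (x - a)) * flat_exp 0 (real (Suc k) * (b - x))"

definition bump :: "nat \<Rightarrow> 'a::euclidean_space \<Rightarrow> 'a \<Rightarrow> 'a \<Rightarrow> real" where
  "bump k a b x = (\<Prod>i\<in>Basis. bump1 k (a \<bullet> i) (b \<bullet> i) (x \<bullet> i))"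

lemma smooth_on_bump1: "smooth_on UNIV (bump1 k a b)"
proof -
  have "bounded_linear (\<lambda>x. real (Suc k) * x)" "bounded_linear (\<lambda>x. - real (Suc k) * x)"
    by (rule bounded_linear_mult_right)+
  then have "smooth_on UNIV (\<lambda>x. flat_exp 0 (real (Suc k) * x + (- real (Suc k) * a)))"
    "smooth_on UNIV (\<lambda>x. flat_exp 0 (- real (Suc k) * x + real (Suc k) * b))"
    using smooth_on_affine[OF _ smooth_on_flat_exp] by blast+
  from smooth_on_mult[OF this] show ?thesis
    unfolding bump1_def by (simp add: algebra_simps)
qed

lemma smooth_on_bump: "smooth_on UNIV (bump k a b)"
  unfolding bump_def
  by (intro smooth_on_prod smooth_on_linear[OF bounded_linear_inner_left smooth_on_bump1])

lemma bump1_measurable [measurable]: "bump1 k a b \<in> borel_measurable borel"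
  using smooth_on_continuous[OF smooth_on_bump1] by (rule borel_measurable_continuous_onI)

lemma bump_measurable [measurable]: "bump k a b \<in> borel_measurable borel"
  using smooth_on_continuous[OF smooth_on_bump] by (rule borel_measurable_continuous_onI)

lemma flat_exp_0_bounds: "0 \<le> flat_exp 0 x" "flat_exp 0 x \<le> 1"
  by (auto simp: flat_exp_def)

lemma bump1_bounds: "0 \<le> bump1 k a b x" "bump1 k a b x \<le> 1"
  by (auto simp: bump1_def flat_exp_0_bounds intro!: mult_le_one mult_nonneg_nonneg)

lemma bump_bounds: "0 \<le> bump k a b x" "bump k a b x \<le> 1"
  by (auto simp: bump_def bump1_bounds intro!: prod_nonneg prod_le_1)

lemma bump1_nonzero_iff: "bump1 k a b x \<noteq> 0 \<longleftrightarrow> a < x \<and> x < b"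
  by (auto simp: bump1_def flat_exp_def zero_less_mult_iff)

lemma bump_nonzero_iff: "bump k a b x \<noteq> 0 \<longleftrightarrow> x \<in> box a b"
  by (auto simp: bump_def bump1_nonzero_iff box_def)

lemma flat_exp_tendsto_1: "0 < x \<Longrightarrow> (\<lambda>k. flat_exp 0 (real (Suc k) * x)) \<longlonglongrightarrow> 1"
proof -
  assume x: "0 < x"
  have "(\<lambda>k. exp (- ((1 / real (Suc k)) * (1 / x)))) \<longlonglongrightarrow> exp (- (0 * (1 / x)))"
    by (intro tendsto_intros LIMSEQ_Suc[OF lim_1_over_n])
  then show ?thesis using x by (simp add: flat_exp_def)
qed

lemma bump1_tendsto_indicator: "(\<lambda>k. bump1 k a b x) \<longlonglongrightarrow> indicator {a<..<b} x"
proof (cases "a < x \<and> x < b")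
  case True
  then have "(\<lambda>k. bump1 k a b x) \<longlonglongrightarrow> 1 * 1"
    unfolding bump1_def by (intro tendsto_mult flat_exp_tendsto_1) auto
  then show ?thesis using True by simp
next
  case False
  then have "bump1 k a b x = 0" for k using bump1_nonzero_iff by blast
  then show ?thesis using False by auto
qed

lemma bump_tendsto_indicator: "(\<lambda>k. bump k a b x) \<longlonglongrightarrow> indicator (box a b) x"
proof -
  have "(\<lambda>k. bump k a b x) \<longlonglongrightarrow> (\<Prod>i\<in>Basis. indicator {a \<bullet> i<..<b \<bullet> i} (x \<bullet> i))"
    unfolding bump_def by (intro tendsto_prod bump1_tendsto_indicator)
  moreover have "(\<Prod>i\<in>Basis. indicator {a \<bullet> i<..<b \<bullet> i} (x \<bullet> i)) = (indicator (box a b) x :: real)"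
    by (auto simp: indicator_def box_def)
  ultimately show ?thesis by simp
qed

lemma test_function_if_support:
  assumes "smooth_on UNIV \<phi>" "compact K" "K \<subseteq> U" "\<And>x. \<phi> x \<noteq> 0 \<Longrightarrow> x \<in> K"
  shows "test_function U \<phi>"
proof -
  have "closure {z. \<phi> z \<noteq> 0} \<subseteq> K"
    using assms by (intro closure_minimal compact_imp_closed) auto
  then show ?thesis
    using assms compact_Int_closed[OF assms(2) closed_closure, of "{z. \<phi> z \<noteq> 0}"]
    by (auto simp: test_function_def inf_absorb2)
qed

lemma test_function_bump:
  assumes "cbox a b \<subseteq> U"
  shows "test_function U (bump k a b)"
  by (rule test_function_if_support[OF smooth_on_bump compact_cbox assms])
     (use bump_nonzero_iff box_subset_cbox in blast)

text \<open>A bump on space-time is a bump in space times a bump in time; test functions of this form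
  allow the two variables to be treated one after the other.\<close>

lemma bump_Pair:
  "bump k (a, s) (b, t) z = bump k a b (fst z) * bump1 k s t (snd z)"
  for a b :: "'a::euclidean_space" and s t :: real
proof -
  have 0: "(\<lambda>u. (u, 0)) ` (Basis::'a set) \<inter> (\<lambda>v. (0, v)) ` (Basis::real set) = {}"
    by (auto simp: nonzero_Basis)
  have "inj_on (\<lambda>u. (u, 0::real)) (Basis::'a set)" "inj_on (\<lambda>v. (0::'a, v)) (Basis::real set)"
    by (auto simp: inj_on_def)
  then show ?thesis
    unfolding bump_def Basis_prod_def
    by (subst prod.union_disjoint) (use 0 in \<open>auto simp: prod.reindex inner_prod_def\<close>)
qed


section \<open>The fundamental lemma of the calculus of variations\<close>

text \<open>The positive and the negative part of \<open>f\<close> are densities of finite measures that agree on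
  boxes. Boxes are stable under intersection and generate the Borel sets, so the measures and hence
  their densities agree.\<close>

lemma AE_lborel_eq_0_if_box_integrals_0:
  fixes f :: "'a::euclidean_space \<Rightarrow> real"
  assumes f: "integrable lborel f"
    and 0: "\<And>a b. (\<integral>x. f x * indicator (box a b) x \<partial>lborel) = 0"
  shows "AE x in lborel. f x = 0"
proof -
  have [measurable]: "f \<in> borel_measurable borel" using f by auto
  let ?E = "range (\<lambda>(a, b). box a b) :: 'a set set"
  define P where "P = (\<lambda>x. ennreal (f x))"
  define N where "N = (\<lambda>x. ennreal (- f x))"
  have [measurable]: "P \<in> borel_measurable borel" "N \<in> borel_measurable borel"
    by (simp_all add: P_def N_def)
  have fin: "(\<integral>\<^sup>+x. P x * indicator X x \<partial>lborel) < \<infinity>" for X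
  proof -
    have "(\<integral>\<^sup>+x. P x * indicator X x \<partial>lborel) \<le> (\<integral>\<^sup>+x. ennreal (norm (f x)) \<partial>lborel)"
      by (intro nn_integral_mono) (auto simp: P_def indicator_def intro!: ennreal_leI)
    also have "\<dots> < \<infinity>" using f by (simp add: integrable_iff_bounded)
    finally show ?thesis .
  qed
  have eq: "(\<integral>\<^sup>+x. P x * indicator X x \<partial>lborel) = (\<integral>\<^sup>+x. N x * indicator X x \<partial>lborel)"
    if X: "X \<in> ?E" for X
  proof -
    obtain a b where ab: "X = box a b" using X by auto
    define g where "g = (\<lambda>x. f x * indicator X x)"
    have g: "integrable lborel g"
      unfolding g_def using f by (intro integrable_real_mult_indicator) (auto simp: ab)
    have "(\<integral>\<^sup>+x. ennreal (g x) \<partial>lborel) = (\<integral>\<^sup>+x. ennreal (- g x) \<partial>lborel)"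
    proof -
      have "(\<integral>x. g x \<partial>lborel) = 0" using 0[of a b] by (simp add: g_def ab)
      moreover have "(\<integral>x. g x \<partial>lborel) =
          enn2real (\<integral>\<^sup>+x. ennreal (g x) \<partial>lborel) - enn2real (\<integral>\<^sup>+x. ennreal (- g x) \<partial>lborel)"
        by (rule real_lebesgue_integral_def[OF g])
      moreover have "(\<integral>\<^sup>+x. ennreal (g x) \<partial>lborel) \<noteq> \<infinity>" "(\<integral>\<^sup>+x. ennreal (- g x) \<partial>lborel) \<noteq> \<infinity>"
        using g by (auto simp: real_integrable_def)
      ultimately show ?thesis
        by (metis diff_eq_diff_less_eq diff_0_right eq_iff_diff_eq_0 ennreal_enn2real infinity_ennreal_def top.not_eq_extremum)
    qed
    moreover have "P x * indicator X x = ennreal (g x)" "N x * indicator X x = ennreal (- g x)" for x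
      by (auto simp: P_def N_def g_def indicator_def)
    ultimately show ?thesis by simp
  qed
  have "density lborel P = density lborel N"
  proof (rule measure_eqI_generator_eq[where \<Omega>=UNIV and E="?E"
        and A="\<lambda>n::nat. box (- (real n *\<^sub>R One)) (real n *\<^sub>R One)"])
    show "Int_stable ?E" by (auto simp: Int_stable_def box_Int_box)
    show "(\<Union>n::nat. box (- (real n *\<^sub>R One)) (real n *\<^sub>R One)) = (UNIV::'a set)"
      using UN_box_eq_UNIV by simp
    show "emeasure (density lborel P) X = emeasure (density lborel N) X" if "X \<in> ?E" for X
      using eq[OF that] that by (auto simp: emeasure_density)
    show "emeasure (density lborel P) (box (- (real n *\<^sub>R One)) (real n *\<^sub>R One)) \<noteq> \<infinity>" for n :: nat
      using fin[of "box (- (real n *\<^sub>R One)) (real n *\<^sub>R One)"] by (simp add: emeasure_density)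
  qed (auto simp: borel_eq_box)
  then have "AE x in lborel. P x = N x"
    by (intro sigma_finite_measure.density_unique[OF sigma_finite_lborel]) auto
  moreover have "f x = 0" if "P x = N x" for x
    using that by (cases "0 \<le> f x") (auto simp: P_def N_def ennreal_neg ennreal_eq_0_iff)
  ultimately show ?thesis by auto
qed

text \<open>Fubini's theorem for \<open>lborel\<close> needs Borel functions on the whole space. The
  representative extended by zero provides one, and the following lemmas carry integrals and
  null sets back and forth.\<close>

lemma lebesgue_on_borel_representative:
  fixes u :: "'a::euclidean_space \<Rightarrow> real"
  assumes U: "open U" and u: "u \<in> borel_measurable (lebesgue_on U)"
  obtains u' where "u' \<in> borel_measurable borel" "\<And>z. z \<notin> U \<Longrightarrow> u' z = 0"
    "AE z in lebesgue_on U. u z = u' z"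
proof -
  have Us: "U \<in> sets lebesgue" using U by simp
  have "(\<lambda>z. if z \<in> U then u z else 0) \<in> borel_measurable lebesgue"
    using borel_measurable_if[OF Us] u by blast
  then obtain v where v: "v \<in> borel_measurable lborel" "AE z in lborel. (if z \<in> U then u z else 0) = v z"
    using completion_ex_borel_measurable_real by blast
  define u' where "u' = (\<lambda>z. indicator U z * v z)"
  show ?thesis
  proof
    have [measurable]: "v \<in> borel_measurable borel" "U \<in> sets borel" using v U by auto
    show "u' \<in> borel_measurable borel" unfolding u'_def by measurable
    have "AE z in lebesgue. z \<in> U \<longrightarrow> u z = u' z"
      using AE_completion[OF v(2)] by eventually_elim (auto simp: u'_def)
    then show "AE z in lebesgue_on U. u z = u' z"
      using Us by (simp add: AE_restrict_space_iff)
  qed (simp add: u'_def)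
qed

lemma integral_lebesgue_on_eq_lborel:
  fixes f :: "'a::euclidean_space \<Rightarrow> real"
  assumes "open U" "f \<in> borel_measurable borel" "\<And>z. z \<notin> U \<Longrightarrow> f z = 0"
  shows "integral\<^sup>L (lebesgue_on U) f = integral\<^sup>L lborel f"
    and "integrable (lebesgue_on U) f \<longleftrightarrow> integrable lborel f"
proof -
  have e: "(\<lambda>x. indicator U x * f x) = f" using assms(3) by (fastforce simp: indicator_def)
  show "integral\<^sup>L (lebesgue_on U) f = integral\<^sup>L lborel f"
    using assms by (subst integral_restrict_space) (auto simp: e integral_completion)
  show "integrable (lebesgue_on U) f \<longleftrightarrow> integrable lborel f"
    using assms by (subst integrable_restrict_space) (auto simp: e integrable_completion)
qed

lemma AE_lebesgue_on_iff_lborel: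
  "open U \<Longrightarrow> (AE z in lebesgue_on U. P z) \<longleftrightarrow> (AE z in lborel. z \<in> U \<longrightarrow> P z)"
  by (simp add: AE_restrict_space_iff AE_completion_iff)

text \<open>Dominated convergence passes from bumps to indicators of boxes whose closure lies in \<open>U\<close>.
  On a single such box the criterion for boxes applies, because the intersection of two boxes is
  again a box with closure in \<open>U\<close>; countably many boxes exhaust \<open>U\<close>.\<close>

lemma AE_lborel_eq_0_if_bump_integrals_0:
  fixes f :: "'a::euclidean_space \<Rightarrow> real"
  assumes U: "open U" and f: "integrable lborel f"
    and 0: "\<And>k a b. cbox a b \<subseteq> U \<Longrightarrow> (\<integral>x. f x * bump k a b x \<partial>lborel) = 0"
  shows "AE x in lborel. x \<in> U \<longrightarrow> f x = 0"
proof -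
  have [measurable]: "f \<in> borel_measurable borel" using f by auto
  have box0: "(\<integral>x. f x * indicator (box a b) x \<partial>lborel) = 0" if "cbox a b \<subseteq> U" for a b
  proof -
    have "(\<lambda>k. \<integral>x. f x * bump k a b x \<partial>lborel) \<longlonglongrightarrow> (\<integral>x. f x * indicator (box a b) x \<partial>lborel)"
    proof (rule integral_dominated_convergence[where w="\<lambda>x. norm (f x)"])
      show "AE x in lborel. (\<lambda>k. f x * bump k a b x) \<longlonglongrightarrow> f x * indicator (box a b) x"
        by (intro AE_I2 tendsto_intros bump_tendsto_indicator)
      show "AE x in lborel. norm (f x * bump k a b x) \<le> norm (f x)" for k
        using bump_bounds[of k a b] by (auto simp: abs_mult intro!: mult_left_le)
    qed (use f in auto)
    then show ?thesis using 0[OF that] by (simp add: LIMSEQ_const_iff)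
  qed
  have local: "AE x in lborel. x \<in> cbox c d \<longrightarrow> f x = 0" if cd: "cbox c d \<subseteq> U" for c d
  proof -
    have "AE x in lborel. f x * indicator (box c d) x = 0"
    proof (rule AE_lborel_eq_0_if_box_integrals_0)
      show "integrable lborel (\<lambda>x. f x * indicator (box c d) x)"
        using f by (intro integrable_real_mult_indicator) auto
      fix a b :: 'a
      obtain p q where pq: "box a b \<inter> box c d = box p q"
        using box_Int_box by blast
      have "cbox p q \<subseteq> U" if "box p q \<noteq> {}"
      proof -
        have "closure (box p q) \<subseteq> cbox c d"
          using pq by (intro closure_minimal closed_cbox) (use box_subset_cbox in blast)
        then show ?thesis using that cd by simp
      qed
      then have "(\<integral>x. f x * indicator (box p q) x \<partial>lborel) = 0"
        using box0[of p q] by (cases "box p q = {}") auto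
      then show "(\<integral>x. f x * indicator (box c d) x * indicator (box a b) x \<partial>lborel) = 0"
        by (simp add: pq[symmetric] indicator_inter_arith mult_ac)
    qed
    moreover have "AE x in lborel. x \<notin> cbox c d - box c d"
    proof -
      have "cbox c d - box c d \<in> null_sets lebesgue"
        using negligible_frontier_interval by (simp add: negligible_iff_null_sets)
      then have "AE x in lebesgue. x \<notin> cbox c d - box c d" by (rule AE_not_in)
      then show ?thesis by (simp only: AE_completion_iff)
    qed
    ultimately show ?thesis by eventually_elim (auto simp: indicator_def split: if_splits)
  qed
  obtain \<D> where D: "countable \<D>" "\<D> \<subseteq> Pow U" "\<And>X. X \<in> \<D> \<Longrightarrow> \<exists>a b. X = cbox a b" "\<Union>\<D> = U"
    using open_countable_Union_open_cbox[OF U] by metis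
  have "AE x in lborel. \<forall>X\<in>\<D>. x \<in> X \<longrightarrow> f x = 0"
    using D(1)
  proof (rule AE_ball_countable[THEN iffD2], intro ballI)
    fix X assume "X \<in> \<D>"
    then obtain a b where "X = cbox a b" "cbox a b \<subseteq> U" using D(2,3) by blast
    then show "AE x in lborel. x \<in> X \<longrightarrow> f x = 0" using local by auto
  qed
  then show ?thesis by eventually_elim (use D(4) in blast)
qed


section \<open>Square integrable functions\<close>

lemma finite_measure_lebesgue_on_open:
  fixes U :: "'a::euclidean_space set"
  shows "open U \<Longrightarrow> bounded U \<Longrightarrow> finite_measure (lebesgue_on U)"
  by (simp add: finite_measure_lebesgue_on lmeasurable_open)

text \<open>Holds because Lebesgue measure is complete.\<close>

lemma borel_measurable_lebesgue_on_cong_AE: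
  fixes f g :: "'a::euclidean_space \<Rightarrow> real"
  assumes U: "open U" and f: "f \<in> borel_measurable (lebesgue_on U)"
    and fg: "AE z in lebesgue_on U. f z = g z"
  shows "g \<in> borel_measurable (lebesgue_on U)"
proof -
  have Us: "U \<in> sets lebesgue" using U by simp
  have "(\<lambda>z. if z \<in> U then f z else 0) \<in> borel_measurable lebesgue"
    using borel_measurable_if[OF Us] f by blast
  moreover have "AE z in lebesgue. (if z \<in> U then f z else 0) = (if z \<in> U then g z else 0)"
    using fg Us by (auto simp: AE_restrict_space_iff elim!: eventually_mono)
  ultimately have "(\<lambda>z. if z \<in> U then g z else 0) \<in> borel_measurable lebesgue"
    by (rule borel_measurable_AE)
  then show ?thesis using borel_measurable_if[OF Us] by blast
qed

lemma L2_onD: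
  assumes "u \<in> L2_on U"
  shows "u \<in> borel_measurable (lebesgue_on U)" "integrable (lebesgue_on U) (\<lambda>z. (u z)\<^sup>2)"
  using assms by (auto simp: L2_on_def)

lemma L2_norm_nonneg: "0 \<le> L2_norm U u"
  by (simp add: L2_norm_def)

lemma L2_norm_sq: "(L2_norm U u)\<^sup>2 = (\<integral>z. (u z)\<^sup>2 \<partial>lebesgue_on U)"
  by (simp add: L2_norm_def)

lemma L2_on_cong_AE:
  assumes U: "open U" and u: "u \<in> L2_on U" and uv: "AE z in lebesgue_on U. u z = v z"
  shows "v \<in> L2_on U"
proof -
  have v: "v \<in> borel_measurable (lebesgue_on U)"
    using borel_measurable_lebesgue_on_cong_AE[OF U L2_onD(1)[OF u] uv] .
  moreover have "integrable (lebesgue_on U) (\<lambda>z. (v z)\<^sup>2)"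
    by (rule integrable_cong_AE_imp[OF L2_onD(2)[OF u]])
       (use v uv in \<open>auto elim!: eventually_mono\<close>)
  ultimately show ?thesis by (simp add: L2_on_def)
qed

lemma L2_norm_cong_AE:
  assumes U: "open U" and u: "u \<in> L2_on U" and uv: "AE z in lebesgue_on U. u z = v z"
  shows "L2_norm U u = L2_norm U v"
  unfolding L2_norm_def
  by (intro arg_cong[where f=sqrt] integral_cong_AE)
     (use L2_onD(1)[OF u] L2_onD(1)[OF L2_on_cong_AE[OF assms]] uv in \<open>auto elim!: eventually_mono\<close>)

lemma L2_on_mult_integrable:
  assumes "u \<in> L2_on U" "v \<in> L2_on U"
  shows "integrable (lebesgue_on U) (\<lambda>z. u z * v z)"
proof (rule Bochner_Integration.integrable_bound)
  show "integrable (lebesgue_on U) (\<lambda>z. (u z)\<^sup>2 + (v z)\<^sup>2)"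
    using assms by (intro Bochner_Integration.integrable_add L2_onD)
  show "AE z in lebesgue_on U. norm (u z * v z) \<le> norm ((u z)\<^sup>2 + (v z)\<^sup>2)"
  proof (rule AE_I2)
    fix z
    have "2 * (\<bar>u z\<bar> * \<bar>v z\<bar>) \<le> (u z)\<^sup>2 + (v z)\<^sup>2"
      using sum_squares_bound[of "\<bar>u z\<bar>" "\<bar>v z\<bar>"] by simp
    moreover have "0 \<le> \<bar>u z\<bar> * \<bar>v z\<bar>" by simp
    ultimately have "\<bar>u z\<bar> * \<bar>v z\<bar> \<le> (u z)\<^sup>2 + (v z)\<^sup>2" by linarith
    then show "norm (u z * v z) \<le> norm ((u z)\<^sup>2 + (v z)\<^sup>2)"
      by (simp add: abs_mult)
  qed
qed (use assms in \<open>auto simp: L2_on_def\<close>)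

lemma L2_on_add:
  assumes "u \<in> L2_on U" "v \<in> L2_on U"
  shows "(\<lambda>z. u z + v z) \<in> L2_on U"
proof -
  have "integrable (lebesgue_on U) (\<lambda>z. (u z)\<^sup>2 + (v z)\<^sup>2 + 2 * (u z * v z))"
    using assms
    by (intro Bochner_Integration.integrable_add integrable_mult_right L2_onD L2_on_mult_integrable)
  then show ?thesis using assms
    by (auto simp: L2_on_def power2_sum mult.assoc)
qed

lemma L2_on_bounded_mult:
  assumes u: "u \<in> L2_on U" and c: "c \<in> borel_measurable (lebesgue_on U)"
    and B: "\<And>z. z \<in> U \<Longrightarrow> \<bar>c z\<bar> \<le> B"
  shows "(\<lambda>z. c z * u z) \<in> L2_on U"
proof -
  have "integrable (lebesgue_on U) (\<lambda>z. (c z * u z)\<^sup>2)"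
  proof (rule Bochner_Integration.integrable_bound)
    show "integrable (lebesgue_on U) (\<lambda>z. B\<^sup>2 * (u z)\<^sup>2)"
      using L2_onD(2)[OF u] by simp
    show "AE z in lebesgue_on U. norm ((c z * u z)\<^sup>2) \<le> norm (B\<^sup>2 * (u z)\<^sup>2)"
    proof (rule AE_I2)
      fix z assume "z \<in> space (lebesgue_on U)"
      then have "\<bar>c z\<bar>\<^sup>2 \<le> B\<^sup>2" using B by (intro power_mono) auto
      then show "norm ((c z * u z)\<^sup>2) \<le> norm (B\<^sup>2 * (u z)\<^sup>2)"
        by (simp add: power_mult_distrib mult_right_mono)
    qed
  qed (use c L2_onD(1)[OF u] in auto)
  then show ?thesis using c L2_onD(1)[OF u] by (auto simp: L2_on_def)
qed

lemma L2_on_cmult: "u \<in> L2_on U \<Longrightarrow> (\<lambda>z. c * u z) \<in> L2_on U"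
  by (rule L2_on_bounded_mult[where B="\<bar>c\<bar>"]) auto

lemma L2_on_diff:
  assumes "u \<in> L2_on U" "v \<in> L2_on U"
  shows "(\<lambda>z. u z - v z) \<in> L2_on U"
  using L2_on_add[OF assms(1) L2_on_cmult[OF assms(2), of "-1"]] by simp

lemma L2_on_zero: "(\<lambda>_. 0) \<in> L2_on U"
  by (simp add: L2_on_def)

lemma L2_on_sum: "(\<And>i. i \<in> I \<Longrightarrow> u i \<in> L2_on U) \<Longrightarrow> (\<lambda>z. \<Sum>i\<in>I. u i z) \<in> L2_on U"
  by (induction I rule: infinite_finite_induct) (auto intro: L2_on_zero L2_on_add)

lemma power2_diff_le: "(a - b)\<^sup>2 \<le> 2 * a\<^sup>2 + 2 * b\<^sup>2" for a b :: real
  using zero_le_power2[of "a + b"] by (simp add: power2_sum power2_diff)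

text \<open>This crude form of the triangle inequality loses only a factor that the
  constants below absorb.\<close>

lemma L2_norm_sq_diff_le:
  assumes "u \<in> L2_on U" "v \<in> L2_on U"
  shows "(L2_norm U (\<lambda>z. u z - v z))\<^sup>2 \<le> 2 * (L2_norm U u)\<^sup>2 + 2 * (L2_norm U v)\<^sup>2"
proof -
  have "(L2_norm U (\<lambda>z. u z - v z))\<^sup>2 \<le> (\<integral>z. 2 * (u z)\<^sup>2 + 2 * (v z)\<^sup>2 \<partial>lebesgue_on U)"
    unfolding L2_norm_sq using assms
    by (intro integral_mono L2_onD(2) L2_on_diff Bochner_Integration.integrable_add
        integrable_mult_right power2_diff_le)
  also have "\<dots> = 2 * (L2_norm U u)\<^sup>2 + 2 * (L2_norm U v)\<^sup>2"
    unfolding L2_norm_sq using assms by (simp add: L2_onD)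
  finally show ?thesis .
qed

lemma L2_norm_diff_le:
  assumes "u \<in> L2_on U" "v \<in> L2_on U"
  shows "L2_norm U (\<lambda>z. u z - v z) \<le> 2 * L2_norm U u + 2 * L2_norm U v"
proof (rule power2_le_imp_le)
  have "(L2_norm U (\<lambda>z. u z - v z))\<^sup>2 \<le> 2 * (L2_norm U u)\<^sup>2 + 2 * (L2_norm U v)\<^sup>2"
    by (rule L2_norm_sq_diff_le[OF assms])
  also have "\<dots> \<le> (2 * L2_norm U u + 2 * L2_norm U v)\<^sup>2"
    by (simp add: power2_sum L2_norm_nonneg)
  finally show "(L2_norm U (\<lambda>z. u z - v z))\<^sup>2 \<le> (2 * L2_norm U u + 2 * L2_norm U v)\<^sup>2" .
qed (simp add: L2_norm_nonneg)

lemma L2_on_mono: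
  fixes u :: "'a::euclidean_space \<Rightarrow> real"
  assumes "open V" "open U" "V \<subseteq> U" "u \<in> L2_on U"
  shows "u \<in> L2_on V"
proof -
  have "V \<in> sets lebesgue" using assms by simp
  have m: "u \<in> borel_measurable (lebesgue_on V)"
    using measurable_restrict_mono[OF L2_onD(1)[OF assms(4)] assms(3)] .
  have "integrable lebesgue (\<lambda>x. indicator U x *\<^sub>R (u x)\<^sup>2)"
    using L2_onD(2)[OF assms(4)] assms by (subst (asm) integrable_restrict_space) auto
  then have "integrable lebesgue (\<lambda>x. indicator V x *\<^sub>R (indicator U x *\<^sub>R (u x)\<^sup>2))"
    using assms(1) by (intro integrable_mult_indicator[where A=V]) simp_all
  moreover have "(\<lambda>x. indicator V x *\<^sub>R (indicator U x *\<^sub>R (u x)\<^sup>2)) = (\<lambda>x. indicator V x *\<^sub>R (u x)\<^sup>2)"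
    using assms(3) by (auto simp: indicator_def fun_eq_iff)
  ultimately have "integrable (lebesgue_on V) (\<lambda>x. (u x)\<^sup>2)"
    using assms by (subst integrable_restrict_space) auto
  then show ?thesis using m by (simp add: L2_on_def)
qed

lemma bounded_measurable_L2_on:
  fixes f :: "'a::euclidean_space \<Rightarrow> real"
  assumes "open U" "bounded U" "f \<in> borel_measurable (lebesgue_on U)" "\<And>z. z \<in> U \<Longrightarrow> \<bar>f z\<bar> \<le> B"
  shows "f \<in> L2_on U"
proof -
  interpret finite_measure "lebesgue_on U" using assms by (simp add: finite_measure_lebesgue_on_open)
  have "(\<lambda>_. 1) \<in> L2_on U" by (simp add: L2_on_def)
  from L2_on_bounded_mult[OF this assms(3,4)] show ?thesis by simp
qed

lemma L2_on_integrable: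
  fixes u :: "'a::euclidean_space \<Rightarrow> real"
  assumes "open U" "bounded U" "u \<in> L2_on U"
  shows "integrable (lebesgue_on U) u"
  using L2_on_mult_integrable[OF assms(3) bounded_measurable_L2_on[OF assms(1,2), of "\<lambda>_. 1" 1]] by simp

section \<open>Weak derivatives and Sobolev spaces\<close>

lemma test_function_smooth: "test_function U \<phi> \<Longrightarrow> smooth_on UNIV \<phi>"
  by (simp add: test_function_def)

lemma test_function_mono: "test_function V \<phi> \<Longrightarrow> V \<subseteq> U \<Longrightarrow> test_function U \<phi>"
  by (auto simp: test_function_def)

lemma test_function_zero_outside: "test_function U \<phi> \<Longrightarrow> z \<notin> U \<Longrightarrow> \<phi> z = 0"
  using closure_subset[of "{z. \<phi> z \<noteq> 0}"] by (auto simp: test_function_def)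

text \<open>Outside its support a test function vanishes on an open set, and with it all derivatives.\<close>

lemma test_function_frechet_derivative:
  assumes t: "test_function U \<phi>" and b: "b \<in> Basis"
  shows "test_function U (\<lambda>z. frechet_derivative \<phi> (at z) b)"
proof (rule test_function_if_support[where K="closure {z. \<phi> z \<noteq> 0}"])
  show "smooth_on UNIV (\<lambda>z. frechet_derivative \<phi> (at z) b)"
    using smooth_on_frechet_derivative t b by (auto simp: test_function_def)
  fix z assume nz: "frechet_derivative \<phi> (at z) b \<noteq> 0"
  show "z \<in> closure {z. \<phi> z \<noteq> 0}"
  proof (rule ccontr)
    assume z: "z \<notin> closure {z. \<phi> z \<noteq> 0}"
    have 0: "((\<lambda>_. 0::real) has_derivative (\<lambda>_. 0)) (at z)" by simp
    have "(\<phi> has_derivative (\<lambda>_. 0)) (at z)"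
      by (rule has_derivative_transform_within_open[OF 0, of "- closure {z. \<phi> z \<noteq> 0}"])
         (use z closure_subset[of "{z. \<phi> z \<noteq> 0}"] in auto)
    then show False using nz by (simp add: frechet_derivative_at[symmetric])
  qed
qed (use t in \<open>auto simp: test_function_def\<close>)

lemma test_function_bounded:
  assumes "test_function U \<phi>"
  obtains B where "\<And>z. \<bar>\<phi> z\<bar> \<le> B"
proof -
  let ?K = "closure {z. \<phi> z \<noteq> 0}"
  have "compact ?K" "continuous_on ?K \<phi>"
    using assms smooth_on_continuous[of \<phi>] continuous_on_subset[of UNIV \<phi> ?K]
    by (auto simp: test_function_def)
  then have "bounded (\<phi> ` ?K)" by (intro compact_imp_bounded compact_continuous_image)
  then obtain B where B: "\<And>z. z \<in> ?K \<Longrightarrow> \<bar>\<phi> z\<bar> \<le> B" by (auto simp: bounded_iff)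
  have "\<bar>\<phi> z\<bar> \<le> max B 0" for z
    using B[of z] closure_subset[of "{z. \<phi> z \<noteq> 0}"] by (cases "\<phi> z = 0") (auto simp: le_max_iff_disj)
  then show thesis by (rule that)
qed

lemma test_function_measurable:
  "test_function U \<phi> \<Longrightarrow> \<phi> \<in> borel_measurable borel"
  by (auto simp: test_function_def intro!: borel_measurable_continuous_onI smooth_on_continuous)

lemma test_function_L2_on:
  assumes "open V" "bounded V" "test_function U \<phi>"
  shows "\<phi> \<in> L2_on V"
proof -
  obtain B where "\<And>z. \<bar>\<phi> z\<bar> \<le> B" using test_function_bounded[OF assms(3)] by blast
  then show ?thesis
    using assms test_function_measurable[OF assms(3)]
    by (intro bounded_measurable_L2_on[where B=B])
       (auto intro!: measurable_restrict_space1 measurable_completion)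
qed

text \<open>The difference of two weak derivatives annihilates all test functions, in particular the
  bumps. This makes the choice in \<open>weak_deriv\<close> immaterial up to null sets, so that the chosen
  derivatives are linear almost everywhere.\<close>

lemma has_weak_deriv_unique:
  fixes u :: "'a::euclidean_space \<Rightarrow> real"
  assumes U: "open U" "bounded U" and g: "has_weak_deriv U b u g" and h: "has_weak_deriv U b u h"
  shows "AE z in lebesgue_on U. g z = h z"
proof -
  have gL: "g \<in> L2_on U" and hL: "h \<in> L2_on U" using g h by (auto simp: has_weak_deriv_def)
  have d: "(\<lambda>z. g z - h z) \<in> L2_on U" by (rule L2_on_diff[OF gL hL])
  obtain f where f: "f \<in> borel_measurable borel" "\<And>z. z \<notin> U \<Longrightarrow> f z = 0"
    "AE z in lebesgue_on U. g z - h z = f z"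
    using lebesgue_on_borel_representative[OF U(1) L2_onD(1)[OF d]] by blast
  have fL: "f \<in> L2_on U" using L2_on_cong_AE[OF U(1) d f(3)] .
  have "AE x in lborel. x \<in> U \<longrightarrow> f x = 0"
  proof (rule AE_lborel_eq_0_if_bump_integrals_0[OF U(1)])
    show "integrable lborel f"
      using integral_lebesgue_on_eq_lborel(2)[OF U(1) f(1,2)] L2_on_integrable[OF U fL] by blast
    fix k and p q :: 'a
    assume "cbox p q \<subseteq> U"
    then have t: "test_function U (bump k p q)" by (rule test_function_bump)
    note bL = test_function_L2_on[OF U t] and bm = test_function_measurable[OF t]
    have "(\<integral>x. f x * bump k p q x \<partial>lborel) = (\<integral>x. f x * bump k p q x \<partial>lebesgue_on U)"
      using f bm by (intro integral_lebesgue_on_eq_lborel(1)[symmetric] U(1)) auto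
    also have "\<dots> = (\<integral>x. g x * bump k p q x - h x * bump k p q x \<partial>lebesgue_on U)"
      using L2_onD(1)[OF fL] L2_onD(1)[OF gL] L2_onD(1)[OF hL] L2_onD(1)[OF bL] f(3)
      by (intro integral_cong_AE) (auto simp: algebra_simps elim!: eventually_mono)
    also have "\<dots> = (\<integral>x. g x * bump k p q x \<partial>lebesgue_on U) - (\<integral>x. h x * bump k p q x \<partial>lebesgue_on U)"
      by (intro Bochner_Integration.integral_diff L2_on_mult_integrable gL hL bL)
    also have "\<dots> = 0" using g h t by (auto simp: has_weak_deriv_def)
    finally show "(\<integral>x. f x * bump k p q x \<partial>lborel) = 0" .
  qed
  then have "AE z in lebesgue_on U. f z = 0" using AE_lebesgue_on_iff_lborel[OF U(1)] by blast
  with f(3) show ?thesis by eventually_elim simp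
qed

lemma has_weak_deriv_cong_AE:
  fixes u :: "'a::euclidean_space \<Rightarrow> real"
  assumes U: "open U" "bounded U" and h: "has_weak_deriv U b u g" and b: "b \<in> Basis"
    and u: "AE z in lebesgue_on U. u z = u' z" and g: "AE z in lebesgue_on U. g z = g' z"
  shows "has_weak_deriv U b u' g'"
proof -
  have L: "u \<in> L2_on U" "g \<in> L2_on U" using h by (auto simp: has_weak_deriv_def)
  have L': "u' \<in> L2_on U" "g' \<in> L2_on U"
    using L2_on_cong_AE[OF U(1) L(1) u] L2_on_cong_AE[OF U(1) L(2) g] .
  have c: "(\<integral>z. f z * p z \<partial>lebesgue_on U) = (\<integral>z. f' z * p z \<partial>lebesgue_on U)"
    if "f \<in> L2_on U" "f' \<in> L2_on U" "p \<in> L2_on U" "AE z in lebesgue_on U. f z = f' z" for f f' p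
    using that by (intro integral_cong_AE) (auto dest!: L2_onD(1) elim!: eventually_mono)
  show ?thesis
    unfolding has_weak_deriv_def
  proof (intro conjI allI impI L')
    fix \<phi> assume t: "test_function U \<phi>"
    have "(\<integral>z. u' z * frechet_derivative \<phi> (at z) b \<partial>lebesgue_on U) =
        (\<integral>z. u z * frechet_derivative \<phi> (at z) b \<partial>lebesgue_on U)"
      by (rule c[OF L(1) L'(1) test_function_L2_on[OF U test_function_frechet_derivative[OF t b]] u, symmetric])
    also have "\<dots> = - (\<integral>z. g z * \<phi> z \<partial>lebesgue_on U)"
      using h t by (auto simp: has_weak_deriv_def)
    also have "(\<integral>z. g z * \<phi> z \<partial>lebesgue_on U) = (\<integral>z. g' z * \<phi> z \<partial>lebesgue_on U)"
      by (rule c[OF L(2) L'(2) test_function_L2_on[OF U t] g])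
    finally show "(\<integral>z. u' z * frechet_derivative \<phi> (at z) b \<partial>lebesgue_on U) =
        - (\<integral>z. g' z * \<phi> z \<partial>lebesgue_on U)" .
  qed
qed

lemma has_weak_deriv_diff:
  fixes u :: "'a::euclidean_space \<Rightarrow> real"
  assumes U: "open U" "bounded U" and b: "b \<in> Basis"
    and 1: "has_weak_deriv U b u1 g1" and 2: "has_weak_deriv U b u2 g2"
  shows "has_weak_deriv U b (\<lambda>z. u1 z - u2 z) (\<lambda>z. g1 z - g2 z)"
proof -
  have L: "u1 \<in> L2_on U" "u2 \<in> L2_on U" "g1 \<in> L2_on U" "g2 \<in> L2_on U"
    using 1 2 by (auto simp: has_weak_deriv_def)
  show ?thesis
    unfolding has_weak_deriv_def
  proof (intro conjI allI impI L2_on_diff L)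
    fix \<phi> assume t: "test_function U \<phi>"
    note p = test_function_L2_on[OF U t] 
      and p' = test_function_L2_on[OF U test_function_frechet_derivative[OF t b]]
    note i = L2_on_mult_integrable[OF L(1) p'] L2_on_mult_integrable[OF L(2) p']
       L2_on_mult_integrable[OF L(3) p] L2_on_mult_integrable[OF L(4) p]
    show "(\<integral>z. (u1 z - u2 z) * frechet_derivative \<phi> (at z) b \<partial>lebesgue_on U) =
        - (\<integral>z. (g1 z - g2 z) * \<phi> z \<partial>lebesgue_on U)"
      using 1 2 t i by (simp add: left_diff_distrib has_weak_deriv_def)
  qed
qed

lemma integral_lebesgue_on_mono_domain:
  fixes f :: "'a::euclidean_space \<Rightarrow> real"
  assumes "open V" "open U" "V \<subseteq> U" "\<And>z. z \<notin> V \<Longrightarrow> f z = 0"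
  shows "(\<integral>z. f z \<partial>lebesgue_on V) = (\<integral>z. f z \<partial>lebesgue_on U)"
proof -
  have "(\<lambda>x. indicator V x *\<^sub>R f x) = (\<lambda>x. indicator U x *\<^sub>R f x)"
    using assms(3,4) by (auto simp: indicator_def fun_eq_iff)
  then show ?thesis using assms by (simp add: integral_restrict_space)
qed

text \<open>Test functions of the smaller set are test functions of the larger one, and their integrals
  only see the smaller set.\<close>

lemma has_weak_deriv_mono:
  fixes u :: "'a::euclidean_space \<Rightarrow> real"
  assumes V: "open V" "open U" "V \<subseteq> U" and b: "b \<in> Basis" and h: "has_weak_deriv U b u g"
  shows "has_weak_deriv V b u g"
  unfolding has_weak_deriv_def
proof (intro conjI allI impI)
  show "u \<in> L2_on V" "g \<in> L2_on V"
    using h by (auto simp: has_weak_deriv_def intro: L2_on_mono[OF V])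
  fix \<phi> assume t: "test_function V \<phi>"
  have "test_function U \<phi>" using test_function_mono[OF t V(3)] .
  then have "(\<integral>z. u z * frechet_derivative \<phi> (at z) b \<partial>lebesgue_on U) = - (\<integral>z. g z * \<phi> z \<partial>lebesgue_on U)"
    using h by (auto simp: has_weak_deriv_def)
  then show "(\<integral>z. u z * frechet_derivative \<phi> (at z) b \<partial>lebesgue_on V) = - (\<integral>z. g z * \<phi> z \<partial>lebesgue_on V)"
    using test_function_zero_outside[OF t]
      test_function_zero_outside[OF test_function_frechet_derivative[OF t b]]
    by (subst (1 2) integral_lebesgue_on_mono_domain[OF V]) auto
qed

lemma has_weak_deriv_weak_deriv:
  "has_weak_deriv U b u g \<Longrightarrow> has_weak_deriv U b u (weak_deriv U b u)"
  unfolding weak_deriv_def by (rule someI[of "has_weak_deriv U b u"])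

lemma weak_deriv_L2_on: "has_weak_deriv U b u g \<Longrightarrow> weak_deriv U b u \<in> L2_on U"
  using has_weak_deriv_weak_deriv by (auto simp: has_weak_deriv_def)

lemma weak_deriv_AE:
  fixes u :: "'a::euclidean_space \<Rightarrow> real"
  shows "open U \<Longrightarrow> bounded U \<Longrightarrow> has_weak_deriv U b u g \<Longrightarrow>
    AE z in lebesgue_on U. weak_deriv U b u z = g z"
  using has_weak_deriv_unique[OF _ _ has_weak_deriv_weak_deriv] by blast

lemma H1D:
  assumes "u \<in> H1 U" "b \<in> Basis"
  shows "has_weak_deriv U b u (weak_deriv U b u)"
proof -
  from assms obtain g where "has_weak_deriv U b u g" by (auto simp: H1_def)
  then show ?thesis by (rule has_weak_deriv_weak_deriv)
qed

lemma H1_L2_on: "u \<in> H1 U \<Longrightarrow> u \<in> L2_on U"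
  by (simp add: H1_def)

lemma H1_cong_AE:
  fixes u :: "'a::euclidean_space \<Rightarrow> real"
  assumes U: "open U" "bounded U" and u: "u \<in> H1 U" and uv: "AE z in lebesgue_on U. u z = v z"
  shows "v \<in> H1 U"
proof -
  have "has_weak_deriv U b v (weak_deriv U b u)" if "b \<in> Basis" for b
    by (rule has_weak_deriv_cong_AE[OF U H1D[OF u that] that uv]) simp
  moreover have "v \<in> L2_on U" by (rule L2_on_cong_AE[OF U(1) H1_L2_on[OF u] uv])
  ultimately show ?thesis by (auto simp: H1_def)
qed

lemma H1_diff:
  fixes u :: "'a::euclidean_space \<Rightarrow> real"
  assumes U: "open U" "bounded U" and u: "u \<in> H1 U" and v: "v \<in> H1 U"
  shows "(\<lambda>z. u z - v z) \<in> H1 U"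
  using has_weak_deriv_diff[OF U _ H1D[OF u] H1D[OF v]] H1_L2_on[OF u] H1_L2_on[OF v]
  by (auto simp: H1_def intro: L2_on_diff)

lemma H2_H1: "u \<in> H2 U \<Longrightarrow> u \<in> H1 U"
  by (auto simp: H1_def H2_def)

text \<open>The definition of \<open>H2\<close> provides some weak derivative in \<open>H1\<close>; every other choice
  agrees with it almost everywhere.\<close>

lemma H2_weak_deriv_H1:
  fixes u :: "'a::euclidean_space \<Rightarrow> real"
  assumes U: "open U" "bounded U" and u: "u \<in> H2 U" and b: "b \<in> Basis"
  shows "weak_deriv U b u \<in> H1 U"
proof -
  obtain g where g: "has_weak_deriv U b u g" "g \<in> H1 U" using u b by (auto simp: H2_def)
  show ?thesis
    by (rule H1_cong_AE[OF U g(2)]) (use weak_deriv_AE[OF U g(1)] in \<open>auto elim!: eventually_mono\<close>)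
qed

lemma weak_deriv_diff_AE:
  fixes u :: "'a::euclidean_space \<Rightarrow> real"
  assumes U: "open U" "bounded U" and u: "u \<in> H1 U" and v: "v \<in> H1 U" and b: "b \<in> Basis"
  shows "AE z in lebesgue_on U. weak_deriv U b (\<lambda>z. u z - v z) z = weak_deriv U b u z - weak_deriv U b v z"
  by (rule weak_deriv_AE[OF U has_weak_deriv_diff[OF U b H1D[OF u b] H1D[OF v b]]])

lemma weak_deriv_cong_AE:
  fixes u :: "'a::euclidean_space \<Rightarrow> real"
  assumes U: "open U" "bounded U" and u: "u \<in> H1 U" and b: "b \<in> Basis"
    and uv: "AE z in lebesgue_on U. u z = v z"
  shows "AE z in lebesgue_on U. weak_deriv U b v z = weak_deriv U b u z"
  by (rule weak_deriv_AE[OF U has_weak_deriv_cong_AE[OF U H1D[OF u b] b uv]]) simp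

lemma H2_diff:
  fixes u :: "'a::euclidean_space \<Rightarrow> real"
  assumes U: "open U" "bounded U" and u: "u \<in> H2 U" and v: "v \<in> H2 U"
  shows "(\<lambda>z. u z - v z) \<in> H2 U"
proof -
  have "has_weak_deriv U b (\<lambda>z. u z - v z) (\<lambda>z. weak_deriv U b u z - weak_deriv U b v z)"
    "(\<lambda>z. weak_deriv U b u z - weak_deriv U b v z) \<in> H1 U" if b: "b \<in> Basis" for b
    using has_weak_deriv_diff[OF U b H1D[OF H2_H1[OF u] b] H1D[OF H2_H1[OF v] b]]
      H1_diff[OF U H2_weak_deriv_H1[OF U u b] H2_weak_deriv_H1[OF U v b]] .
  then show ?thesis
    using H1_L2_on[OF H2_H1[OF u]] H1_L2_on[OF H2_H1[OF v]]
    unfolding H2_def by (blast intro: L2_on_diff)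
qed

lemma weak_deriv2_diff_AE:
  fixes u :: "'a::euclidean_space \<Rightarrow> real"
  assumes U: "open U" "bounded U" and u: "u \<in> H2 U" and v: "v \<in> H2 U"
    and b: "b \<in> Basis" and b': "b' \<in> Basis"
  shows "AE z in lebesgue_on U. weak_deriv U b' (weak_deriv U b (\<lambda>z. u z - v z)) z =
    weak_deriv U b' (weak_deriv U b u) z - weak_deriv U b' (weak_deriv U b v) z"
proof -
  note D = H2_weak_deriv_H1[OF U u b] H2_weak_deriv_H1[OF U v b]
  have "AE z in lebesgue_on U. weak_deriv U b' (weak_deriv U b (\<lambda>z. u z - v z)) z =
      weak_deriv U b' (\<lambda>z. weak_deriv U b u z - weak_deriv U b v z) z"
    by (rule weak_deriv_cong_AE[OF U H1_diff[OF U D] b'])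
       (use weak_deriv_diff_AE[OF U H2_H1[OF u] H2_H1[OF v] b] in \<open>auto elim!: eventually_mono\<close>)
  with weak_deriv_diff_AE[OF U D b'] show ?thesis by eventually_elim simp
qed

lemma sets_hausdorff_measure: "sets (hausdorff_measure k) = sets borel"
  by (simp add: hausdorff_measure_def sets.sigma_sets_eq[of borel, simplified])

section \<open>Vanishing lateral traces\<close>

text \<open>The differences of the approximating smooth functions approximate the difference. Their
  surface integrals can be compared because the surface measure is defined on the Borel sets.\<close>

lemma has_boundary_trace_zero_diff:
  fixes u v :: "'a::euclidean_space \<Rightarrow> real"
  assumes U: "open U" "bounded U" and \<Gamma>: "\<Gamma> \<in> sets borel"
    and u: "has_boundary_trace U \<Gamma> u (\<lambda>_. 0)" and v: "has_boundary_trace U \<Gamma> v (\<lambda>_. 0)"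
  shows "has_boundary_trace U \<Gamma> (\<lambda>z. u z - v z) (\<lambda>_. 0)"
proof -
  let ?H = "hausdorff_measure (DIM('a) - 1) :: 'a measure"
  have uv: "u \<in> H1 U" "v \<in> H1 U" using u v by (auto simp: has_boundary_trace_def)
  note uvL = uv[THEN H1_L2_on]
  obtain p where p: "\<And>k. smooth_on UNIV (p k)" "\<And>k. p k \<in> L2_on U"
      "\<And>k b. b \<in> Basis \<Longrightarrow> (\<lambda>z. frechet_derivative (p k) (at z) b) \<in> L2_on U"
      "(\<lambda>k. L2_norm U (\<lambda>z. p k z - u z)) \<longlonglongrightarrow> 0"
      "\<And>b. b \<in> Basis \<Longrightarrow> (\<lambda>k. L2_norm U (\<lambda>z. frechet_derivative (p k) (at z) b - weak_deriv U b u z)) \<longlonglongrightarrow> 0"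
      "(\<lambda>k. \<integral>\<^sup>+z\<in>\<Gamma>. ennreal ((p k z)\<^sup>2) \<partial>?H) \<longlonglongrightarrow> 0"
    using u unfolding has_boundary_trace_def by auto
  obtain q where q: "\<And>k. smooth_on UNIV (q k)" "\<And>k. q k \<in> L2_on U"
      "\<And>k b. b \<in> Basis \<Longrightarrow> (\<lambda>z. frechet_derivative (q k) (at z) b) \<in> L2_on U"
      "(\<lambda>k. L2_norm U (\<lambda>z. q k z - v z)) \<longlonglongrightarrow> 0"
      "\<And>b. b \<in> Basis \<Longrightarrow> (\<lambda>k. L2_norm U (\<lambda>z. frechet_derivative (q k) (at z) b - weak_deriv U b v z)) \<longlonglongrightarrow> 0"
      "(\<lambda>k. \<integral>\<^sup>+z\<in>\<Gamma>. ennreal ((q k z)\<^sup>2) \<partial>?H) \<longlonglongrightarrow> 0"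
    using v unfolding has_boundary_trace_def by auto
  define r where "r = (\<lambda>k z. p k z - q k z)"
  have dr: "frechet_derivative (r k) (at z) b = frechet_derivative (p k) (at z) b - frechet_derivative (q k) (at z) b"
    for k z b
    using frechet_derivative_at[OF has_derivative_diff[OF smooth_on_has_derivative[OF p(1)]
          smooth_on_has_derivative[OF q(1)]], of k z k]
    by (simp add: r_def fun_eq_iff)
  have squeeze: "(\<lambda>k. L2_norm U (\<lambda>z. (P k z - Q k z) - w z)) \<longlonglongrightarrow> 0"
    if "\<And>k. P k \<in> L2_on U" "\<And>k. Q k \<in> L2_on U" "w1 \<in> L2_on U" "w2 \<in> L2_on U"
      and w: "AE z in lebesgue_on U. w z = w1 z - w2 z"
      and l: "(\<lambda>k. L2_norm U (\<lambda>z. P k z - w1 z)) \<longlonglongrightarrow> 0" "(\<lambda>k. L2_norm U (\<lambda>z. Q k z - w2 z)) \<longlonglongrightarrow> 0"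
    for P Q and w1 w2 w :: "'a \<Rightarrow> real"
  proof (rule tendsto_sandwich[OF _ _ tendsto_const])
    have "L2_norm U (\<lambda>z. (P k z - Q k z) - w z) \<le> 2 * L2_norm U (\<lambda>z. P k z - w1 z) + 2 * L2_norm U (\<lambda>z. Q k z - w2 z)" for k
    proof -
      have "L2_norm U (\<lambda>z. (P k z - w1 z) - (Q k z - w2 z)) = L2_norm U (\<lambda>z. (P k z - Q k z) - w z)"
        by (rule L2_norm_cong_AE[OF U(1)]) (use that in \<open>auto intro!: L2_on_diff elim!: eventually_mono\<close>)
      moreover have "L2_norm U (\<lambda>z. (P k z - w1 z) - (Q k z - w2 z)) \<le>
          2 * L2_norm U (\<lambda>z. P k z - w1 z) + 2 * L2_norm U (\<lambda>z. Q k z - w2 z)"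
        by (rule L2_norm_diff_le) (use that in \<open>auto intro!: L2_on_diff\<close>)
      ultimately show ?thesis by simp
    qed
    then show "\<forall>\<^sub>F k in sequentially. L2_norm U (\<lambda>z. (P k z - Q k z) - w z) \<le>
        2 * L2_norm U (\<lambda>z. P k z - w1 z) + 2 * L2_norm U (\<lambda>z. Q k z - w2 z)" by simp
    show "(\<lambda>k. 2 * L2_norm U (\<lambda>z. P k z - w1 z) + 2 * L2_norm U (\<lambda>z. Q k z - w2 z)) \<longlonglongrightarrow> 0"
      using tendsto_add[OF tendsto_mult_left[OF l(1), of 2] tendsto_mult_left[OF l(2), of 2]] by simp
  qed (simp add: L2_norm_nonneg)
  have meas: "f \<in> borel_measurable ?H \<longleftrightarrow> f \<in> borel_measurable borel" for f :: "'a \<Rightarrow> ennreal"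
    using measurable_cong_sets[OF sets_hausdorff_measure refl] by blast
  have pqm: "p k \<in> borel_measurable borel" "q k \<in> borel_measurable borel" for k
    using p(1) q(1) by (auto intro!: borel_measurable_continuous_onI smooth_on_continuous)
  have le: "(\<integral>\<^sup>+z\<in>\<Gamma>. ennreal ((r k z)\<^sup>2) \<partial>?H) \<le>
      2 * (\<integral>\<^sup>+z\<in>\<Gamma>. ennreal ((p k z)\<^sup>2) \<partial>?H) + 2 * (\<integral>\<^sup>+z\<in>\<Gamma>. ennreal ((q k z)\<^sup>2) \<partial>?H)" for k
  proof -
    have [measurable]: "(\<lambda>z. ennreal ((p k z)\<^sup>2) * indicator \<Gamma> z) \<in> borel_measurable ?H"
      "(\<lambda>z. ennreal ((q k z)\<^sup>2) * indicator \<Gamma> z) \<in> borel_measurable ?H"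
      unfolding meas using pqm \<Gamma> by measurable
    have "(\<integral>\<^sup>+z\<in>\<Gamma>. ennreal ((r k z)\<^sup>2) \<partial>?H) \<le>
      (\<integral>\<^sup>+z. 2 * (ennreal ((p k z)\<^sup>2) * indicator \<Gamma> z) + 2 * (ennreal ((q k z)\<^sup>2) * indicator \<Gamma> z) \<partial>?H)"
    proof (rule nn_integral_mono)
      fix z
      have "ennreal ((r k z)\<^sup>2) \<le> ennreal (2 * (p k z)\<^sup>2 + 2 * (q k z)\<^sup>2)"
        unfolding r_def by (intro ennreal_leI power2_diff_le)
      also have "\<dots> = 2 * ennreal ((p k z)\<^sup>2) + 2 * ennreal ((q k z)\<^sup>2)"
        by (simp add: ennreal_mult')
      finally show "ennreal ((r k z)\<^sup>2) * indicator \<Gamma> z \<le>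
          2 * (ennreal ((p k z)\<^sup>2) * indicator \<Gamma> z) + 2 * (ennreal ((q k z)\<^sup>2) * indicator \<Gamma> z)"
        by (simp add: indicator_def)
    qed
    also have "\<dots> = 2 * (\<integral>\<^sup>+z\<in>\<Gamma>. ennreal ((p k z)\<^sup>2) \<partial>?H) + 2 * (\<integral>\<^sup>+z\<in>\<Gamma>. ennreal ((q k z)\<^sup>2) \<partial>?H)"
      by (simp add: nn_integral_add nn_integral_cmult del: One_nat_def)
    finally show ?thesis .
  qed
  have "(\<lambda>k. 2 * (\<integral>\<^sup>+z\<in>\<Gamma>. ennreal ((p k z)\<^sup>2) \<partial>?H) + 2 * (\<integral>\<^sup>+z\<in>\<Gamma>. ennreal ((q k z)\<^sup>2) \<partial>?H)) \<longlonglongrightarrow> 2 * 0 + 2 * 0"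
    by (intro tendsto_add ennreal_tendsto_cmult p(6) q(6)) auto
  then have lim: "(\<lambda>k. 2 * (\<integral>\<^sup>+z\<in>\<Gamma>. ennreal ((p k z)\<^sup>2) \<partial>?H) + 2 * (\<integral>\<^sup>+z\<in>\<Gamma>. ennreal ((q k z)\<^sup>2) \<partial>?H)) \<longlonglongrightarrow> 0"
    by simp
  have tr: "(\<lambda>k. \<integral>\<^sup>+z\<in>\<Gamma>. ennreal ((r k z)\<^sup>2) \<partial>?H) \<longlonglongrightarrow> 0"
    by (rule tendsto_sandwich[OF _ _ tendsto_const lim]) (use le in auto)
  show ?thesis
    unfolding has_boundary_trace_def
  proof (intro conjI exI[of _ r] allI ballI)
    show "(\<lambda>z. u z - v z) \<in> H1 U" by (rule H1_diff[OF U uv])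
    show "smooth_on UNIV (r k)" for k unfolding r_def by (intro smooth_on_diff p q)
    show "r k \<in> L2_on U" for k unfolding r_def by (intro L2_on_diff p q)
    show "(\<lambda>z. frechet_derivative (r k) (at z) b) \<in> L2_on U" if "b \<in> Basis" for k b
      unfolding dr by (intro L2_on_diff p q that)
    show "(\<lambda>k. L2_norm U (\<lambda>z. r k z - (u z - v z))) \<longlonglongrightarrow> 0"
      unfolding r_def by (rule squeeze[OF p(2) q(2) uvL _ p(4) q(4)]) simp
    show "(\<lambda>k. L2_norm U (\<lambda>z. frechet_derivative (r k) (at z) b - weak_deriv U b (\<lambda>z. u z - v z) z)) \<longlonglongrightarrow> 0"
      if b: "b \<in> Basis" for b
      unfolding dr
      by (rule squeeze[OF p(3)[OF b] q(3)[OF b] weak_deriv_L2_on[OF H1D[OF uv(1) b]]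
            weak_deriv_L2_on[OF H1D[OF uv(2) b]] weak_deriv_diff_AE[OF U uv b] p(5)[OF b] q(5)[OF b]])
    show "(\<lambda>k. \<integral>\<^sup>+z\<in>\<Gamma>. ennreal ((r k z - 0)\<^sup>2) \<partial>?H) \<longlonglongrightarrow> 0"
      using tr by simp
  qed simp
qed


section \<open>Product integration and primitives\<close>

lemma nn_integral_lborel_eq_L2_norm:
  fixes f :: "'a::euclidean_space \<Rightarrow> real"
  assumes U: "open U" and f: "f \<in> borel_measurable borel" "\<And>z. z \<notin> U \<Longrightarrow> f z = 0" "f \<in> L2_on U"
  shows "(\<integral>\<^sup>+z. ennreal ((f z)\<^sup>2) \<partial>lborel) = ennreal ((L2_norm U f)\<^sup>2)"
proof -
  have "integrable lborel (\<lambda>z. (f z)\<^sup>2)" "(\<integral>z. (f z)\<^sup>2 \<partial>lebesgue_on U) = (\<integral>z. (f z)\<^sup>2 \<partial>lborel)"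
    using integral_lebesgue_on_eq_lborel[OF U, of "\<lambda>z. (f z)\<^sup>2"] f L2_onD(2)[OF f(3)] by auto
  then show ?thesis
    by (simp add: nn_integral_eq_integral L2_norm_sq)
qed

lemma L2_on_if_nn_integral_le:
  fixes f :: "'a::euclidean_space \<Rightarrow> real"
  assumes U: "open U" and [measurable]: "f \<in> borel_measurable borel"
    and le: "(\<integral>\<^sup>+z. ennreal ((f z)\<^sup>2) * indicator U z \<partial>lborel) \<le> ennreal c" and c: "0 \<le> c"
  shows "f \<in> L2_on U" "(L2_norm U f)\<^sup>2 \<le> c"
proof -
  have [measurable]: "U \<in> sets borel" using U by simp
  define f' where "f' = (\<lambda>z. f z * indicator U z)"
  have f': "f' \<in> borel_measurable borel" "\<And>z. z \<notin> U \<Longrightarrow> f' z = 0"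
    unfolding f'_def using U by auto
  have "(\<integral>\<^sup>+z. ennreal ((f' z)\<^sup>2) \<partial>lborel) = (\<integral>\<^sup>+z. ennreal ((f z)\<^sup>2) * indicator U z \<partial>lborel)"
    by (intro nn_integral_cong) (auto simp: f'_def indicator_def)
  then have le': "(\<integral>\<^sup>+z. ennreal ((f' z)\<^sup>2) \<partial>lborel) \<le> ennreal c" using le by simp
  then have i: "integrable lborel (\<lambda>z. (f' z)\<^sup>2)"
    using f' by (intro integrableI_nonneg) (auto simp: less_top[symmetric] top_unique)
  then have "integrable (lebesgue_on U) (\<lambda>z. (f' z)\<^sup>2)"
    using integral_lebesgue_on_eq_lborel(2)[OF U, of "\<lambda>z. (f' z)\<^sup>2"] f' by auto
  then have f'L: "f' \<in> L2_on U"
    using f' by (auto simp: L2_on_def intro!: measurable_restrict_space1 measurable_completion)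
  have e: "AE z in lebesgue_on U. f' z = f z" by (rule AE_I2) (auto simp: f'_def)
  show "f \<in> L2_on U" by (rule L2_on_cong_AE[OF U f'L e])
  have "ennreal ((L2_norm U f')\<^sup>2) \<le> ennreal c"
    using nn_integral_lborel_eq_L2_norm[OF U f' f'L] le' by simp
  then show "(L2_norm U f)\<^sup>2 \<le> c"
    using c L2_norm_cong_AE[OF U f'L e] by simp
qed

text \<open>Sections of a null set are null for almost every value of the second coordinate, by
  Tonelli's theorem in the other order.\<close>

lemma AE_lborel_pair_swap:
  fixes P :: "'a::euclidean_space \<times> 'b::euclidean_space \<Rightarrow> bool"
  assumes "AE z in lborel. P z"
  shows "AE y in lborel. AE x in lborel. P (x, y)"
proof -
  obtain N where N: "{z. \<not> P z} \<subseteq> N" "emeasure lborel N = 0" "N \<in> sets borel"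
    using assms by (auto elim!: AE_E)
  have [measurable]: "N \<in> sets borel" by fact
  have m: "(\<lambda>z. indicator N z :: ennreal) \<in> borel_measurable (lborel \<Otimes>\<^sub>M lborel)"
    unfolding lborel_prod by simp
  have "(\<integral>\<^sup>+y. \<integral>\<^sup>+x. indicator N (x, y) \<partial>lborel \<partial>lborel) =
      (\<integral>\<^sup>+z. indicator N z \<partial>(lborel \<Otimes>\<^sub>M lborel))"
    using lborel_pair.nn_integral_snd[OF m] by simp
  also have "\<dots> = 0" using N by (simp add: lborel_prod)
  finally have "AE y in lborel. (\<integral>\<^sup>+x. indicator N (x, y) \<partial>lborel) = (0::ennreal)"
    by (subst (asm) nn_integral_0_iff_AE) (use N in \<open>auto simp: borel_prod[symmetric]\<close>)
  then show ?thesis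
  proof eventually_elim
    fix y assume "(\<integral>\<^sup>+x. indicator N (x, y) \<partial>lborel) = (0::ennreal)"
    then have "AE x in lborel. indicator N (x, y) = (0::ennreal)"
      by (subst (asm) nn_integral_0_iff_AE) (auto simp: borel_prod[symmetric])
    then show "AE x in lborel. P (x, y)"
      by eventually_elim (use N(1) in \<open>auto simp: indicator_def split: if_splits\<close>)
  qed
qed

lemma integrable_lborel_pair_mult:
  fixes f :: "'a::euclidean_space \<Rightarrow> real" and g :: "'b::euclidean_space \<Rightarrow> real"
  assumes f: "integrable lborel f" and g: "integrable lborel g"
  shows "integrable lborel (\<lambda>z. f (fst z) * g (snd z))"
    and "(\<integral>z. f (fst z) * g (snd z) \<partial>lborel) = (\<integral>x. f x \<partial>lborel) * (\<integral>y. g y \<partial>lborel)"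
proof -
  have [measurable]: "f \<in> borel_measurable borel" "g \<in> borel_measurable borel" using f g by auto
  have m: "(\<lambda>z. f (fst z) * g (snd z)) \<in> borel_measurable (lborel \<Otimes>\<^sub>M lborel)"
    by measurable
  have "integrable (lborel \<Otimes>\<^sub>M lborel) (\<lambda>z. f (fst z) * g (snd z))"
  proof (rule lborel_pair.Fubini_integrable[OF m])
    show "integrable lborel (\<lambda>x. \<integral>y. norm (f (fst (x, y)) * g (snd (x, y))) \<partial>lborel)"
      using f by (simp add: abs_mult)
    show "AE x in lborel. integrable lborel (\<lambda>y. f (fst (x, y)) * g (snd (x, y)))"
      using g by simp
  qed
  then show i: "integrable lborel (\<lambda>z. f (fst z) * g (snd z))" by (simp add: lborel_prod)
  then have i': "integrable (lborel \<Otimes>\<^sub>M lborel) (\<lambda>z. f (fst z) * g (snd z))" by (simp add: lborel_prod)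
  show "(\<integral>z. f (fst z) * g (snd z) \<partial>lborel) = (\<integral>x. f x \<partial>lborel) * (\<integral>y. g y \<partial>lborel)"
    using lborel_pair.integral_fst'[OF i'] by (simp add: lborel_prod)
qed

text \<open>A function is the derivative of a test function on the line exactly when its integral
  vanishes. Integrating from the right gives the form that Fubini's theorem needs below.\<close>

lemma smooth_antiderivative_compact_support:
  fixes f :: "real \<Rightarrow> real"
  assumes f: "smooth_on UNIV f" and supp: "\<And>t. f t \<noteq> 0 \<Longrightarrow> t \<in> {c..d}" and 0: "(\<integral>t. f t \<partial>lborel) = 0"
  obtains F where "smooth_on UNIV F" "\<And>t. (F has_real_derivative f t) (at t)"
    "\<And>t. F t \<noteq> 0 \<Longrightarrow> t \<in> {c..d}" "\<And>t. F t = - (\<integral>s. f s * indicator {t..} s \<partial>lborel)"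
proof -
  have cont: "isCont f t" for t
    using smooth_on_continuous[OF f] by (simp add: continuous_on_eq_continuous_at)
  obtain F0 where F0: "\<And>t. (F0 has_real_derivative f t) (at t)"
    using einterval_antiderivative[of "-\<infinity>" "\<infinity>" f] cont
    by (auto simp: has_real_derivative_iff_has_vector_derivative)
  define F where "F = (\<lambda>t. F0 t - F0 (max c d))"
  have F: "(F has_real_derivative f t) (at t)" for t
    unfolding F_def by (auto intro!: derivative_eq_intros F0)
  have FTC: "(\<integral>s. f s * indicator {a..b} s \<partial>lborel) = F b - F a" if "a \<le> b" for a b
    by (rule integral_FTC_Icc_real[OF that F cont])
  have right: "F t = 0" if "max c d \<le> t" for t
  proof -
    have "(\<integral>s. f s * indicator {max c d..t} s \<partial>lborel) = (\<integral>s. 0 * indicator {max c d} s \<partial>lborel)"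
    proof (rule integral_cong_AE)
      have "AE s in lborel. s \<noteq> max c d" by (rule AE_lborel_singleton)
      then show "AE s in lborel. f s * indicator {max c d..t} s = 0 * indicator {max c d} s"
        by eventually_elim (use supp in \<open>force simp: indicator_def\<close>)
    qed (use borel_measurable_continuous_onI[OF smooth_on_continuous[OF f]] in auto)
    then show ?thesis using FTC[OF that] by (simp add: F_def)
  qed
  have rep: "F t = - (\<integral>s. f s * indicator {t..} s \<partial>lborel)" for t
  proof -
    \<comment> \<open>Beyond \<open>e\<close> both \<open>F\<close> and \<open>f\<close> vanish, so the integral over a half line is one over \<open>[t, e]\<close>.\<close>
    define e where "e = max t (max c d)"
    have "(\<lambda>s. f s * indicator {t..} s) = (\<lambda>s. f s * indicator {t..e} s)"
    proof
      fix s show "f s * indicator {t..} s = f s * indicator {t..e} s"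
        using supp[of s] by (cases "f s = 0") (auto simp: e_def indicator_def)
    qed
    moreover have "F e = 0" by (rule right) (simp add: e_def)
    moreover have "t \<le> e" by (simp add: e_def)
    ultimately show ?thesis using FTC[of t e] by simp
  qed
  show ?thesis
  proof
    show "smooth_on UNIV F" by (rule smooth_on_antiderivative[OF F f])
    show "F t \<noteq> 0 \<Longrightarrow> t \<in> {c..d}" for t
    proof (rule ccontr)
      assume nz: "F t \<noteq> 0" and t: "t \<notin> {c..d}"
      have "(\<lambda>s. f s * indicator {t..} s) = f" if "t < c"
      proof
        fix s show "f s * indicator {t..} s = f s"
          using supp[of s] that by (cases "f s = 0") (auto simp: indicator_def)
      qed
      then have "t < c \<Longrightarrow> F t = 0" using rep[of t] 0 by simp
      moreover have "F t = 0" if "d < t"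
      proof -
        have "(\<lambda>s. f s * indicator {t..} s) = (\<lambda>s. 0)"
        proof
          fix s show "f s * indicator {t..} s = 0"
            using supp[of s] that by (cases "f s = 0") (auto simp: indicator_def)
        qed
        then show ?thesis using rep[of t] by simp
      qed
      ultimately show False using nz t by force
    qed
  qed (fact F rep)+
qed

text \<open>Integration by parts for a primitive of a merely integrable \<open>k\<close>: both sides are the double
  integral of \<open>k r * f t\<close> over the half plane \<open>r \<le> t\<close>.\<close>

lemma integral_by_parts_primitive:
  fixes k f F :: "real \<Rightarrow> real"
  assumes k: "integrable lborel k" and f: "integrable lborel f"
    and F: "\<And>r. F r = - (\<integral>t. f t * indicator {r..} t \<partial>lborel)"
  shows "(\<integral>r. k r * F r \<partial>lborel) = - (\<integral>t. (\<integral>r. k r * indicator {..t} r \<partial>lborel) * f t \<partial>lborel)"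
proof -
  have [measurable]: "k \<in> borel_measurable borel" "f \<in> borel_measurable borel" using f k by auto
  define I where "I = (\<lambda>r t. k r * f t * (if r \<le> t then 1 else 0))"
  have "integrable (lborel \<Otimes>\<^sub>M lborel) (\<lambda>(r, t). I r t)"
  proof (rule Bochner_Integration.integrable_bound)
    show "integrable (lborel \<Otimes>\<^sub>M lborel) (\<lambda>z. k (fst z) * f (snd z))"
      using integrable_lborel_pair_mult(1)[OF k f] by (simp add: lborel_prod)
    show "(\<lambda>(r, t). I r t) \<in> borel_measurable (lborel \<Otimes>\<^sub>M lborel)"
      unfolding I_def by measurable
  qed (auto simp: I_def)
  from lborel_pair.Fubini_integral[OF this]
  have "(\<integral>t. \<integral>r. I r t \<partial>lborel \<partial>lborel) = (\<integral>r. \<integral>t. I r t \<partial>lborel \<partial>lborel)" .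
  moreover have "(\<integral>r. I r t \<partial>lborel) = (\<integral>r. k r * indicator {..t} r \<partial>lborel) * f t" for t
  proof -
    have "(\<lambda>r. I r t) = (\<lambda>r. (k r * indicator {..t} r) * f t)" by (auto simp: I_def indicator_def)
    then show ?thesis by simp
  qed
  moreover have "(\<integral>t. I r t \<partial>lborel) = - (k r * F r)" for r
  proof -
    have "(\<lambda>t. I r t) = (\<lambda>t. k r * (f t * indicator {r..} t))" by (auto simp: I_def indicator_def)
    then show ?thesis by (simp add: F)
  qed
  ultimately show ?thesis by simp
qed

text \<open>Cauchy and Schwarz on \<open>[0, t]\<close>. Stated with nonnegative integrals, it holds even where
  \<open>k\<close> is not square integrable, so that no exceptional set of space points has to be carried along.\<close>

lemma primitive_square_le:
  fixes k :: "real \<Rightarrow> real"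
  assumes [measurable]: "k \<in> borel_measurable borel" and k0: "\<And>r. r \<le> 0 \<Longrightarrow> k r = 0" and t: "0 \<le> t"
  shows "ennreal ((\<integral>r. k r * indicator {..t} r \<partial>lborel)\<^sup>2) \<le> ennreal t * (\<integral>\<^sup>+r. ennreal ((k r)\<^sup>2) \<partial>lborel)"
proof -
  let ?I = "\<integral>r. k r * indicator {..t} r \<partial>lborel"
  have "ennreal \<bar>?I\<bar> \<le> (\<integral>\<^sup>+r. ennreal \<bar>k r\<bar> * indicator {0..t} r \<partial>lborel)"
  proof (cases "integrable lborel (\<lambda>r. k r * indicator {..t} r)")
    case True
    have "ennreal (norm ?I) \<le> (\<integral>\<^sup>+r. ennreal (norm (k r * indicator {..t} r)) \<partial>lborel)"
      by (rule integral_norm_bound_ennreal[OF True])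
    also have "\<dots> = (\<integral>\<^sup>+r. ennreal \<bar>k r\<bar> * indicator {0..t} r \<partial>lborel)"
    proof (rule nn_integral_cong)
      fix r show "ennreal (norm (k r * indicator {..t} r)) = ennreal \<bar>k r\<bar> * indicator {0..t} r"
        using k0[of r] by (cases "r \<le> 0") (auto simp: indicator_def)
    qed
    finally show ?thesis by simp
  qed (simp add: not_integrable_integral_eq)
  then have "ennreal (?I\<^sup>2) \<le> (\<integral>\<^sup>+r. ennreal \<bar>k r\<bar> * indicator {0..t} r \<partial>lborel)\<^sup>2"
    by (metis abs_ge_zero ennreal_power power2_abs power_mono_ennreal)
  also have "\<dots> \<le> (\<integral>\<^sup>+r. (ennreal \<bar>k r\<bar>)\<^sup>2 \<partial>lborel) * (\<integral>\<^sup>+r. (indicator {0..t} r)\<^sup>2 \<partial>lborel)"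
    by (rule Cauchy_Schwarz_nn_integral) auto
  also have "(\<integral>\<^sup>+r. (indicator {0..t} r)\<^sup>2 \<partial>lborel) = ennreal t"
  proof -
    have "(\<lambda>r. (indicator {0..t} r)\<^sup>2 :: ennreal) = indicator {0..t}" by (auto simp: indicator_def)
    then show ?thesis using t by simp
  qed
  also have "(\<integral>\<^sup>+r. (ennreal \<bar>k r\<bar>)\<^sup>2 \<partial>lborel) = (\<integral>\<^sup>+r. ennreal ((k r)\<^sup>2) \<partial>lborel)"
    by (simp add: ennreal_power)
  finally show ?thesis by (simp add: mult.commute)
qed


section \<open>Traces in time\<close>

lemma test_function_tensor:
  fixes \<phi> :: "'a::euclidean_space \<Rightarrow> real" and F :: "real \<Rightarrow> real"
  assumes \<phi>: "test_function \<Omega> \<phi>" and F: "smooth_on UNIV F" "\<And>t. F t \<noteq> 0 \<Longrightarrow> t \<in> {c..d}"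
    and cd: "{c..d} \<subseteq> I"
  shows "test_function (\<Omega> \<times> I) (\<lambda>z. \<phi> (fst z) * F (snd z))"
proof (rule test_function_if_support[where K="closure {x. \<phi> x \<noteq> 0} \<times> {c..d}"])
  show "smooth_on UNIV (\<lambda>z. \<phi> (fst z) * F (snd z))"
    by (intro smooth_on_mult smooth_on_linear[OF bounded_linear_fst] smooth_on_linear[OF bounded_linear_snd]
        test_function_smooth[OF \<phi>] F)
  show "compact (closure {x. \<phi> x \<noteq> 0} \<times> {c..d})"
    using \<phi> by (auto simp: test_function_def intro!: compact_Times)
  show "closure {x. \<phi> x \<noteq> 0} \<times> {c..d} \<subseteq> \<Omega> \<times> I"
    using \<phi> cd by (auto simp: test_function_def)
  show "z \<in> closure {x. \<phi> x \<noteq> 0} \<times> {c..d}" if "\<phi> (fst z) * F (snd z) \<noteq> 0" for z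
    using that F(2)[of "snd z"] closure_subset[of "{x. \<phi> x \<noteq> 0}"] by (cases z) auto
qed

lemma frechet_derivative_tensor_time:
  fixes \<phi> :: "'a::euclidean_space \<Rightarrow> real" and F :: "real \<Rightarrow> real"
  assumes \<phi>: "smooth_on UNIV \<phi>" and F: "\<And>t. (F has_real_derivative f t) (at t)"
  shows "frechet_derivative (\<lambda>z. \<phi> (fst z) * F (snd z)) (at z) (0, 1) = \<phi> (fst z) * f (snd z)"
proof -
  have 1: "((\<lambda>z. \<phi> (fst z)) has_derivative (\<lambda>h. frechet_derivative \<phi> (at (fst z)) (fst h))) (at z)"
    using has_derivative_compose[OF bounded_linear_imp_has_derivative[OF bounded_linear_fst]
        smooth_on_has_derivative[OF \<phi>], of z UNIV] by simp
  have 2: "((\<lambda>z. F (snd z)) has_derivative (\<lambda>h. f (snd z) * snd h)) (at z)"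
    using has_derivative_compose[OF bounded_linear_imp_has_derivative[OF bounded_linear_snd],
        of F "(*) (f (snd z))" z UNIV] F[of "snd z"] by (simp add: has_field_derivative_def)
  have "linear (frechet_derivative \<phi> (at (fst z)))"
    using smooth_on_has_derivative[OF \<phi>] by (rule has_derivative_linear)
  then have "frechet_derivative \<phi> (at (fst z)) 0 = 0" by (rule linear_0)
  then show ?thesis
    using fun_cong[OF frechet_derivative_at[OF has_derivative_mult[OF 1 2]], of "(0, 1)"] by simp
qed

lemma integrable_bump1: "integrable lborel (bump1 k a b)"
proof (rule Bochner_Integration.integrable_bound[where f="indicator {a..b} :: real \<Rightarrow> real"])
  show "AE x in lborel. norm (bump1 k a b x) \<le> norm (indicator {a..b} x :: real)"
  proof (rule AE_I2)
    fix x show "norm (bump1 k a b x) \<le> norm (indicator {a..b} x :: real)"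
      using bump1_bounds[of k a b x] bump1_nonzero_iff[of k a b x]
      by (cases "bump1 k a b x = 0") auto
  qed
  show "integrable lborel (indicator {a..b} :: real \<Rightarrow> real)"
    by (rule integrable_real_indicator) (auto simp: emeasure_lborel_Icc_eq)
qed simp

lemma integral_bump1_pos:
  assumes "a < b"
  shows "0 < (\<integral>t. bump1 k a b t \<partial>lborel)"
proof -
  have "(\<integral>t. bump1 k a b t \<partial>lborel) \<noteq> 0"
  proof
    assume "(\<integral>t. bump1 k a b t \<partial>lborel) = 0"
    then have "AE t in lborel. bump1 k a b t = 0"
      using integral_nonneg_eq_0_iff_AE[OF integrable_bump1] bump1_bounds by simp
    then have "AE t in lborel. t \<notin> {a<..<b}"
    proof eventually_elim
      fix t assume "bump1 k a b t = 0"
      then show "t \<notin> {a<..<b}" using bump1_nonzero_iff[of k a b t] by simp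
    qed
    then have "{a<..<b} \<in> null_sets lborel"
      by (simp add: AE_iff_null_sets)
    then show False using assms by (simp add: null_sets_def)
  qed
  moreover have "0 \<le> (\<integral>t. bump1 k a b t \<partial>lborel)"
    by (rule Bochner_Integration.integral_nonneg) (simp add: bump1_bounds)
  ultimately show ?thesis by simp
qed

lemma integrable_bounded_mult:
  fixes f c :: "'a \<Rightarrow> real"
  assumes f: "integrable M f" and c: "c \<in> borel_measurable M" and B: "\<And>z. z \<in> space M \<Longrightarrow> \<bar>c z\<bar> \<le> B"
  shows "integrable M (\<lambda>z. f z * c z)"
proof (rule Bochner_Integration.integrable_bound[where f="\<lambda>z. B * f z"])
  show "AE z in M. norm (f z * c z) \<le> norm (B * f z)"
  proof (rule AE_I2)
    fix z assume z: "z \<in> space M"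
    have "\<bar>f z\<bar> * \<bar>c z\<bar> \<le> \<bar>f z\<bar> * \<bar>B\<bar>" using B[OF z] by (intro mult_left_mono) auto
    then show "norm (f z * c z) \<le> norm (B * f z)" by (simp add: abs_mult mult.commute)
  qed
qed (use f c in auto)

lemma integrable_lborel_bounded_mult:
  fixes f p :: "'a::euclidean_space \<Rightarrow> real"
  assumes "integrable lborel f" "p \<in> borel_measurable borel" "\<And>z. \<bar>p z\<bar> \<le> B"
  shows "integrable lborel (\<lambda>z. f z * p z)"
  using assms by (intro integrable_bounded_mult[where B=B]) auto

text \<open>The lemma of du Bois-Reymond, with a parameter. Let \<open>\<theta>\<close> be a fixed bump in time and \<open>\<eta>\<close>
  any other one. The function \<open>\<eta> - (\<integral>\<eta> / \<integral>\<theta>) \<theta>\<close> has integral zero, so \<open>u\<close> tested with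
  \<open>\<phi>(x) \<eta>(t)\<close> equals \<open>\<integral>\<eta>\<close> times a number that depends on \<open>\<phi>\<close> only. That number is the
  integral of \<open>G \<phi>\<close>, where \<open>G\<close> is the average of \<open>u\<close> in time with weight \<open>\<theta>\<close>. Hence
  \<open>u - G\<close> annihilates all bumps on the cylinder.\<close>

lemma AE_independent_of_time_if_weak_derivative_0:
  fixes \<Omega> :: "'a::euclidean_space set" and u :: "'a \<times> real \<Rightarrow> real"
  assumes \<Omega>: "open \<Omega>" and T: "0 < T"
    and u: "integrable lborel u" and out: "\<And>z. z \<notin> cylinder \<Omega> 0 T \<Longrightarrow> u z = 0"
    and weak: "\<And>\<phi> f c d. test_function \<Omega> \<phi> \<Longrightarrow> smooth_on UNIV f \<Longrightarrow> {c..d} \<subseteq> {0<..<T} \<Longrightarrow>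
      (\<And>t. f t \<noteq> 0 \<Longrightarrow> t \<in> {c..d}) \<Longrightarrow> (\<integral>t. f t \<partial>lborel) = 0 \<Longrightarrow>
      (\<integral>z. u z * (\<phi> (fst z) * f (snd z)) \<partial>lborel) = 0"
  obtains G where "integrable lborel G" "\<And>x. x \<notin> \<Omega> \<Longrightarrow> G x = 0"
    "AE z in lborel. z \<in> cylinder \<Omega> 0 T \<longrightarrow> u z = G (fst z)"
proof -
  let ?Q = "cylinder \<Omega> 0 T"
  have [measurable]: "u \<in> borel_measurable borel" using u by auto
  \<comment> \<open>Any bump with support inside \<open>(0, T)\<close> would do.\<close>
  define \<theta> where "\<theta> = bump1 0 (T/3) (2*T/3)"
  define c0 where "c0 = (\<integral>t. \<theta> t \<partial>lborel)"
  have c0: "0 < c0" unfolding c0_def \<theta>_def using T by (intro integral_bump1_pos) auto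
  have \<theta>m[measurable]: "\<theta> \<in> borel_measurable borel" by (simp add: \<theta>_def)
  have \<theta>i: "integrable lborel \<theta>" unfolding \<theta>_def by (rule integrable_bump1)
  have \<theta>b: "\<bar>\<theta> t\<bar> \<le> 1" for t unfolding \<theta>_def using bump1_bounds[of 0 "T/3" "2*T/3" t] by simp
  have \<theta>0: "\<theta> t \<noteq> 0 \<Longrightarrow> t \<in> {T/3..2*T/3}" for t unfolding \<theta>_def bump1_nonzero_iff by auto
  define G where "G = (\<lambda>x. (\<integral>t. u (x, t) * \<theta> t \<partial>lborel) / c0)"
  have u\<theta>: "integrable lborel (\<lambda>z. u z * \<theta> (snd z))"
    by (rule integrable_lborel_bounded_mult[OF u]) (use \<theta>b in \<open>auto simp: borel_prod[symmetric]\<close>)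
  then have u\<theta>': "integrable (lborel \<Otimes>\<^sub>M lborel) (\<lambda>z. u z * \<theta> (snd z))" by (simp add: lborel_prod)
  have Gi: "integrable lborel G"
    using lborel_pair.integrable_fst'[OF u\<theta>'] unfolding G_def by simp
  then have [measurable]: "G \<in> borel_measurable borel" by auto
  have G0: "G x = 0" if "x \<notin> \<Omega>" for x
    using that out unfolding G_def by (simp add: cylinder_def)
  have Gbump: "(\<integral>x. G x * bump k a b x \<partial>lborel) =
      (\<integral>z. u z * (bump k a b (fst z) * \<theta> (snd z)) \<partial>lborel) / c0" for k a b
  proof -
    have "integrable lborel (\<lambda>z. u z * (bump k a b (fst z) * \<theta> (snd z)))"
    proof (rule integrable_lborel_bounded_mult[OF u, where B=1])
      show "\<bar>bump k a b (fst z) * \<theta> (snd z)\<bar> \<le> 1" for z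
        using bump_bounds[of k a b "fst z"] \<theta>b[of "snd z"] by (simp add: abs_mult mult_le_one)
      show "(\<lambda>z. bump k a b (fst z) * \<theta> (snd z)) \<in> borel_measurable borel"
        unfolding borel_prod[symmetric] by measurable
    qed
    then have "integrable (lborel \<Otimes>\<^sub>M lborel) (\<lambda>z. u z * (bump k a b (fst z) * \<theta> (snd z)))"
      by (simp add: lborel_prod)
    from lborel_pair.integral_fst'[OF this]
    have "(\<integral>z. u z * (bump k a b (fst z) * \<theta> (snd z)) \<partial>lborel) =
        (\<integral>x. \<integral>t. bump k a b x * (u (x, t) * \<theta> t) \<partial>lborel \<partial>lborel)"
      by (simp add: lborel_prod mult_ac)
    also have "\<dots> = (\<integral>x. c0 * (G x * bump k a b x) \<partial>lborel)"
      using c0 by (intro Bochner_Integration.integral_cong refl, subst integral_mult_right_zero)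
        (simp add: G_def)
    also have "\<dots> = c0 * (\<integral>x. G x * bump k a b x \<partial>lborel)" by simp
    finally show ?thesis using c0 by simp
  qed
  \<comment> \<open>Extended constantly in time, \<open>G\<close> need not be integrable over space-time; \<open>J\<close> cuts it off.\<close>
  define J where "J = (indicator {0<..<T} :: real \<Rightarrow> real)"
  have Ji: "integrable lborel J" unfolding J_def using T by (intro integrable_real_indicator) auto
  have GJ: "integrable lborel (\<lambda>z. G (fst z) * J (snd z))"
    by (rule integrable_lborel_pair_mult(1)[OF Gi Ji])
  have "AE z in lborel. z \<in> ?Q \<longrightarrow> u z - G (fst z) * J (snd z) = 0"
  proof (rule AE_lborel_eq_0_if_bump_integrals_0)
    show "open ?Q" unfolding cylinder_def using \<Omega> by (intro open_Times) auto
    show "integrable lborel (\<lambda>z. u z - G (fst z) * J (snd z))"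
      by (intro Bochner_Integration.integrable_diff u GJ)
    fix k and p q :: "'a \<times> real" assume pq: "cbox p q \<subseteq> ?Q"
    obtain a s b t where st: "p = (a, s)" "q = (b, t)" by (cases p, cases q)
    show "(\<integral>z. (u z - G (fst z) * J (snd z)) * bump k p q z \<partial>lborel) = 0"
    proof (cases "cbox p q = {}")
      case True
      then have "bump k p q z = 0" for z using bump_nonzero_iff[of k p q z] box_subset_cbox[of p q] by auto
      then show ?thesis by simp
    next
      case False
      then have ab: "cbox a b \<subseteq> \<Omega>" and sub: "{s..t} \<subseteq> {0<..<T}" and stne: "s \<le> t"
        using pq unfolding st cbox_Pair_eq cylinder_def by (auto simp: times_subset_iff)
      define \<eta> where "\<eta> = bump1 k s t"
      define e where "e = (\<integral>t. \<eta> t \<partial>lborel)"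
      define \<phi> where "\<phi> = bump k a b"
      have [measurable]: "\<eta> \<in> borel_measurable borel" "\<phi> \<in> borel_measurable borel"
        by (simp_all add: \<eta>_def \<phi>_def)
      have \<eta>i: "integrable lborel \<eta>" unfolding \<eta>_def by (rule integrable_bump1)
      have \<phi>b: "\<bar>\<phi> x\<bar> \<le> 1" and \<eta>b: "\<bar>\<eta> r\<bar> \<le> 1" for x r
        unfolding \<phi>_def \<eta>_def using bump_bounds[of k a b x] bump1_bounds[of k s t r] by auto
      have b: "bump k p q z = \<phi> (fst z) * \<eta> (snd z)" for z
        unfolding st bump_Pair \<phi>_def \<eta>_def ..
      have \<eta>J: "J r * \<eta> r = \<eta> r" for r
      proof (cases "\<eta> r = 0")
        case False
        then have "r \<in> {s..t}" using bump1_nonzero_iff[of k s t r] by (simp add: \<eta>_def)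
        then have "r \<in> {0<..<T}" using sub by blast
        then show ?thesis by (simp add: J_def)
      qed simp
      have int: "integrable lborel (\<lambda>z. u z * (\<phi> (fst z) * \<zeta> (snd z)))"
        if "\<zeta> \<in> borel_measurable borel" "\<And>r. \<bar>\<zeta> r\<bar> \<le> 1" for \<zeta> :: "real \<Rightarrow> real"
      proof (rule integrable_lborel_bounded_mult[OF u, where B=1])
        show "\<bar>\<phi> (fst z) * \<zeta> (snd z)\<bar> \<le> 1" for z
          using \<phi>b[of "fst z"] that(2)[of "snd z"] by (simp add: abs_mult mult_le_one)
        show "(\<lambda>z. \<phi> (fst z) * \<zeta> (snd z)) \<in> borel_measurable borel"
          using that(1) unfolding borel_prod[symmetric] by measurable
      qed
      have "(\<integral>z. u z * (\<phi> (fst z) * (\<eta> (snd z) - e / c0 * \<theta> (snd z))) \<partial>lborel) = 0"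
      \<comment> \<open>The interval contains the supports of both bumps.\<close>
      proof (rule weak[where c="min s (T/3)" and d="max t (2*T/3)"])
        show "test_function \<Omega> \<phi>" unfolding \<phi>_def by (rule test_function_bump[OF ab])
        show "smooth_on UNIV (\<lambda>t. \<eta> t - e / c0 * \<theta> t)"
          unfolding \<eta>_def \<theta>_def by (intro smooth_on_diff smooth_on_cmult smooth_on_bump1)
        show "{min s (T / 3)..max t (2 * T / 3)} \<subseteq> {0<..<T}"
        proof -
          have "s \<in> {0<..<T}" "t \<in> {0<..<T}" using sub stne by auto
          then show ?thesis using T by (auto simp: min_def max_def)
        qed
        show "r \<in> {min s (T / 3)..max t (2 * T / 3)}" if "\<eta> r - e / c0 * \<theta> r \<noteq> 0" for r
          using that \<theta>0[of r] bump1_nonzero_iff[of k s t r] unfolding \<eta>_def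
          by (cases "\<theta> r = 0"; force)
        show "(\<integral>t. \<eta> t - e / c0 * \<theta> t \<partial>lborel) = 0"
          using \<eta>i \<theta>i c0 by (simp add: e_def c0_def[symmetric])
      qed
      moreover have "(\<integral>z. u z * (\<phi> (fst z) * (\<eta> (snd z) - e / c0 * \<theta> (snd z))) \<partial>lborel) =
          (\<integral>z. u z * (\<phi> (fst z) * \<eta> (snd z)) \<partial>lborel) - e / c0 * (\<integral>z. u z * (\<phi> (fst z) * \<theta> (snd z)) \<partial>lborel)"
      proof -
        have "(\<integral>z. u z * (\<phi> (fst z) * (\<eta> (snd z) - e / c0 * \<theta> (snd z))) \<partial>lborel) =
          (\<integral>z. u z * (\<phi> (fst z) * \<eta> (snd z)) - e / c0 * (u z * (\<phi> (fst z) * \<theta> (snd z))) \<partial>lborel)"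
          by (intro Bochner_Integration.integral_cong) (auto simp: algebra_simps)
        also have "\<dots> = (\<integral>z. u z * (\<phi> (fst z) * \<eta> (snd z)) \<partial>lborel) - (\<integral>z. e / c0 * (u z * (\<phi> (fst z) * \<theta> (snd z))) \<partial>lborel)"
          using int[of \<eta>] int[of \<theta>] \<eta>b \<theta>b
          by (intro Bochner_Integration.integral_diff integrable_mult_right) auto
        finally show ?thesis by simp
      qed
      ultimately have A: "(\<integral>z. u z * (\<phi> (fst z) * \<eta> (snd z)) \<partial>lborel) = e / c0 * (\<integral>z. u z * (\<phi> (fst z) * \<theta> (snd z)) \<partial>lborel)"
        by simp
      have G\<phi>: "integrable lborel (\<lambda>x. G x * \<phi> x)"
        by (rule integrable_lborel_bounded_mult[OF Gi _ \<phi>b]) auto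
      have "(\<lambda>z. (u z - G (fst z) * J (snd z)) * bump k p q z) =
        (\<lambda>z. u z * (\<phi> (fst z) * \<eta> (snd z)) - (G (fst z) * \<phi> (fst z)) * \<eta> (snd z))"
        unfolding b by (rule ext) (use \<eta>J in \<open>auto simp: algebra_simps\<close>)
      then have "(\<integral>z. (u z - G (fst z) * J (snd z)) * bump k p q z \<partial>lborel) =
          (\<integral>z. u z * (\<phi> (fst z) * \<eta> (snd z)) \<partial>lborel) - (\<integral>z. (G (fst z) * \<phi> (fst z)) * \<eta> (snd z) \<partial>lborel)"
        using int[of \<eta>] \<eta>b integrable_lborel_pair_mult(1)[OF G\<phi> \<eta>i]
        by (simp add: Bochner_Integration.integral_diff)
      also have "(\<integral>z. (G (fst z) * \<phi> (fst z)) * \<eta> (snd z) \<partial>lborel) = (\<integral>x. G x * \<phi> x \<partial>lborel) * e"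
        using integrable_lborel_pair_mult(2)[OF G\<phi> \<eta>i] by (simp add: e_def)
      finally show ?thesis using A Gbump[of k a b] by (simp add: \<phi>_def)
    qed
  qed
  then have "AE z in lborel. z \<in> ?Q \<longrightarrow> u z = G (fst z)"
    by eventually_elim (auto simp: J_def cylinder_def)
  with Gi G0 show thesis by (rule that)
qed

text \<open>Let \<open>H(x, t)\<close> be the integral of \<open>h(x, r)\<close> over \<open>r \<le> t\<close>. By Fubini's theorem and
  integration by parts \<open>g - H\<close> has weak time derivative zero, so it equals some \<open>G(x)\<close> almost
  everywhere. The Cauchy-Schwarz inequality bounds the \<open>L\<^sub>2\<close> norm of \<open>H(\<cdot>, t)\<close> by
  \<open>\<surd>t\<close> times that of \<open>h\<close>, so \<open>g(\<cdot>, t)\<close> tends to \<open>G\<close> as \<open>t\<close> tends to \<open>0\<close>. Integrating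
  \<open>G\<^sup>2 \<le> 2 g\<^sup>2 + 2 H\<^sup>2\<close> over the cylinder bounds \<open>G\<close>.\<close>

lemma weak_time_derivative_representation:
  fixes \<Omega> :: "'a::euclidean_space set" and g h :: "'a \<times> real \<Rightarrow> real"
  assumes \<Omega>: "open \<Omega>" "bounded \<Omega>" and T: "0 < T"
    and g: "g \<in> borel_measurable borel" "\<And>z. z \<notin> cylinder \<Omega> 0 T \<Longrightarrow> g z = 0"
    and h: "h \<in> borel_measurable borel" "\<And>z. z \<notin> cylinder \<Omega> 0 T \<Longrightarrow> h z = 0"
    and weak: "has_weak_deriv (cylinder \<Omega> 0 T) (0, 1) g h"
  obtains G where "G \<in> borel_measurable borel" "\<And>x. x \<notin> \<Omega> \<Longrightarrow> G x = 0"
    "ennreal T * (\<integral>\<^sup>+x. ennreal ((G x)\<^sup>2) \<partial>lborel) \<le>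
      ennreal (2 * (L2_norm (cylinder \<Omega> 0 T) g)\<^sup>2 + 2 * T\<^sup>2 * (L2_norm (cylinder \<Omega> 0 T) h)\<^sup>2)"
    "AE t in lborel. t \<in> {0<..<T} \<longrightarrow>
      (\<integral>\<^sup>+x. ennreal ((g (x, t) - G x)\<^sup>2) * indicator \<Omega> x \<partial>lborel) \<le>
        ennreal (t * (L2_norm (cylinder \<Omega> 0 T) h)\<^sup>2)"
proof -
  let ?Q = "cylinder \<Omega> 0 T"
  have Q: "open ?Q" "bounded ?Q"
    unfolding cylinder_def using \<Omega> by (auto intro: open_Times bounded_Times)
  have [measurable]: "\<Omega> \<in> sets borel" "?Q \<in> sets borel" using \<Omega> Q by auto
  note [measurable] = g(1) h(1)
  have gL: "g \<in> L2_on ?Q" and hL: "h \<in> L2_on ?Q" using weak by (auto simp: has_weak_deriv_def)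
  have gi: "integrable lborel g" and hi: "integrable lborel h"
    using integral_lebesgue_on_eq_lborel(2)[OF Q(1)] L2_on_integrable[OF Q] gL hL g h by blast+
  define Kh where "Kh = (L2_norm ?Q h)\<^sup>2"
  define Kg where "Kg = (L2_norm ?Q g)\<^sup>2"
  have nng: "(\<integral>\<^sup>+z. ennreal ((g z)\<^sup>2) \<partial>lborel) = ennreal Kg"
    unfolding Kg_def by (rule nn_integral_lborel_eq_L2_norm[OF Q(1) g gL])
  have nnh: "(\<integral>\<^sup>+z. ennreal ((h z)\<^sup>2) \<partial>lborel) = ennreal Kh"
    unfolding Kh_def by (rule nn_integral_lborel_eq_L2_norm[OF Q(1) h hL])
  have K0: "0 \<le> Kg" "0 \<le> Kh" by (simp_all add: Kg_def Kh_def)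
  have sect[measurable]: "(\<lambda>r. h (x, r)) \<in> borel_measurable borel" for x
    using h(1) by (simp add: borel_prod[symmetric])
  have sectt[measurable]: "(\<lambda>x. g (x, t)) \<in> borel_measurable borel" for t
    using g(1) by (simp add: borel_prod[symmetric])
  have hfst: "(\<integral>\<^sup>+x. \<integral>\<^sup>+r. ennreal ((h (x, r))\<^sup>2) \<partial>lborel \<partial>lborel) = ennreal Kh"
    using lborel.nn_integral_fst[of "\<lambda>z. ennreal ((h z)\<^sup>2)" lborel] nnh by (simp add: lborel_prod)
  have hm: "(\<lambda>x. \<integral>\<^sup>+r. ennreal ((h (x, r))\<^sup>2) \<partial>lborel) \<in> borel_measurable borel"
    using lborel.borel_measurable_nn_integral_fst[of "\<lambda>z. ennreal ((h z)\<^sup>2)" lborel] by (simp add: lborel_prod)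
  define H0 where "H0 = (\<lambda>z. \<integral>r. h (fst z, r) * indicator {..snd z} r \<partial>lborel)"
  \<comment> \<open>After time \<open>T\<close> the primitive \<open>H0\<close> stays constant in time; the cut-off makes it square integrable.\<close>
  define H where "H = (\<lambda>z. H0 z * indicator ?Q z)"
  have H0m[measurable]: "H0 \<in> borel_measurable borel"
  proof -
    have "(\<lambda>z. \<integral>r. h (fst z, r) * (if r \<le> snd z then 1 else 0) \<partial>lborel) \<in> borel_measurable borel"
      using h(1) unfolding borel_prod[symmetric] by measurable
    moreover have "H0 = (\<lambda>z. \<integral>r. h (fst z, r) * (if r \<le> snd z then 1 else 0) \<partial>lborel)"
      unfolding H0_def by (intro ext Bochner_Integration.integral_cong) (auto simp: indicator_def)
    ultimately show ?thesis by simp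
  qed
  have Hm[measurable]: "H \<in> borel_measurable borel" unfolding H_def by measurable
  have Hout: "z \<notin> ?Q \<Longrightarrow> H z = 0" for z by (simp add: H_def)
  have Hle: "ennreal ((H (x, t))\<^sup>2) \<le> ennreal t * (\<integral>\<^sup>+r. ennreal ((h (x, r))\<^sup>2) \<partial>lborel)" if "0 \<le> t" for x t
  proof -
    have "ennreal ((H (x, t))\<^sup>2) \<le> ennreal ((H0 (x, t))\<^sup>2)"
      by (auto simp: H_def indicator_def)
    also have "\<dots> \<le> ennreal t * (\<integral>\<^sup>+r. ennreal ((h (x, r))\<^sup>2) \<partial>lborel)"
      using primitive_square_le[OF sect _ that, of x] h(2) by (auto simp: H0_def cylinder_def)
    finally show ?thesis .
  qed
  have Hslice: "(\<integral>\<^sup>+x. ennreal ((H (x, t))\<^sup>2) \<partial>lborel) \<le> ennreal (t * Kh)" if "0 \<le> t" for t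
  proof -
    have "(\<integral>\<^sup>+x. ennreal ((H (x, t))\<^sup>2) \<partial>lborel) \<le>
        (\<integral>\<^sup>+x. ennreal t * (\<integral>\<^sup>+r. ennreal ((h (x, r))\<^sup>2) \<partial>lborel) \<partial>lborel)"
      by (intro nn_integral_mono Hle that)
    also have "\<dots> = ennreal t * ennreal Kh" using hm by (simp add: nn_integral_cmult hfst)
    finally show ?thesis using that by (simp add: ennreal_mult')
  qed
  have nnH: "(\<integral>\<^sup>+z. ennreal ((H z)\<^sup>2) \<partial>lborel) \<le> ennreal (T\<^sup>2 * Kh)"
  proof -
    have "(\<integral>\<^sup>+z. ennreal ((H z)\<^sup>2) \<partial>lborel) = (\<integral>\<^sup>+t. \<integral>\<^sup>+x. ennreal ((H (x, t))\<^sup>2) \<partial>lborel \<partial>lborel)"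
      using lborel_pair.nn_integral_snd[of "\<lambda>z. ennreal ((H z)\<^sup>2)"] by (simp add: lborel_prod)
    also have "\<dots> \<le> (\<integral>\<^sup>+t. ennreal (T * Kh) * indicator {0..T} t \<partial>lborel)"
    proof (rule nn_integral_mono)
      fix t
      show "(\<integral>\<^sup>+x. ennreal ((H (x, t))\<^sup>2) \<partial>lborel) \<le> ennreal (T * Kh) * indicator {0..T} t"
      proof (cases "t \<in> {0..T}")
        case True
        then have "ennreal (t * Kh) \<le> ennreal (T * Kh)"
          using K0 by (intro ennreal_leI mult_right_mono) auto
        then show ?thesis using Hslice[of t] True by (auto intro: order_trans)
      next
        case False
        then have "H (x, t) = 0" for x by (intro Hout) (auto simp: cylinder_def)
        then show ?thesis by simp
      qed
    qed
    also have "\<dots> = ennreal (T * Kh) * ennreal T"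
      using T by (simp add: nn_integral_cmult)
    also have "\<dots> = ennreal (T\<^sup>2 * Kh)"
      using T K0 by (simp add: ennreal_mult'[symmetric] power2_eq_square mult_ac)
    finally show ?thesis .
  qed
  have HL: "H \<in> L2_on ?Q"
  proof (rule L2_on_if_nn_integral_le(1)[OF Q(1) Hm])
    have "(\<lambda>z. ennreal ((H z)\<^sup>2) * indicator ?Q z) = (\<lambda>z. ennreal ((H z)\<^sup>2))"
      using Hout by (auto simp: indicator_def fun_eq_iff)
    then show "(\<integral>\<^sup>+z. ennreal ((H z)\<^sup>2) * indicator ?Q z \<partial>lborel) \<le> ennreal (T\<^sup>2 * Kh)"
      using nnH by simp
  qed (use K0 in simp)
  have Hi: "integrable lborel H"
    using integral_lebesgue_on_eq_lborel(2)[OF Q(1) Hm Hout] L2_on_integrable[OF Q HL] by blast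
  define u where "u = (\<lambda>z. g z - H z)"
  have ui: "integrable lborel u" unfolding u_def by (intro Bochner_Integration.integrable_diff gi Hi)
  have um[measurable]: "u \<in> borel_measurable borel" unfolding u_def by measurable
  have uout: "u z = 0" if "z \<notin> ?Q" for z using that by (simp add: u_def g Hout)
  have weak0: "(\<integral>z. u z * (\<phi> (fst z) * f (snd z)) \<partial>lborel) = 0"
    if \<phi>: "test_function \<Omega> \<phi>" and f: "smooth_on UNIV f" and cd: "{c..d} \<subseteq> {0<..<T}"
      and supp: "\<And>t. f t \<noteq> 0 \<Longrightarrow> t \<in> {c..d}" and f0: "(\<integral>t. f t \<partial>lborel) = (0::real)" for \<phi> f c d
  proof -
    obtain F where F: "smooth_on UNIV F" "\<And>t. (F has_real_derivative f t) (at t)"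
      "\<And>t. F t \<noteq> 0 \<Longrightarrow> t \<in> {c..d}" "\<And>t. F t = - (\<integral>s. f s * indicator {t..} s \<partial>lborel)"
      using smooth_antiderivative_compact_support[OF f supp f0] by blast
    have tF: "test_function ?Q (\<lambda>z. \<phi> (fst z) * F (snd z))"
      unfolding cylinder_def by (rule test_function_tensor[OF \<phi> F(1,3) cd])
    have tf: "test_function ?Q (\<lambda>z. \<phi> (fst z) * f (snd z))"
      unfolding cylinder_def by (rule test_function_tensor[OF \<phi> f supp cd])
    obtain B1 where B1: "\<And>z. \<bar>\<phi> (fst z) * F (snd z)\<bar> \<le> B1" using test_function_bounded[OF tF] by blast
    obtain B2 where B2: "\<And>z. \<bar>\<phi> (fst z) * f (snd z)\<bar> \<le> B2" using test_function_bounded[OF tf] by blast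
    note mF = test_function_measurable[OF tF] and mf = test_function_measurable[OF tf]
    have fi: "integrable lborel f"
    proof -
      have "test_function {0<..<T} f"
        by (rule test_function_if_support[OF f _ cd supp]) simp
      note t = this
      have "integrable (lebesgue_on {0<..<T}) f"
        by (rule L2_on_integrable[OF _ _ test_function_L2_on[OF _ _ t]]) auto
      then show ?thesis
        using integral_lebesgue_on_eq_lborel(2)[OF _ test_function_measurable[OF t], of "{0<..<T}"]
          test_function_zero_outside[OF t] by auto
    qed
    have "(\<integral>z. g z * (\<phi> (fst z) * f (snd z)) \<partial>lborel) =
        (\<integral>z. g z * frechet_derivative (\<lambda>z. \<phi> (fst z) * F (snd z)) (at z) (0, 1) \<partial>lebesgue_on ?Q)"
      unfolding frechet_derivative_tensor_time[OF test_function_smooth[OF \<phi>] F(2)]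
      using g mf by (intro integral_lebesgue_on_eq_lborel(1)[OF Q(1), symmetric]) auto
    also have "\<dots> = - (\<integral>z. h z * (\<phi> (fst z) * F (snd z)) \<partial>lebesgue_on ?Q)"
      using weak tF unfolding has_weak_deriv_def by blast
    also have "(\<integral>z. h z * (\<phi> (fst z) * F (snd z)) \<partial>lebesgue_on ?Q) = (\<integral>z. h z * (\<phi> (fst z) * F (snd z)) \<partial>lborel)"
      using h mF by (intro integral_lebesgue_on_eq_lborel(1)[OF Q(1)]) auto
    also have "\<dots> = (\<integral>x. \<integral>r. \<phi> x * (h (x, r) * F r) \<partial>lborel \<partial>lborel)"
      using lborel_pair.integral_fst'[of "\<lambda>z. h z * (\<phi> (fst z) * F (snd z))"]
        integrable_lborel_bounded_mult[OF hi mF B1] by (simp add: lborel_prod mult_ac)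
    also have "\<dots> = (\<integral>x. \<integral>t. - (H (x, t) * (\<phi> x * f t)) \<partial>lborel \<partial>lborel)"
    proof (rule integral_cong_AE)
      have "AE x in lborel. integrable lborel (\<lambda>r. h (x, r))"
        using lborel_pair.AE_integrable_fst'[of h] hi by (simp add: lborel_prod)
      then show "AE x in lborel. (\<integral>r. \<phi> x * (h (x, r) * F r) \<partial>lborel) = (\<integral>t. - (H (x, t) * (\<phi> x * f t)) \<partial>lborel)"
      proof eventually_elim
        case (elim x)
        have "(\<integral>r. \<phi> x * (h (x, r) * F r) \<partial>lborel) = \<phi> x * (\<integral>r. h (x, r) * F r \<partial>lborel)" by simp
        also have "\<dots> = - (\<integral>t. \<phi> x * (H0 (x, t) * f t) \<partial>lborel)"
          using integral_by_parts_primitive[OF elim fi F(4)] by (simp add: H0_def)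
        also have "(\<lambda>t. \<phi> x * (H0 (x, t) * f t)) = (\<lambda>t. H (x, t) * (\<phi> x * f t))"
        proof
          fix t
          have "\<phi> x = 0 \<or> f t = 0 \<or> (x, t) \<in> ?Q"
            using test_function_zero_outside[OF \<phi>, of x] supp[of t] cd by (auto simp: cylinder_def)
          then show "\<phi> x * (H0 (x, t) * f t) = H (x, t) * (\<phi> x * f t)" by (auto simp: H_def)
        qed
        finally show ?case by simp
      qed
      have [measurable]: "F \<in> borel_measurable borel" "f \<in> borel_measurable borel" "\<phi> \<in> borel_measurable borel"
        using smooth_on_continuous F(1) f test_function_smooth[OF \<phi>]
        by (auto intro!: borel_measurable_continuous_onI)
      show "(\<lambda>x. \<integral>r. \<phi> x * (h (x, r) * F r) \<partial>lborel) \<in> borel_measurable lborel"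
        using h(1) unfolding borel_prod[symmetric] by measurable
      show "(\<lambda>x. \<integral>t. - (H (x, t) * (\<phi> x * f t)) \<partial>lborel) \<in> borel_measurable lborel"
        using Hm unfolding borel_prod[symmetric] by measurable
    qed
    also have "\<dots> = - (\<integral>z. H z * (\<phi> (fst z) * f (snd z)) \<partial>lborel)"
      using lborel_pair.integral_fst'[of "\<lambda>z. H z * (\<phi> (fst z) * f (snd z))"]
        integrable_lborel_bounded_mult[OF Hi mf B2] by (simp add: lborel_prod)
    finally have "(\<integral>z. g z * (\<phi> (fst z) * f (snd z)) \<partial>lborel) = (\<integral>z. H z * (\<phi> (fst z) * f (snd z)) \<partial>lborel)"
      by simp
    then show "(\<integral>z. u z * (\<phi> (fst z) * f (snd z)) \<partial>lborel) = 0"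
      using integrable_lborel_bounded_mult[OF gi mf B2] integrable_lborel_bounded_mult[OF Hi mf B2]
      by (simp add: u_def left_diff_distrib)
  qed
  obtain G where G: "integrable lborel G" "\<And>x. x \<notin> \<Omega> \<Longrightarrow> G x = 0"
    "AE z in lborel. z \<in> ?Q \<longrightarrow> u z = G (fst z)"
  proof (rule AE_independent_of_time_if_weak_derivative_0[OF \<Omega>(1) T ui])
  qed (rule uout weak0 that; assumption)+
  have Gm[measurable]: "G \<in> borel_measurable borel" using G(1) by auto
  have Gm1[measurable]: "(\<lambda>z :: 'a \<times> real. G (fst z)) \<in> borel_measurable borel"
    unfolding borel_prod[symmetric] by measurable
  show thesis
  proof (rule that[OF Gm G(2)])
    have "ennreal T * (\<integral>\<^sup>+x. ennreal ((G x)\<^sup>2) \<partial>lborel) = (\<integral>\<^sup>+z. ennreal ((G (fst z))\<^sup>2) * indicator ?Q z \<partial>lborel)"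
    proof -
      have "(\<lambda>z. ennreal ((G (fst z))\<^sup>2) * indicator ?Q z) \<in> borel_measurable (lborel \<Otimes>\<^sub>M lborel)"
        unfolding lborel_prod by measurable
      from lborel.nn_integral_fst[OF this]
      have "(\<integral>\<^sup>+z. ennreal ((G (fst z))\<^sup>2) * indicator ?Q z \<partial>lborel) =
          (\<integral>\<^sup>+x. \<integral>\<^sup>+t. ennreal ((G x)\<^sup>2) * indicator ?Q (x, t) \<partial>lborel \<partial>lborel)"
        by (simp add: lborel_prod)
      also have "\<dots> = (\<integral>\<^sup>+x. \<integral>\<^sup>+t. ennreal ((G x)\<^sup>2) * indicator {0<..<T} t \<partial>lborel \<partial>lborel)"
        using G(2) by (intro nn_integral_cong) (force simp: cylinder_def indicator_def)
      also have "\<dots> = (\<integral>\<^sup>+x. ennreal T * ennreal ((G x)\<^sup>2) \<partial>lborel)"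
        using T by (simp add: nn_integral_cmult mult.commute[of "ennreal T"])
      finally show ?thesis by (simp add: nn_integral_cmult)
    qed
    also have "\<dots> = (\<integral>\<^sup>+z. ennreal ((u z)\<^sup>2) * indicator ?Q z \<partial>lborel)"
      by (rule nn_integral_cong_AE) (use G(3) in eventually_elim, auto simp: indicator_def)
    also have "\<dots> \<le> (\<integral>\<^sup>+z. 2 * ennreal ((g z)\<^sup>2) + 2 * ennreal ((H z)\<^sup>2) \<partial>lborel)"
    proof (rule nn_integral_mono)
      fix z
      have "ennreal ((u z)\<^sup>2) \<le> ennreal (2 * (g z)\<^sup>2 + 2 * (H z)\<^sup>2)"
        unfolding u_def by (intro ennreal_leI power2_diff_le)
      also have "\<dots> = 2 * ennreal ((g z)\<^sup>2) + 2 * ennreal ((H z)\<^sup>2)" by (simp add: ennreal_mult')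
      finally show "ennreal ((u z)\<^sup>2) * indicator ?Q z \<le> 2 * ennreal ((g z)\<^sup>2) + 2 * ennreal ((H z)\<^sup>2)"
        by (auto simp: indicator_def)
    qed
    also have "\<dots> = 2 * ennreal Kg + 2 * (\<integral>\<^sup>+z. ennreal ((H z)\<^sup>2) \<partial>lborel)"
      by (simp add: nn_integral_add nn_integral_cmult nng)
    also have "\<dots> \<le> 2 * ennreal Kg + 2 * ennreal (T\<^sup>2 * Kh)"
      using nnH by (intro add_left_mono mult_left_mono) auto
    also have "\<dots> = ennreal (2 * Kg + 2 * T\<^sup>2 * Kh)"
      using K0 by (simp add: ennreal_mult' ennreal_plus mult.assoc)
    finally show "ennreal T * (\<integral>\<^sup>+x. ennreal ((G x)\<^sup>2) \<partial>lborel) \<le>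
        ennreal (2 * (L2_norm ?Q g)\<^sup>2 + 2 * T\<^sup>2 * (L2_norm ?Q h)\<^sup>2)"
      by (simp add: Kg_def Kh_def)
    have "AE t in lborel. AE x in lborel. (x, t) \<in> ?Q \<longrightarrow> u (x, t) = G (fst (x, t))"
      by (rule AE_lborel_pair_swap[OF G(3)])
    then show "AE t in lborel. t \<in> {0<..<T} \<longrightarrow>
      (\<integral>\<^sup>+x. ennreal ((g (x, t) - G x)\<^sup>2) * indicator \<Omega> x \<partial>lborel) \<le>
        ennreal (t * (L2_norm (cylinder \<Omega> 0 T) h)\<^sup>2)"
    proof (eventually_elim, intro impI)
      fix t assume ae: "AE x in lborel. (x, t) \<in> ?Q \<longrightarrow> u (x, t) = G (fst (x, t))" and t: "t \<in> {0<..<T}"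
      have "(\<integral>\<^sup>+x. ennreal ((g (x, t) - G x)\<^sup>2) * indicator \<Omega> x \<partial>lborel) \<le> (\<integral>\<^sup>+x. ennreal ((H (x, t))\<^sup>2) \<partial>lborel)"
      proof (rule nn_integral_mono_AE)
        show "AE x in lborel. ennreal ((g (x, t) - G x)\<^sup>2) * indicator \<Omega> x \<le> ennreal ((H (x, t))\<^sup>2)"
          using ae
        proof eventually_elim
          case (elim x)
          show ?case
          proof (cases "x \<in> \<Omega>")
            case True
            then have "g (x, t) - G x = H (x, t)" using elim t by (auto simp: cylinder_def u_def)
            then show ?thesis by (simp add: indicator_def)
          qed simp
        qed
      qed
      also have "\<dots> \<le> ennreal (t * Kh)" using Hslice t by auto
      finally show "(\<integral>\<^sup>+x. ennreal ((g (x, t) - G x)\<^sup>2) * indicator \<Omega> x \<partial>lborel) \<le> ennreal (t * (L2_norm ?Q h)\<^sup>2)"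
        by (simp add: Kh_def)
    qed
  qed
qed


lemma open_cylinder: "open \<Omega> \<Longrightarrow> open (cylinder \<Omega> s T)"
  unfolding cylinder_def by (intro open_Times) auto

lemma bounded_cylinder: "bounded \<Omega> \<Longrightarrow> bounded (cylinder \<Omega> s T)"
  for \<Omega> :: "'a::euclidean_space set"
  unfolding cylinder_def by (intro bounded_Times) auto

text \<open>A negligible set contains no interval, so times outside it accumulate at both ends. Without
  this, limits along such times would say nothing.\<close>

lemma time_limit_point:
  fixes s T :: real
  assumes "0 < T" "s = 0 \<or> s = T" "negligible N"
  shows "at s within ({0<..<T} - N) \<noteq> bot"
proof -
  have "s islimpt ({0<..<T} - N)"
    unfolding islimpt_def
  proof (intro allI impI)
    fix U assume U: "s \<in> U" "open U"
    have "s \<in> closure {0<..<T}"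
      unfolding closure_greaterThanLessThan[OF assms(1)] using assms by auto
    then have "U \<inter> {0<..<T} \<noteq> {}" using U by (metis Int_commute closure_iff_nhds_not_empty order_refl)
    then have "\<not> negligible (U \<inter> {0<..<T})"
      using U by (intro open_not_negligible) auto
    then have "\<not> U \<inter> {0<..<T} \<subseteq> N" using assms(3) negligible_subset by blast
    then show "\<exists>y\<in>{0<..<T} - N. y \<in> U \<and> y \<noteq> s" using assms(2) by auto
  qed
  then show ?thesis using trivial_limit_within by blast
qed

lemma has_time_trace_unique:
  fixes \<Omega> :: "'a::euclidean_space set"
  assumes T: "0 < T" "s = 0 \<or> s = T"
    and g: "has_time_trace \<Omega> T u s g" and h: "has_time_trace \<Omega> T u s h"
  shows "L2_norm \<Omega> (\<lambda>x. g x - h x) = 0"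
proof -
  obtain N where N: "negligible N" "\<And>t. t \<in> {0<..<T} - N \<Longrightarrow> (\<lambda>x. u (x, t)) \<in> L2_on \<Omega>"
    "((\<lambda>t. L2_norm \<Omega> (\<lambda>x. u (x, t) - g x)) \<longlongrightarrow> 0) (at s within ({0<..<T} - N))"
    using g by (auto simp: has_time_trace_def)
  obtain N' where N': "negligible N'"
    "((\<lambda>t. L2_norm \<Omega> (\<lambda>x. u (x, t) - h x)) \<longlongrightarrow> 0) (at s within ({0<..<T} - N'))"
    using h by (auto simp: has_time_trace_def)
  have L: "g \<in> L2_on \<Omega>" "h \<in> L2_on \<Omega>" using g h by (auto simp: has_time_trace_def)
  let ?S = "{0<..<T} - (N \<union> N')"
  have lim: "((\<lambda>t. 2 * L2_norm \<Omega> (\<lambda>x. u (x, t) - h x) + 2 * L2_norm \<Omega> (\<lambda>x. u (x, t) - g x)) \<longlongrightarrow> 2 * 0 + 2 * 0)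
      (at s within ?S)"
    by (intro tendsto_intros tendsto_within_subset[OF N(3)] tendsto_within_subset[OF N'(2)]) auto
  have "eventually (\<lambda>t. L2_norm \<Omega> (\<lambda>x. g x - h x) \<le>
      2 * L2_norm \<Omega> (\<lambda>x. u (x, t) - h x) + 2 * L2_norm \<Omega> (\<lambda>x. u (x, t) - g x)) (at s within ?S)"
  proof (rule eventually_at_topological[THEN iffD2], intro exI[of _ UNIV] conjI ballI impI)
    fix t assume t: "t \<in> ?S"
    then have ut: "(\<lambda>x. u (x, t)) \<in> L2_on \<Omega>" by (intro N(2)) auto
    have "L2_norm \<Omega> (\<lambda>x. (u (x, t) - h x) - (u (x, t) - g x)) \<le>
       2 * L2_norm \<Omega> (\<lambda>x. u (x, t) - h x) + 2 * L2_norm \<Omega> (\<lambda>x. u (x, t) - g x)"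
      by (intro L2_norm_diff_le L2_on_diff ut L)
    then show "L2_norm \<Omega> (\<lambda>x. g x - h x) \<le>
       2 * L2_norm \<Omega> (\<lambda>x. u (x, t) - h x) + 2 * L2_norm \<Omega> (\<lambda>x. u (x, t) - g x)" by simp
  qed auto
  moreover have "at s within ?S \<noteq> bot"
    using N(1) N'(1) by (intro time_limit_point T negligible_Un)
  ultimately have "L2_norm \<Omega> (\<lambda>x. g x - h x) \<le> 0"
    using tendsto_lowerbound[OF lim] by simp
  then show ?thesis using L2_norm_nonneg[of \<Omega> "\<lambda>x. g x - h x"] by linarith
qed

lemma has_time_trace_zero_diff:
  fixes \<Omega> :: "'a::euclidean_space set"
  assumes u: "has_time_trace \<Omega> T u s (\<lambda>_. 0)" and v: "has_time_trace \<Omega> T v s (\<lambda>_. 0)"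
  shows "has_time_trace \<Omega> T (\<lambda>z. u z - v z) s (\<lambda>_. 0)"
proof -
  obtain N where N: "negligible N" "\<And>t. t \<in> {0<..<T} - N \<Longrightarrow> (\<lambda>x. u (x, t)) \<in> L2_on \<Omega>"
    "((\<lambda>t. L2_norm \<Omega> (\<lambda>x. u (x, t))) \<longlongrightarrow> 0) (at s within ({0<..<T} - N))"
    using u by (auto simp: has_time_trace_def)
  obtain N' where N': "negligible N'" "\<And>t. t \<in> {0<..<T} - N' \<Longrightarrow> (\<lambda>x. v (x, t)) \<in> L2_on \<Omega>"
    "((\<lambda>t. L2_norm \<Omega> (\<lambda>x. v (x, t))) \<longlongrightarrow> 0) (at s within ({0<..<T} - N'))"
    using v by (auto simp: has_time_trace_def)
  let ?S = "{0<..<T} - (N \<union> N')"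
  have lim: "((\<lambda>t. 2 * L2_norm \<Omega> (\<lambda>x. u (x, t)) + 2 * L2_norm \<Omega> (\<lambda>x. v (x, t))) \<longlongrightarrow> 2 * 0 + 2 * 0)
      (at s within ?S)"
    by (intro tendsto_intros tendsto_within_subset[OF N(3)] tendsto_within_subset[OF N'(3)]) auto
  have ev: "eventually (\<lambda>t. L2_norm \<Omega> (\<lambda>x. u (x, t) - v (x, t)) \<le>
      2 * L2_norm \<Omega> (\<lambda>x. u (x, t)) + 2 * L2_norm \<Omega> (\<lambda>x. v (x, t))) (at s within ?S)"
    by (rule eventually_at_topological[THEN iffD2], intro exI[of _ UNIV] conjI ballI impI)
       (auto intro!: L2_norm_diff_le N N')
  show ?thesis
    unfolding has_time_trace_def
  proof (intro conjI exI[of _ "N \<union> N'"] ballI L2_on_zero)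
    show "negligible (N \<union> N')" using N(1) N'(1) by (rule negligible_Un)
    show "(\<lambda>x. u (x, t) - v (x, t)) \<in> L2_on \<Omega>" if "t \<in> ?S" for t
      using that by (intro L2_on_diff N(2) N'(2)) auto
    show "((\<lambda>t. L2_norm \<Omega> (\<lambda>x. u (x, t) - v (x, t) - 0)) \<longlongrightarrow> 0) (at s within ?S)"
      by (rule tendsto_sandwich[OF _ _ tendsto_const lim[simplified]])
         (use ev L2_norm_nonneg in \<open>auto intro: always_eventually\<close>)
  qed
qed

lemma has_time_trace_time_trace:
  "has_time_trace \<Omega> T u s g \<Longrightarrow> has_time_trace \<Omega> T u s (time_trace \<Omega> T u s)"
  unfolding time_trace_def by (rule someI[of "has_time_trace \<Omega> T u s"])

text \<open>\<open>time_trace\<close> is some trace, and traces are unique as elements of \<open>L\<^sub>2\<close>; so any trace that is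
  known explicitly controls it.\<close>

lemma L2_norm_time_trace_le:
  fixes \<Omega> :: "'a::euclidean_space set"
  assumes T: "0 < T" "s = 0 \<or> s = T" and g: "has_time_trace \<Omega> T u s g"
  shows "(L2_norm \<Omega> (time_trace \<Omega> T u s))\<^sup>2 \<le> 2 * (L2_norm \<Omega> g)\<^sup>2"
proof -
  let ?t = "time_trace \<Omega> T u s"
  have t: "has_time_trace \<Omega> T u s ?t" by (rule has_time_trace_time_trace[OF g])
  have L: "g \<in> L2_on \<Omega>" "?t \<in> L2_on \<Omega>" using g t by (auto simp: has_time_trace_def)
  have "(L2_norm \<Omega> (\<lambda>x. (?t x - g x) - (-1) * g x))\<^sup>2 \<le>
      2 * (L2_norm \<Omega> (\<lambda>x. ?t x - g x))\<^sup>2 + 2 * (L2_norm \<Omega> (\<lambda>x. (-1) * g x))\<^sup>2"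
    by (intro L2_norm_sq_diff_le L2_on_diff L2_on_cmult L)
  moreover have "L2_norm \<Omega> (\<lambda>x. (-1) * g x) = L2_norm \<Omega> g" by (simp add: L2_norm_def)
  ultimately show ?thesis using has_time_trace_unique[OF T t g] by simp
qed

text \<open>Transfers the representation from Borel representatives to the given functions. Times at
  which the two differ on a set of positive measure form a null set, which is absorbed by the exceptional
  set in the definition of a trace.\<close>

lemma weak_time_derivative_imp_trace_at_0:
  fixes \<Omega> :: "'a::euclidean_space set"
  assumes \<Omega>: "open \<Omega>" "bounded \<Omega>" and T: "0 < T"
    and weak: "has_weak_deriv (cylinder \<Omega> 0 T) (0, 1) g h"
  obtains G where "has_time_trace \<Omega> T g 0 G"
    "T * (L2_norm \<Omega> G)\<^sup>2 \<le> 2 * (L2_norm (cylinder \<Omega> 0 T) g)\<^sup>2 + 2 * T\<^sup>2 * (L2_norm (cylinder \<Omega> 0 T) h)\<^sup>2"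
proof -
  let ?Q = "cylinder \<Omega> 0 T"
  note Q = open_cylinder[OF \<Omega>(1), of 0 T] bounded_cylinder[OF \<Omega>(2), of 0 T]
  have L: "g \<in> L2_on ?Q" "h \<in> L2_on ?Q" using weak by (auto simp: has_weak_deriv_def)
  obtain g' where g': "g' \<in> borel_measurable borel" "\<And>z. z \<notin> ?Q \<Longrightarrow> g' z = 0" "AE z in lebesgue_on ?Q. g z = g' z"
    using lebesgue_on_borel_representative[OF Q(1) L2_onD(1)[OF L(1)]] by blast
  obtain h' where h': "h' \<in> borel_measurable borel" "\<And>z. z \<notin> ?Q \<Longrightarrow> h' z = 0" "AE z in lebesgue_on ?Q. h z = h' z"
    using lebesgue_on_borel_representative[OF Q(1) L2_onD(1)[OF L(2)]] by blast
  have b: "(0, 1) \<in> (Basis :: ('a \<times> real) set)" by (simp add: Basis_prod_def)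
  have weak': "has_weak_deriv ?Q (0, 1) g' h'"
    by (rule has_weak_deriv_cong_AE[OF Q weak b g'(3) h'(3)])
  have ng: "L2_norm ?Q g' = L2_norm ?Q g" "L2_norm ?Q h' = L2_norm ?Q h"
    using L2_norm_cong_AE[OF Q(1) L(1) g'(3)] L2_norm_cong_AE[OF Q(1) L(2) h'(3)] by simp_all
  obtain G where G: "G \<in> borel_measurable borel" "\<And>x. x \<notin> \<Omega> \<Longrightarrow> G x = 0"
    "ennreal T * (\<integral>\<^sup>+x. ennreal ((G x)\<^sup>2) \<partial>lborel) \<le>
      ennreal (2 * (L2_norm ?Q g')\<^sup>2 + 2 * T\<^sup>2 * (L2_norm ?Q h')\<^sup>2)"
    "AE t in lborel. t \<in> {0<..<T} \<longrightarrow>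
      (\<integral>\<^sup>+x. ennreal ((g' (x, t) - G x)\<^sup>2) * indicator \<Omega> x \<partial>lborel) \<le> ennreal (t * (L2_norm ?Q h')\<^sup>2)"
    using weak_time_derivative_representation[OF \<Omega> T g'(1,2) h'(1,2) weak'] by blast
  define K where "K = 2 * (L2_norm ?Q g)\<^sup>2 + 2 * T\<^sup>2 * (L2_norm ?Q h)\<^sup>2"
  have K: "0 \<le> K" by (simp add: K_def)
  have GL: "G \<in> L2_on \<Omega>" "(L2_norm \<Omega> G)\<^sup>2 \<le> K / T"
  proof -
    have "(\<integral>\<^sup>+x. ennreal ((G x)\<^sup>2) * indicator \<Omega> x \<partial>lborel) = (\<integral>\<^sup>+x. ennreal ((G x)\<^sup>2) \<partial>lborel)"
      using G(2) by (intro nn_integral_cong) (auto simp: indicator_def)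
    also have "\<dots> = ennreal (1 / T) * (ennreal T * (\<integral>\<^sup>+x. ennreal ((G x)\<^sup>2) \<partial>lborel))"
      using T by (simp add: mult.assoc[symmetric] ennreal_mult[symmetric])
    also have "\<dots> \<le> ennreal (1 / T) * ennreal K"
      using G(3) unfolding ng K_def by (rule mult_left_mono) simp
    also have "\<dots> = ennreal (K / T)" using T K by (simp add: ennreal_mult[symmetric])
    finally have le: "(\<integral>\<^sup>+x. ennreal ((G x)\<^sup>2) * indicator \<Omega> x \<partial>lborel) \<le> ennreal (K / T)" .
    show "G \<in> L2_on \<Omega>" "(L2_norm \<Omega> G)\<^sup>2 \<le> K / T"
      using L2_on_if_nn_integral_le[OF \<Omega>(1) G(1) le] T K by auto
  qed
  have "AE z in lborel. z \<in> ?Q \<longrightarrow> g z = g' z"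
    using g'(3) unfolding AE_lebesgue_on_iff_lborel[OF Q(1)] .
  then have "AE t in lborel. AE x in lborel. (x, t) \<in> ?Q \<longrightarrow> g (x, t) = g' (x, t)"
    by (rule AE_lborel_pair_swap)
  with G(4) have "AE t in lborel. t \<in> {0<..<T} \<longrightarrow>
      (\<lambda>x. g (x, t)) \<in> L2_on \<Omega> \<and> L2_norm \<Omega> (\<lambda>x. g (x, t) - G x) \<le> sqrt (t * (L2_norm ?Q h)\<^sup>2)"
  proof (eventually_elim, intro impI)
    fix t
    assume t: "t \<in> {0<..<T}" and ae: "AE x in lborel. (x, t) \<in> ?Q \<longrightarrow> g (x, t) = g' (x, t)"
      and le: "t \<in> {0<..<T} \<longrightarrow>
      (\<integral>\<^sup>+x. ennreal ((g' (x, t) - G x)\<^sup>2) * indicator \<Omega> x \<partial>lborel) \<le> ennreal (t * (L2_norm ?Q h')\<^sup>2)"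
    have [measurable]: "(\<lambda>x. g' (x, t)) \<in> borel_measurable borel"
      using g'(1) by (simp add: borel_prod[symmetric])
    have m: "(\<lambda>x. g' (x, t) - G x) \<in> borel_measurable borel" using G(1) by measurable
    have d: "(\<lambda>x. g' (x, t) - G x) \<in> L2_on \<Omega>"
      "(L2_norm \<Omega> (\<lambda>x. g' (x, t) - G x))\<^sup>2 \<le> t * (L2_norm ?Q h)\<^sup>2"
      using L2_on_if_nn_integral_le[OF \<Omega>(1) m le[rule_format, OF t]] t unfolding ng by auto
    have e: "AE x in lebesgue_on \<Omega>. g' (x, t) = g (x, t)"
      unfolding AE_lebesgue_on_iff_lborel[OF \<Omega>(1)]
      using ae by eventually_elim (use t in \<open>auto simp: cylinder_def\<close>)
    have "(\<lambda>x. (g' (x, t) - G x) + G x) \<in> L2_on \<Omega>" by (rule L2_on_add[OF d(1) GL(1)])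
    then have "(\<lambda>x. g' (x, t)) \<in> L2_on \<Omega>" by simp
    then have "(\<lambda>x. g (x, t)) \<in> L2_on \<Omega>" using e by (rule L2_on_cong_AE[OF \<Omega>(1)])
    moreover have "L2_norm \<Omega> (\<lambda>x. g' (x, t) - G x) = L2_norm \<Omega> (\<lambda>x. g (x, t) - G x)"
      by (rule L2_norm_cong_AE[OF \<Omega>(1) d(1)]) (use e in \<open>auto elim!: eventually_mono\<close>)
    ultimately show "(\<lambda>x. g (x, t)) \<in> L2_on \<Omega> \<and> L2_norm \<Omega> (\<lambda>x. g (x, t) - G x) \<le> sqrt (t * (L2_norm ?Q h)\<^sup>2)"
      using d(2) by (metis real_le_rsqrt)
  qed
  then obtain N where N: "{t. \<not> (t \<in> {0<..<T} \<longrightarrow>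
      (\<lambda>x. g (x, t)) \<in> L2_on \<Omega> \<and> L2_norm \<Omega> (\<lambda>x. g (x, t) - G x) \<le> sqrt (t * (L2_norm ?Q h)\<^sup>2))} \<subseteq> N"
    "emeasure lborel N = 0" "N \<in> sets lborel"
    by (auto elim!: AE_E)
  have neg: "negligible N"
    using N(2,3) by (auto simp: negligible_iff_null_sets null_sets_def intro!: null_sets_completionI)
  have tr: "has_time_trace \<Omega> T g 0 G"
    unfolding has_time_trace_def
  proof (intro conjI exI[of _ N] ballI GL(1) neg)
    show "(\<lambda>x. g (x, t)) \<in> L2_on \<Omega>" if "t \<in> {0<..<T} - N" for t using N(1) that by blast
    have lim: "((\<lambda>t. sqrt (t * (L2_norm ?Q h)\<^sup>2)) \<longlongrightarrow> sqrt (0 * (L2_norm ?Q h)\<^sup>2)) (at 0 within ({0<..<T} - N))"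
      by (intro tendsto_intros)
    show "((\<lambda>t. L2_norm \<Omega> (\<lambda>x. g (x, t) - G x)) \<longlongrightarrow> 0) (at 0 within ({0<..<T} - N))"
    proof (rule tendsto_sandwich[OF _ _ tendsto_const lim[simplified mult_zero_left real_sqrt_zero]])
      show "\<forall>\<^sub>F t in at 0 within ({0<..<T} - N). L2_norm \<Omega> (\<lambda>x. g (x, t) - G x) \<le> sqrt (t * (L2_norm ?Q h)\<^sup>2)"
        by (rule eventually_at_topological[THEN iffD2], intro exI[of _ UNIV] conjI ballI impI)
           (use N(1) in blast)+
    qed (simp add: L2_norm_nonneg)
  qed
  show thesis
    by (rule that[OF tr]) (use GL(2) T in \<open>simp add: K_def field_simps\<close>)
qed

lemma L2_norm_time_trace_0_le:
  fixes \<Omega> :: "'a::euclidean_space set"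
  assumes \<Omega>: "open \<Omega>" "bounded \<Omega>" and T: "0 < T"
    and weak: "has_weak_deriv (cylinder \<Omega> 0 T) (0, 1) g h"
  shows "(L2_norm \<Omega> (time_trace \<Omega> T g 0))\<^sup>2 \<le>
    4 / T * (L2_norm (cylinder \<Omega> 0 T) g)\<^sup>2 + 4 * T * (L2_norm (cylinder \<Omega> 0 T) h)\<^sup>2"
proof -
  obtain G where G: "has_time_trace \<Omega> T g 0 G"
    "T * (L2_norm \<Omega> G)\<^sup>2 \<le> 2 * (L2_norm (cylinder \<Omega> 0 T) g)\<^sup>2 + 2 * T\<^sup>2 * (L2_norm (cylinder \<Omega> 0 T) h)\<^sup>2"
    using weak_time_derivative_imp_trace_at_0[OF \<Omega> T weak] by blast
  have "T * (L2_norm \<Omega> (time_trace \<Omega> T g 0))\<^sup>2 \<le> T * (2 * (L2_norm \<Omega> G)\<^sup>2)"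
    using L2_norm_time_trace_le[OF T _ G(1)] T by (intro mult_left_mono) auto
  also have "\<dots> \<le> 4 * (L2_norm (cylinder \<Omega> 0 T) g)\<^sup>2 + 4 * T\<^sup>2 * (L2_norm (cylinder \<Omega> 0 T) h)\<^sup>2"
    using G(2) by simp
  also have "\<dots> = T * (4 / T * (L2_norm (cylinder \<Omega> 0 T) g)\<^sup>2 + 4 * T * (L2_norm (cylinder \<Omega> 0 T) h)\<^sup>2)"
    using T by (simp add: field_simps power2_eq_square)
  finally show ?thesis using T by simp
qed

lemma H2_norm_sq:
  "(H2_norm U u)\<^sup>2 = (L2_norm U u)\<^sup>2 + (\<Sum>b\<in>Basis. (L2_norm U (weak_deriv U b u))\<^sup>2) +
     (\<Sum>b\<in>Basis. \<Sum>b'\<in>Basis. (L2_norm U (weak_deriv U b' (weak_deriv U b u)))\<^sup>2)"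
  unfolding H2_norm_def by (intro real_sqrt_pow2 add_nonneg_nonneg sum_nonneg) auto

lemma H2_norm_nonneg: "0 \<le> H2_norm U u"
  unfolding H2_norm_def by (intro real_sqrt_ge_zero add_nonneg_nonneg sum_nonneg) auto

lemma H2_norm_sq_diff_le:
  fixes u :: "'a::euclidean_space \<Rightarrow> real"
  assumes U: "open U" "bounded U" and u: "u \<in> H2 U" and v: "v \<in> H2 U"
  shows "(H2_norm U (\<lambda>z. u z - v z))\<^sup>2 \<le> 2 * (H2_norm U u)\<^sup>2 + 2 * (H2_norm U v)\<^sup>2"
proof -
  let ?w = "\<lambda>z. u z - v z"
  note H = H2_H1[OF u] H2_H1[OF v] H2_H1[OF H2_diff[OF U u v]]
  have 0: "(L2_norm U ?w)\<^sup>2 \<le> 2 * (L2_norm U u)\<^sup>2 + 2 * (L2_norm U v)\<^sup>2"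
    by (intro L2_norm_sq_diff_le H1_L2_on H)
  have 1: "(L2_norm U (weak_deriv U b ?w))\<^sup>2 \<le>
      2 * (L2_norm U (weak_deriv U b u))\<^sup>2 + 2 * (L2_norm U (weak_deriv U b v))\<^sup>2" if b: "b \<in> Basis" for b
  proof -
    have "L2_norm U (weak_deriv U b ?w) = L2_norm U (\<lambda>z. weak_deriv U b u z - weak_deriv U b v z)"
      by (rule L2_norm_cong_AE[OF U(1) weak_deriv_L2_on[OF H1D[OF H(3) b]] weak_deriv_diff_AE[OF U H(1,2) b]])
    then show ?thesis
      using L2_norm_sq_diff_le[OF weak_deriv_L2_on[OF H1D[OF H(1) b]] weak_deriv_L2_on[OF H1D[OF H(2) b]]] by simp
  qed
  have 2: "(L2_norm U (weak_deriv U b' (weak_deriv U b ?w)))\<^sup>2 \<le>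
      2 * (L2_norm U (weak_deriv U b' (weak_deriv U b u)))\<^sup>2 + 2 * (L2_norm U (weak_deriv U b' (weak_deriv U b v)))\<^sup>2"
    if b: "b \<in> Basis" and b': "b' \<in> Basis" for b b'
  proof -
    note D = H2_weak_deriv_H1[OF U u b] H2_weak_deriv_H1[OF U v b] H2_weak_deriv_H1[OF U H2_diff[OF U u v] b]
    have "L2_norm U (weak_deriv U b' (weak_deriv U b ?w)) =
        L2_norm U (\<lambda>z. weak_deriv U b' (weak_deriv U b u) z - weak_deriv U b' (weak_deriv U b v) z)"
      by (rule L2_norm_cong_AE[OF U(1) weak_deriv_L2_on[OF H1D[OF D(3) b']] weak_deriv2_diff_AE[OF U u v b b']])
    then show ?thesis
      using L2_norm_sq_diff_le[OF weak_deriv_L2_on[OF H1D[OF D(1) b']] weak_deriv_L2_on[OF H1D[OF D(2) b']]] by simp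
  qed
  have "(\<Sum>b\<in>Basis. (L2_norm U (weak_deriv U b ?w))\<^sup>2) \<le>
      (\<Sum>b\<in>Basis. 2 * (L2_norm U (weak_deriv U b u))\<^sup>2 + 2 * (L2_norm U (weak_deriv U b v))\<^sup>2)"
    by (intro sum_mono 1)
  moreover have "(\<Sum>b\<in>Basis. \<Sum>b'\<in>Basis. (L2_norm U (weak_deriv U b' (weak_deriv U b ?w)))\<^sup>2) \<le>
      (\<Sum>b\<in>Basis. \<Sum>b'\<in>Basis. 2 * (L2_norm U (weak_deriv U b' (weak_deriv U b u)))\<^sup>2 +
        2 * (L2_norm U (weak_deriv U b' (weak_deriv U b v)))\<^sup>2)"
    by (intro sum_mono 2)
  ultimately show ?thesis
    using 0 by (simp add: H2_norm_sq sum.distrib sum_distrib_left[symmetric])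
qed

lemma space_direction_Basis: "(axis i 1, 0) \<in> (Basis :: ((real^'n::finite) \<times> real) set)"
  by (simp add: Basis_prod_def axis_in_Basis_iff)

lemma time_direction_Basis: "(0, 1) \<in> (Basis :: ('a::euclidean_space \<times> real) set)"
  by (simp add: Basis_prod_def)

lemma sum_space_directions_le:
  fixes f :: "(real^'n::finite) \<times> real \<Rightarrow> real"
  assumes "\<And>b. 0 \<le> f b"
  shows "(\<Sum>i\<in>UNIV. f (axis i 1, 0)) \<le> sum f Basis"
proof -
  have "inj (\<lambda>i::'n. (axis i (1::real), 0::real))" by (auto simp: inj_on_def axis_eq_axis)
  then have "(\<Sum>i\<in>UNIV. f (axis i 1, 0)) = sum f (range (\<lambda>i::'n. (axis i 1, 0)))"
    by (simp add: sum.reindex)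
  also have "\<dots> \<le> sum f Basis"
    by (intro sum_mono2) (use assms space_direction_Basis in auto)
  finally show ?thesis .
qed

text \<open>Each space derivative of \<open>w\<close> is square integrable together with its time derivative, which
  is one of the second derivatives that the \<open>H\<^sup>2\<close> norm contains.\<close>

lemma grad_time_trace_norm_le:
  fixes \<Omega> :: "(real^'n::finite) set"
  assumes \<Omega>: "open \<Omega>" "bounded \<Omega>" and T: "0 < T" and w: "w \<in> H2 (cylinder \<Omega> 0 T)"
  shows "(grad_time_trace_norm \<Omega> T w 0)\<^sup>2 \<le> (4 / T + 4 * T) * (H2_norm (cylinder \<Omega> 0 T) w)\<^sup>2"
proof -
  let ?Q = "cylinder \<Omega> 0 T"
  note Q = open_cylinder[OF \<Omega>(1), of 0 T] bounded_cylinder[OF \<Omega>(2), of 0 T]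
  let ?D = "\<lambda>b. (L2_norm ?Q (weak_deriv ?Q b w))\<^sup>2"
  let ?D2 = "\<lambda>b b'. (L2_norm ?Q (weak_deriv ?Q b' (weak_deriv ?Q b w)))\<^sup>2"
  have "(grad_time_trace_norm \<Omega> T w 0)\<^sup>2 = (\<Sum>i\<in>UNIV. (L2_norm \<Omega> (time_trace \<Omega> T (dx ?Q i w) 0))\<^sup>2)"
    unfolding grad_time_trace_norm_def by (intro real_sqrt_pow2 sum_nonneg) auto
  also have "\<dots> \<le> (\<Sum>i\<in>UNIV. 4 / T * ?D (axis i 1, 0) + 4 * T * ?D2 (axis i 1, 0) (0, 1))"
    unfolding dx_def
    by (intro sum_mono L2_norm_time_trace_0_le \<Omega> T H1D H2_weak_deriv_H1 Q w space_direction_Basis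
        time_direction_Basis)
  also have "\<dots> = 4 / T * (\<Sum>i\<in>UNIV. ?D (axis i 1, 0)) + 4 * T * (\<Sum>i\<in>UNIV. ?D2 (axis i 1, 0) (0, 1))"
    by (simp only: sum.distrib sum_distrib_left)
  also have "\<dots> \<le> 4 / T * (H2_norm ?Q w)\<^sup>2 + 4 * T * (H2_norm ?Q w)\<^sup>2"
  proof (intro add_mono mult_left_mono)
    have D: "(\<Sum>i\<in>UNIV. ?D (axis i 1, 0)) \<le> sum ?D Basis" by (rule sum_space_directions_le) simp
    have "(\<Sum>i\<in>UNIV. ?D2 (axis i 1, 0) (0, 1)) \<le> (\<Sum>b\<in>Basis. ?D2 b (0, 1))"
      by (rule sum_space_directions_le) simp
    also have "\<dots> \<le> (\<Sum>b\<in>Basis. \<Sum>b'\<in>Basis. ?D2 b b')"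
    proof (rule sum_mono)
      fix b :: "(real^'n) \<times> real"
      show "?D2 b (0, 1) \<le> (\<Sum>b'\<in>Basis. ?D2 b b')"
        by (rule member_le_sum[of "(0, 1)" Basis "?D2 b"]) (auto simp: time_direction_Basis)
    qed
    finally have D2: "(\<Sum>i\<in>UNIV. ?D2 (axis i 1, 0) (0, 1)) \<le> (\<Sum>b\<in>Basis. \<Sum>b'\<in>Basis. ?D2 b b')" .
    have "0 \<le> sum ?D Basis" "0 \<le> (\<Sum>b\<in>Basis. \<Sum>b'\<in>Basis. ?D2 b b')" by (auto intro!: sum_nonneg)
    then show "(\<Sum>i\<in>UNIV. ?D (axis i 1, 0)) \<le> (H2_norm ?Q w)\<^sup>2"
      "(\<Sum>i\<in>UNIV. ?D2 (axis i 1, 0) (0, 1)) \<le> (H2_norm ?Q w)\<^sup>2"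
      using D D2 zero_le_power2[of "L2_norm ?Q w"] unfolding H2_norm_sq by linarith+
  qed (use T in auto)
  also have "\<dots> = (4 / T + 4 * T) * (H2_norm ?Q w)\<^sup>2" by (simp add: distrib_right)
  finally show ?thesis .
qed


section \<open>The differential operators\<close>

lemma L2_on_continuous_mult:
  fixes f :: "'a::euclidean_space \<Rightarrow> real"
  assumes U: "open U" "bounded U" and f: "continuous_on (closure U) f" and u: "u \<in> L2_on U"
  shows "(\<lambda>z. f z * u z) \<in> L2_on U"
proof -
  have "compact (f ` closure U)" using U f by (intro compact_continuous_image) auto
  then obtain B where B: "\<And>z. z \<in> closure U \<Longrightarrow> \<bar>f z\<bar> \<le> B"
    using compact_imp_bounded by (force simp: bounded_iff)
  have "continuous_on U f" using f closure_subset by (rule continuous_on_subset)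
  then have "f \<in> borel_measurable (lebesgue_on U)"
    using U by (intro continuous_imp_measurable_on_sets_lebesgue) auto
  then show ?thesis
    by (rule L2_on_bounded_mult[OF u]) (use B closure_subset in blast)
qed

lemma integral_lebesgue_on_mono_nonneg:
  fixes f :: "'a::euclidean_space \<Rightarrow> real"
  assumes "open V" "open U" "V \<subseteq> U" and f: "integrable (lebesgue_on U) f" and 0: "\<And>z. 0 \<le> f z"
  shows "(\<integral>z. f z \<partial>lebesgue_on V) \<le> (\<integral>z. f z \<partial>lebesgue_on U)" "integrable (lebesgue_on V) f"
proof -
  have iU: "integrable lebesgue (\<lambda>z. indicator U z *\<^sub>R f z)"
    using f assms by (subst (asm) integrable_restrict_space) auto
  have "integrable lebesgue (\<lambda>z. indicator V z *\<^sub>R (indicator U z *\<^sub>R f z))"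
    using iU assms(1) by (intro integrable_mult_indicator[where A=V]) auto
  moreover have "(\<lambda>z. indicator V z *\<^sub>R (indicator U z *\<^sub>R f z)) = (\<lambda>z. indicator V z *\<^sub>R f z)"
    using assms(3) by (auto simp: indicator_def fun_eq_iff)
  ultimately have iV: "integrable lebesgue (\<lambda>z. indicator V z *\<^sub>R f z)" by simp
  then show "integrable (lebesgue_on V) f"
    using assms by (subst integrable_restrict_space) auto
  have "(\<integral>z. indicator V z *\<^sub>R f z \<partial>lebesgue) \<le> (\<integral>z. indicator U z *\<^sub>R f z \<partial>lebesgue)"
    by (intro integral_mono iV iU) (use 0 assms(3) in \<open>auto simp: indicator_def\<close>)
  then show "(\<integral>z. f z \<partial>lebesgue_on V) \<le> (\<integral>z. f z \<partial>lebesgue_on U)"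
    using assms by (subst (1 2) integral_restrict_space) auto
qed

definition evolution_op :: "((real^'n::finite) \<times> real) set \<Rightarrow> ('n \<Rightarrow> 'n \<Rightarrow> (real^'n) \<times> real \<Rightarrow> real)
    \<Rightarrow> ('n \<Rightarrow> (real^'n) \<times> real \<Rightarrow> real) \<Rightarrow> ((real^'n) \<times> real \<Rightarrow> real)
    \<Rightarrow> ((real^'n) \<times> real \<Rightarrow> real) \<Rightarrow> (real^'n) \<times> real \<Rightarrow> real" where
  "evolution_op U a b c u z = dt U u z - L_op U a u z - A_op U b c u z"

lemma dx_L2_on: "u \<in> H1 U \<Longrightarrow> dx U i u \<in> L2_on U"
  unfolding dx_def by (rule weak_deriv_L2_on[OF H1D[OF _ space_direction_Basis]])

lemma dt_L2_on: "u \<in> H1 U \<Longrightarrow> dt U u \<in> L2_on U"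
  unfolding dt_def by (rule weak_deriv_L2_on[OF H1D[OF _ time_direction_Basis]])

lemma dx_H1: "open U \<Longrightarrow> bounded U \<Longrightarrow> u \<in> H2 U \<Longrightarrow> dx U i u \<in> H1 U"
  unfolding dx_def by (rule H2_weak_deriv_H1[OF _ _ _ space_direction_Basis])

lemma L_op_L2_on:
  assumes U: "open U" "bounded U" and a: "\<And>i j. continuous_on (closure U) (a i j)" and u: "u \<in> H2 U"
  shows "L_op U a u \<in> L2_on U"
proof -
  have "(\<lambda>z. \<Sum>i\<in>UNIV. \<Sum>j\<in>UNIV. a i j z * dx U j (dx U i u) z) \<in> L2_on U"
    by (intro L2_on_sum L2_on_continuous_mult U a dx_L2_on dx_H1 u)
  then show ?thesis unfolding L_op_def[abs_def] .
qed

lemma A_op_L2_on: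
  assumes U: "open U" "bounded U" and b: "\<And>j. continuous_on (closure U) (b j)"
    and c: "continuous_on (closure U) c" and u: "u \<in> H1 U"
  shows "A_op U b c u \<in> L2_on U"
proof -
  have "(\<lambda>z. (\<Sum>j\<in>UNIV. b j z * dx U j u z) + c z * u z) \<in> L2_on U"
    by (intro L2_on_add L2_on_sum L2_on_continuous_mult U b c dx_L2_on u H1_L2_on)
  then show ?thesis unfolding A_op_def[abs_def] .
qed

lemma evolution_op_L2_on:
  assumes U: "open U" "bounded U" and a: "\<And>i j. continuous_on (closure U) (a i j)"
    and b: "\<And>j. continuous_on (closure U) (b j)" and c: "continuous_on (closure U) c" and u: "u \<in> H2 U"
  shows "evolution_op U a b c u \<in> L2_on U"
  unfolding evolution_op_def[abs_def]
  by (intro L2_on_diff dt_L2_on L_op_L2_on A_op_L2_on H2_H1 assms)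

lemma evolution_op_diff_AE:
  assumes U: "open U" "bounded U" and u: "u \<in> H2 U" and v: "v \<in> H2 U"
  shows "AE z in lebesgue_on U. evolution_op U a b c (\<lambda>z. u z - v z) z =
    evolution_op U a b c u z - evolution_op U a b c v z"
proof -
  note H = H2_H1[OF u] H2_H1[OF v]
  have 1: "AE z in lebesgue_on U. dt U (\<lambda>z. u z - v z) z = dt U u z - dt U v z"
    unfolding dt_def by (rule weak_deriv_diff_AE[OF U H time_direction_Basis])
  have 2: "AE z in lebesgue_on U. \<forall>i. dx U i (\<lambda>z. u z - v z) z = dx U i u z - dx U i v z"
    unfolding dx_def by (intro eventually_all_finite weak_deriv_diff_AE U H space_direction_Basis)
  have 3: "AE z in lebesgue_on U. \<forall>i j. dx U j (dx U i (\<lambda>z. u z - v z)) z =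
      dx U j (dx U i u) z - dx U j (dx U i v) z"
    unfolding dx_def by (intro eventually_all_finite weak_deriv2_diff_AE U u v space_direction_Basis)
  from 1 2 3 show ?thesis
    by eventually_elim
      (simp add: evolution_op_def L_op_def A_op_def right_diff_distrib sum_subtractf)
qed

text \<open>\<open>A\<close> is the increment of \<open>F\<close> from \<open>(0, 0)\<close> to \<open>(\<nabla>w, w)\<close>, since \<open>p\<close> cancels. So the
  Lipschitz constant of \<open>F\<close> bounds it, uniformly in the coefficients.\<close>

lemma A_op_sq_le:
  assumes lo: "lower_order_coeffs \<Omega> T Cbar b c p" and z: "z \<in> closure (cylinder \<Omega> 0 T)"
  shows "(A_op U b c w z)\<^sup>2 \<le> Cbar\<^sup>2 * ((norm (grad U w z))\<^sup>2 + (w z)\<^sup>2)"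
proof -
  have lip: "Cbar-lipschitz_on UNIV (\<lambda>(\<xi>, s). F_fun b c p \<xi> s z)"
    using lo z by (auto simp: lower_order_coeffs_def)
  have "dist (F_fun b c p (grad U w z) (w z) z) (F_fun b c p 0 0 z) \<le> Cbar * dist (grad U w z, w z) (0, 0)"
    using lipschitz_onD[OF lip, of "(grad U w z, w z)" "(0, 0)"] by simp
  moreover have "dist (F_fun b c p (grad U w z) (w z) z) (F_fun b c p 0 0 z) = \<bar>A_op U b c w z\<bar>"
    by (simp add: dist_real_def F_fun_def A_op_def grad_def)
  moreover have "dist (grad U w z, w z) (0, 0) = sqrt ((norm (grad U w z))\<^sup>2 + (w z)\<^sup>2)"
    by (simp add: dist_Pair_Pair)
  ultimately have "\<bar>A_op U b c w z\<bar> \<le> Cbar * sqrt ((norm (grad U w z))\<^sup>2 + (w z)\<^sup>2)" by simp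
  then have "\<bar>A_op U b c w z\<bar>\<^sup>2 \<le> (Cbar * sqrt ((norm (grad U w z))\<^sup>2 + (w z)\<^sup>2))\<^sup>2"
    by (intro power_mono) auto
  then show ?thesis by (simp add: power_mult_distrib)
qed

lemma norm_grad_sq: "(norm (grad U w z))\<^sup>2 = (\<Sum>i\<in>UNIV. (dx U i w z)\<^sup>2)"
  by (simp add: norm_vec_def L2_set_def grad_def sum_nonneg)

lemma integrable_norm_grad_sq:
  "w \<in> H1 U \<Longrightarrow> integrable (lebesgue_on U) (\<lambda>z. (norm (grad U w z))\<^sup>2)"
  unfolding norm_grad_sq by (intro Bochner_Integration.integrable_sum L2_onD(2) dx_L2_on)

lemma H10_norm_sq: "(H10_norm U w)\<^sup>2 = (\<integral>z. (norm (grad U w z))\<^sup>2 + (w z)\<^sup>2 \<partial>lebesgue_on U)"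
  unfolding H10_norm_def by (intro real_sqrt_pow2 Bochner_Integration.integral_nonneg) auto

text \<open>The norm on the smaller set refers to the weak derivatives chosen there, which agree almost
  everywhere with those of the larger set.\<close>

lemma H10_norm_restrict:
  fixes w :: "(real^'n::finite) \<times> real \<Rightarrow> real"
  assumes V: "open V" "open U" "V \<subseteq> U" "bounded U" and w: "w \<in> H1 U"
  shows "(H10_norm V w)\<^sup>2 = (\<integral>z. (norm (grad U w z))\<^sup>2 + (w z)\<^sup>2 \<partial>lebesgue_on V)"
proof -
  have bV: "bounded V" using V bounded_subset by blast
  have wd: "has_weak_deriv V (axis i 1, 0) w (weak_deriv U (axis i 1, 0) w)" for i
    by (rule has_weak_deriv_mono[OF V(1-3) space_direction_Basis H1D[OF w space_direction_Basis]])
  then have "AE z in lebesgue_on V. \<forall>i. dx V i w z = dx U i w z"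
    unfolding dx_def by (intro eventually_all_finite weak_deriv_AE V(1) bV)
  then have ae: "AE z in lebesgue_on V. (norm (grad V w z))\<^sup>2 + (w z)\<^sup>2 = (norm (grad U w z))\<^sup>2 + (w z)\<^sup>2"
    by eventually_elim (simp add: norm_grad_sq)
  have L: "dx V i w \<in> L2_on V" "dx U i w \<in> L2_on V" "w \<in> L2_on V" for i
    using wd[of i] weak_deriv_L2_on[OF wd[of i]] by (auto simp: dx_def has_weak_deriv_def)
  show ?thesis
    unfolding H10_norm_sq
    by (rule integral_cong_AE[OF _ _ ae]) (use L[THEN L2_onD(1)] in \<open>simp_all add: norm_grad_sq\<close>)
qed

section \<open>From the Carleman estimate to the convergence rate\<close>

text \<open>The weight lies between \<open>exp (2 (\<tau> + 1) powr \<nu>)\<close> and \<open>exp (2 (T + 1) powr \<nu>)\<close> for times in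
  \<open>(\<tau>, T)\<close>. In the Carleman estimate \<open>u\<^sub>t - L u\<close> is the evolution operator plus \<open>A u\<close>. The
  contribution of \<open>A u\<close> has a coefficient independent of \<open>\<nu>\<close>, so half of the lower bound absorbs it
  once \<open>\<surd>\<nu>\<close> is large compared with \<open>Cbar\<^sup>2 / C\<close>. In the application \<open>R\<close> is the squared norm of the
  gradient at time \<open>0\<close>; it carries no exponential factor, which is decisive.\<close>

lemma carleman_imp_H10_bound:
  fixes \<Omega> :: "(real^'n::finite) set" and T :: real
  defines "Q \<equiv> cylinder \<Omega> 0 T" and "W \<equiv> (\<lambda>\<nu> z. exp (2 * (snd z + 1) powr \<nu>))"
  assumes \<Omega>: "open \<Omega>" "bounded \<Omega>" and T: "0 < T" and \<tau>: "0 < \<tau>" "\<tau> < T"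
    and lo: "lower_order_coeffs \<Omega> T Cbar b c p"
    and a: "\<And>i j. continuous_on (closure Q) (a i j)" and w: "w \<in> H2 Q"
    and C: "0 < C" and \<nu>: "1 \<le> \<nu>" "4 * Cbar\<^sup>2 \<le> C * sqrt \<nu>"
    and carleman: "(\<integral>z. (dt Q w z - L_op Q a w z)\<^sup>2 * W \<nu> z \<partial>lebesgue_on Q)
            \<ge> C * sqrt \<nu> * (\<integral>z. (norm (grad Q w z))\<^sup>2 * W \<nu> z \<partial>lebesgue_on Q)
              + C * \<nu>\<^sup>2 * (\<integral>z. (w z)\<^sup>2 * W \<nu> z \<partial>lebesgue_on Q) - C * R"
  shows "exp (2 * (\<tau> + 1) powr \<nu>) * (H10_norm (cylinder \<Omega> \<tau> T) w)\<^sup>2 \<le>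
    4 / C * exp (2 * (T + 1) powr \<nu>) * (L2_norm Q (evolution_op Q a b c w))\<^sup>2 + 2 * R"
proof -
  have Q: "open Q" "bounded Q" unfolding Q_def by (intro open_cylinder bounded_cylinder \<Omega>)+
  have bc: "continuous_on (closure Q) (b j)" "continuous_on (closure Q) c" for j
    using lo by (auto simp: lower_order_coeffs_def Q_def)
  note wH1 = H2_H1[OF w] and wL = H1_L2_on[OF H2_H1[OF w]]
  define E where "E = exp (2 * (T + 1) powr \<nu>)"
  have W: "0 \<le> W \<nu> z" "z \<in> Q \<Longrightarrow> W \<nu> z \<le> E" for z
  proof -
    show "0 \<le> W \<nu> z" by (simp add: W_def)
    show "z \<in> Q \<Longrightarrow> W \<nu> z \<le> E"
      using \<nu> by (auto simp: W_def E_def Q_def cylinder_def intro!: powr_mono2)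
  qed
  have Wm: "W \<nu> \<in> borel_measurable (lebesgue_on Q)"
  proof -
    have "W \<nu> \<in> borel_measurable borel" unfolding W_def borel_prod[symmetric] by measurable
    then show ?thesis by (auto intro!: measurable_restrict_space1 measurable_completion)
  qed
  have iW: "integrable (lebesgue_on Q) (\<lambda>z. f z * W \<nu> z)" if "integrable (lebesgue_on Q) f" for f
    by (rule integrable_bounded_mult[OF that Wm, of E]) (use W in auto)
  let ?P = "evolution_op Q a b c w"
  let ?I1 = "\<integral>z. (norm (grad Q w z))\<^sup>2 * W \<nu> z \<partial>lebesgue_on Q"
  let ?I2 = "\<integral>z. (w z)\<^sup>2 * W \<nu> z \<partial>lebesgue_on Q"
  note PL = evolution_op_L2_on[OF Q a bc w]
  note i1 = iW[OF integrable_norm_grad_sq[OF wH1]] and i2 = iW[OF L2_onD(2)[OF wL]]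
  have I0: "0 \<le> ?I1" "0 \<le> ?I2" by (auto intro!: Bochner_Integration.integral_nonneg simp: W)
  have "(\<integral>z. (dt Q w z - L_op Q a w z)\<^sup>2 * W \<nu> z \<partial>lebesgue_on Q) \<le>
      (\<integral>z. 2 * E * (?P z)\<^sup>2 + 2 * Cbar\<^sup>2 * ((norm (grad Q w z))\<^sup>2 * W \<nu> z + (w z)\<^sup>2 * W \<nu> z) \<partial>lebesgue_on Q)"
  proof (rule integral_mono)
    show "integrable (lebesgue_on Q) (\<lambda>z. (dt Q w z - L_op Q a w z)\<^sup>2 * W \<nu> z)"
      by (intro iW L2_onD(2) L2_on_diff dt_L2_on L_op_L2_on Q a wH1 w)
    show "integrable (lebesgue_on Q) (\<lambda>z. 2 * E * (?P z)\<^sup>2 + 2 * Cbar\<^sup>2 * ((norm (grad Q w z))\<^sup>2 * W \<nu> z + (w z)\<^sup>2 * W \<nu> z))"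
      by (intro Bochner_Integration.integrable_add integrable_mult_right L2_onD(2) PL i1 i2)
    fix z assume "z \<in> space (lebesgue_on Q)"
    then have z: "z \<in> Q" by simp
    then have A: "(A_op Q b c w z)\<^sup>2 \<le> Cbar\<^sup>2 * ((norm (grad Q w z))\<^sup>2 + (w z)\<^sup>2)"
      using closure_subset by (intro A_op_sq_le[OF lo]) (auto simp: Q_def)
    have "(dt Q w z - L_op Q a w z)\<^sup>2 = (?P z - - A_op Q b c w z)\<^sup>2"
      by (simp add: evolution_op_def)
    also have "\<dots> \<le> 2 * (?P z)\<^sup>2 + 2 * (- A_op Q b c w z)\<^sup>2" by (rule power2_diff_le)
    also have "\<dots> \<le> 2 * (?P z)\<^sup>2 + 2 * (Cbar\<^sup>2 * ((norm (grad Q w z))\<^sup>2 + (w z)\<^sup>2))" using A by simp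
    finally have "(dt Q w z - L_op Q a w z)\<^sup>2 * W \<nu> z \<le>
        (2 * (?P z)\<^sup>2 + 2 * (Cbar\<^sup>2 * ((norm (grad Q w z))\<^sup>2 + (w z)\<^sup>2))) * W \<nu> z"
      by (rule mult_right_mono) (rule W)
    also have "\<dots> = 2 * (W \<nu> z * (?P z)\<^sup>2) + 2 * Cbar\<^sup>2 * ((norm (grad Q w z))\<^sup>2 * W \<nu> z + (w z)\<^sup>2 * W \<nu> z)"
      by (simp add: algebra_simps)
    also have "W \<nu> z * (?P z)\<^sup>2 \<le> E * (?P z)\<^sup>2" by (intro mult_right_mono W z) simp
    finally show "(dt Q w z - L_op Q a w z)\<^sup>2 * W \<nu> z \<le>
        2 * E * (?P z)\<^sup>2 + 2 * Cbar\<^sup>2 * ((norm (grad Q w z))\<^sup>2 * W \<nu> z + (w z)\<^sup>2 * W \<nu> z)"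
      by simp
  qed
  also have "\<dots> = 2 * E * (L2_norm Q ?P)\<^sup>2 + 2 * Cbar\<^sup>2 * (?I1 + ?I2)"
    unfolding L2_norm_sq using L2_onD(2)[OF PL] i1 i2 by simp
  finally have up: "(\<integral>z. (dt Q w z - L_op Q a w z)\<^sup>2 * W \<nu> z \<partial>lebesgue_on Q) \<le>
      2 * E * (L2_norm Q ?P)\<^sup>2 + 2 * Cbar\<^sup>2 * (?I1 + ?I2)" .
  have "sqrt \<nu> \<le> \<nu>\<^sup>2"
  proof -
    have "sqrt \<nu> \<le> \<nu>" using \<nu>(1) by (intro real_le_lsqrt) (auto simp: power2_eq_square)
    also have "\<dots> \<le> \<nu>\<^sup>2" using \<nu>(1) by (simp add: power2_eq_square)
    finally show ?thesis .
  qed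
  then have "C * sqrt \<nu> * ?I2 \<le> C * \<nu>\<^sup>2 * ?I2"
    using C I0 by (intro mult_right_mono mult_left_mono) auto
  with up carleman have "C * sqrt \<nu> * ?I1 + C * sqrt \<nu> * ?I2 - C * R \<le>
      2 * E * (L2_norm Q ?P)\<^sup>2 + 2 * Cbar\<^sup>2 * (?I1 + ?I2)" by linarith
  moreover have "C / 2 * (?I1 + ?I2) \<le> (C * sqrt \<nu> - 2 * Cbar\<^sup>2) * (?I1 + ?I2)"
  proof (rule mult_right_mono)
    have "C * 1 \<le> C * sqrt \<nu>" using C \<nu>(1) by (intro mult_left_mono) auto
    then show "C / 2 \<le> C * sqrt \<nu> - 2 * Cbar\<^sup>2" using \<nu>(2) by simp
  qed (use I0 in simp)
  ultimately have "C / 2 * (?I1 + ?I2) \<le> 2 * E * (L2_norm Q ?P)\<^sup>2 + C * R"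
    by (simp add: algebra_simps)
  then have S: "?I1 + ?I2 \<le> 4 / C * E * (L2_norm Q ?P)\<^sup>2 + 2 * R"
    using C by (simp add: field_simps)
  define V where "V = cylinder \<Omega> \<tau> T"
  have V: "open V" "V \<subseteq> Q" unfolding V_def using \<tau> by (auto simp: Q_def cylinder_def open_cylinder[OF \<Omega>(1), unfolded cylinder_def])
  define f where "f = (\<lambda>z. (norm (grad Q w z))\<^sup>2 + (w z)\<^sup>2)"
  have fi: "integrable (lebesgue_on Q) f"
    unfolding f_def by (intro Bochner_Integration.integrable_add integrable_norm_grad_sq wH1 L2_onD(2) wL)
  have f0: "0 \<le> f z" for z by (simp add: f_def)
  have "exp (2 * (\<tau> + 1) powr \<nu>) * (H10_norm V w)\<^sup>2 = (\<integral>z. exp (2 * (\<tau> + 1) powr \<nu>) * f z \<partial>lebesgue_on V)"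
    unfolding H10_norm_restrict[OF V(1) Q(1) V(2) Q(2) wH1] f_def by simp
  also have "\<dots> \<le> (\<integral>z. f z * W \<nu> z \<partial>lebesgue_on V)"
  proof (rule integral_mono)
    show "integrable (lebesgue_on V) (\<lambda>z. exp (2 * (\<tau> + 1) powr \<nu>) * f z)"
      using integral_lebesgue_on_mono_nonneg(2)[OF V(1) Q(1) V(2) fi f0] by simp
    show "integrable (lebesgue_on V) (\<lambda>z. f z * W \<nu> z)"
      by (rule integral_lebesgue_on_mono_nonneg(2)[OF V(1) Q(1) V(2) iW[OF fi]]) (simp add: f0 W)
    fix z assume "z \<in> space (lebesgue_on V)"
    then have "\<tau> + 1 \<le> snd z + 1" by (auto simp: V_def cylinder_def)
    then have "exp (2 * (\<tau> + 1) powr \<nu>) \<le> W \<nu> z"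
      using \<tau> \<nu>(1) unfolding W_def by (auto intro!: powr_mono2)
    then show "exp (2 * (\<tau> + 1) powr \<nu>) * f z \<le> f z * W \<nu> z"
      using f0[of z] by (simp add: mult.commute mult_left_mono)
  qed
  also have "\<dots> \<le> (\<integral>z. f z * W \<nu> z \<partial>lebesgue_on Q)"
    by (rule integral_lebesgue_on_mono_nonneg(1)[OF V(1) Q(1) V(2) iW[OF fi]]) (simp add: f0 W)
  also have "\<dots> = ?I1 + ?I2" unfolding f_def using i1 i2 by (simp add: distrib_right)
  finally show ?thesis using S by (simp add: V_def E_def)
qed

text \<open>Compare the values of the functional at \<open>v\<close> and at \<open>v_star\<close>. The latter is at most
  \<open>\<delta>\<^sup>2 (1 + \<parallel>v_star\<parallel>\<^sup>2)\<close>, since \<open>v_star\<close> has residual \<open>q_star - q\<close>. As the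
  regularization parameter is \<open>\<delta>\<^sup>2\<close>, the residual of \<open>v\<close> is of order \<open>\<delta>\<close> while its
  \<open>H\<^sup>2\<close> norm is of order \<open>1\<close>.\<close>

lemma minimizer_bounds:
  fixes \<Omega> :: "(real^'n::finite) set" and T :: real
  defines "Q \<equiv> cylinder \<Omega> 0 T"
  assumes \<Omega>: "open \<Omega>" "bounded \<Omega>"
    and a: "\<And>i j. continuous_on (closure Q) (a i j)" and b: "\<And>j. continuous_on (closure Q) (b j)"
    and c: "continuous_on (closure Q) c"
    and \<delta>: "0 < \<delta>" and qs: "q_star \<in> L2_on Q" and q: "q \<in> L2_on Q"
    and vs: "v_star \<in> H2_0 \<Omega> T"
    and eq: "AE z in lebesgue_on Q. evolution_op Q a b c v_star z = q_star z"
    and qq: "L2_norm Q (\<lambda>z. q z - q_star z) < \<delta>"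
    and min: "is_arg_min (J_functional Q a b c q (\<delta>\<^sup>2)) (\<lambda>v. v \<in> H2_0 \<Omega> T) v"
  shows "(L2_norm Q (evolution_op Q a b c (\<lambda>z. v z - v_star z)))\<^sup>2 \<le> 4 * \<delta>\<^sup>2 * (1 + (H2_norm Q v_star)\<^sup>2)"
    and "(H2_norm Q (\<lambda>z. v z - v_star z))\<^sup>2 \<le> 4 * (1 + (H2_norm Q v_star)\<^sup>2)"
proof -
  have Q: "open Q" "bounded Q" unfolding Q_def by (intro open_cylinder bounded_cylinder \<Omega>)+
  let ?P = "evolution_op Q a b c" and ?m = "H2_norm Q v_star"
  have v0: "v \<in> H2_0 \<Omega> T" using min by (simp add: is_arg_min_def)
  have H: "v \<in> H2 Q" "v_star \<in> H2 Q" using v0 vs by (auto simp: H2_0_def Q_def)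
  have PL: "?P v \<in> L2_on Q" "?P v_star \<in> L2_on Q"
    by (intro evolution_op_L2_on Q a b c H)+
  have J: "J_functional Q a b c q (\<delta>\<^sup>2) u = (L2_norm Q (\<lambda>z. ?P u z - q z))\<^sup>2 + \<delta>\<^sup>2 * (H2_norm Q u)\<^sup>2" for u
    by (simp add: J_functional_def L2_norm_sq evolution_op_def)
  have qq2: "(L2_norm Q (\<lambda>z. q z - q_star z))\<^sup>2 \<le> \<delta>\<^sup>2"
    using qq by (intro power_mono) (auto simp: L2_norm_nonneg)
  have "L2_norm Q (\<lambda>z. ?P v_star z - q z) = L2_norm Q (\<lambda>z. q_star z - q z)"
    by (rule L2_norm_cong_AE[OF Q(1)]) (use PL q eq in \<open>auto intro!: L2_on_diff elim!: eventually_mono\<close>)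
  also have "\<dots> = L2_norm Q (\<lambda>z. q z - q_star z)" by (simp add: L2_norm_def power2_commute)
  finally have "J_functional Q a b c q (\<delta>\<^sup>2) v_star \<le> \<delta>\<^sup>2 * (1 + ?m\<^sup>2)"
    using qq2 by (simp add: J distrib_left)
  moreover have "J_functional Q a b c q (\<delta>\<^sup>2) v \<le> J_functional Q a b c q (\<delta>\<^sup>2) v_star"
    using min vs by (auto simp: is_arg_min_def not_less)
  ultimately have Jv: "(L2_norm Q (\<lambda>z. ?P v z - q z))\<^sup>2 + \<delta>\<^sup>2 * (H2_norm Q v)\<^sup>2 \<le> \<delta>\<^sup>2 * (1 + ?m\<^sup>2)"
    by (simp add: J)
  have "\<delta>\<^sup>2 * (H2_norm Q v)\<^sup>2 \<le> \<delta>\<^sup>2 * (1 + ?m\<^sup>2)"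
    using Jv zero_le_power2[of "L2_norm Q (\<lambda>z. ?P v z - q z)"] by linarith
  then have Hv: "(H2_norm Q v)\<^sup>2 \<le> 1 + ?m\<^sup>2" using \<delta> by simp
  have Pv: "(L2_norm Q (\<lambda>z. ?P v z - q z))\<^sup>2 \<le> \<delta>\<^sup>2 * (1 + ?m\<^sup>2)"
    using Jv by (smt (verit) mult_nonneg_nonneg zero_le_power2)
  have "(H2_norm Q (\<lambda>z. v z - v_star z))\<^sup>2 \<le> 2 * (H2_norm Q v)\<^sup>2 + 2 * ?m\<^sup>2"
    by (rule H2_norm_sq_diff_le[OF Q H])
  then show "(H2_norm Q (\<lambda>z. v z - v_star z))\<^sup>2 \<le> 4 * (1 + ?m\<^sup>2)"
    using Hv by (simp add: field_simps)
  have "L2_norm Q (?P (\<lambda>z. v z - v_star z)) = L2_norm Q (\<lambda>z. (?P v z - q z) - (q_star z - q z))"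
  proof (rule L2_norm_cong_AE[OF Q(1)])
    show "?P (\<lambda>z. v z - v_star z) \<in> L2_on Q" by (intro evolution_op_L2_on Q a b c H2_diff H)
    show "AE z in lebesgue_on Q. ?P (\<lambda>z. v z - v_star z) z = (?P v z - q z) - (q_star z - q z)"
      using evolution_op_diff_AE[OF Q H, of a b c] eq by eventually_elim simp
  qed
  then have "(L2_norm Q (?P (\<lambda>z. v z - v_star z)))\<^sup>2 \<le>
      2 * (L2_norm Q (\<lambda>z. ?P v z - q z))\<^sup>2 + 2 * (L2_norm Q (\<lambda>z. q_star z - q z))\<^sup>2"
    using L2_norm_sq_diff_le[OF L2_on_diff[OF PL(1) q] L2_on_diff[OF qs q]] by simp
  also have "L2_norm Q (\<lambda>z. q_star z - q z) = L2_norm Q (\<lambda>z. q z - q_star z)"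
    by (simp add: L2_norm_def power2_commute)
  also have "2 * (L2_norm Q (\<lambda>z. ?P v z - q z))\<^sup>2 + 2 * (L2_norm Q (\<lambda>z. q z - q_star z))\<^sup>2 \<le>
      2 * (\<delta>\<^sup>2 * (1 + ?m\<^sup>2)) + 2 * (\<delta>\<^sup>2 * (1 + ?m\<^sup>2))"
  proof -
    have "\<delta>\<^sup>2 * 1 \<le> \<delta>\<^sup>2 * (1 + ?m\<^sup>2)" by (intro mult_left_mono) auto
    then show ?thesis using Pv qq2 by linarith
  qed
  finally show "(L2_norm Q (?P (\<lambda>z. v z - v_star z)))\<^sup>2 \<le> 4 * \<delta>\<^sup>2 * (1 + ?m\<^sup>2)"
    by (simp add: algebra_simps)
qed

lemma time_exponent_bounds:
  assumes "0 < \<tau>" "\<tau> < T"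
  shows "time_exponent \<tau> T \<in> {0<..<1}"
  using assms by (auto simp: time_exponent_def divide_simps)

text \<open>The solution \<open>\<nu>\<close> of \<open>(T + 1) powr \<nu> = ln (1 / \<delta>) / 2\<close>.\<close>

definition carleman_parameter :: "real \<Rightarrow> real \<Rightarrow> real" where
  "carleman_parameter T \<delta> = ln ((ln (\<delta> powr (-1/2))) powr (1 / ln (T + 1)))"

lemma ln_powr_minus_half: "0 < \<delta> \<Longrightarrow> ln (\<delta> powr (-1/2)) = ln (1 / \<delta>) / 2" for \<delta> :: real
  by (simp add: ln_powr ln_div)

lemma carleman_parameter_eq:
  assumes "0 < \<delta>" "\<delta> < 1"
  shows "carleman_parameter T \<delta> = ln (ln (1 / \<delta>) / 2) / ln (T + 1)"
proof -
  have "0 < ln (1 / \<delta>) / 2" using assms by simp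
  then show ?thesis
    unfolding carleman_parameter_def ln_powr_minus_half[OF assms(1)] by (simp add: ln_powr)
qed

lemma carleman_parameter_antimono:
  assumes "0 < \<delta>" "\<delta> \<le> \<delta>0" "\<delta>0 < 1" "0 < T"
  shows "carleman_parameter T \<delta>0 \<le> carleman_parameter T \<delta>"
proof -
  have "ln (1 / \<delta>0) \<le> ln (1 / \<delta>)" "0 < ln (1 / \<delta>0)"
    using assms by (auto simp: frac_le)
  then have "ln (ln (1 / \<delta>0) / 2) \<le> ln (ln (1 / \<delta>) / 2)" by (subst ln_le_cancel_iff) auto
  then show ?thesis
    using assms by (simp add: carleman_parameter_eq divide_right_mono)
qed

text \<open>Here \<open>\<tau> + 1\<close> is the power of \<open>T + 1\<close> with exponent \<open>time_exponent \<tau> T\<close>; this is where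
  the exponent of the rate comes from. For \<open>\<tau> = T\<close> it is the defining equation of \<open>\<nu>\<close>.\<close>

lemma carleman_parameter_powr:
  assumes "0 < \<delta>" "\<delta> < 1" "0 < T" "-1 < \<tau>"
  shows "(\<tau> + 1) powr carleman_parameter T \<delta> =
    1 / 2 powr time_exponent \<tau> T * ln (1 / \<delta>) powr time_exponent \<tau> T"
proof -
  have x: "0 < ln (1 / \<delta>)" using assms by simp
  have "(\<tau> + 1) powr carleman_parameter T \<delta> = (ln (1 / \<delta>) / 2) powr time_exponent \<tau> T"
    using assms x by (simp add: powr_def carleman_parameter_eq time_exponent_def)
  also have "\<dots> = ln (1 / \<delta>) powr time_exponent \<tau> T / 2 powr time_exponent \<tau> T"
    using x by (simp add: powr_divide)
  finally show ?thesis by simp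
qed

theorem theorem4p2:
  fixes \<Omega> :: "(real^'n::finite) set" and T \<mu>1 \<mu>2 K Cbar \<nu>0 \<nu>1 :: real
  assumes "bounded_domain \<Omega>" and "piecewise_smooth_boundary \<Omega>" and "0 < T"
    and "0 < \<mu>1" and "\<mu>1 \<le> \<mu>2" and "0 < Cbar"
    and "1 < \<nu>0" and "carleman_estimate \<Omega> T \<mu>1 \<mu>2 K \<nu>0"
    and "\<nu>0 \<le> \<nu>1" and "stability_estimate \<Omega> T \<mu>1 \<mu>2 K Cbar \<nu>1"
  shows "\<exists>\<nu>2 C1. \<nu>2 \<ge> \<nu>1 \<and> \<nu>1 \<ge> \<nu>0 \<and> \<nu>0 > 1 \<and> C1 > 0 \<and>
    (\<forall>a b c p. diffusion_coeffs \<Omega> T \<mu>1 \<mu>2 K a \<and> lower_order_coeffs \<Omega> T Cbar b c p \<longrightarrow>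
      (\<forall>\<delta>0 \<delta> \<alpha> q_star v_star q v_min.
         0 < \<delta>0 \<and> \<delta>0 < 1 \<and> ln ((ln (\<delta>0 powr (-1/2))) powr (1 / ln (T + 1))) \<ge> \<nu>2 \<and>
         0 < \<delta> \<and> \<delta> < \<delta>0 \<and> \<alpha> = \<delta>\<^sup>2 \<and>
         q_star \<in> L2_on (cylinder \<Omega> 0 T) \<and> v_star \<in> H2_0 \<Omega> T \<and>
         (AE z in lebesgue_on (cylinder \<Omega> 0 T).
            dt (cylinder \<Omega> 0 T) v_star z =
              L_op (cylinder \<Omega> 0 T) a v_star z + A_op (cylinder \<Omega> 0 T) b c v_star z + q_star z) \<and>
         q \<in> L2_on (cylinder \<Omega> 0 T) \<and> L2_norm (cylinder \<Omega> 0 T) (\<lambda>z. q z - q_star z) < \<delta> \<and>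
         unique_minimizer (cylinder \<Omega> 0 T) (J_functional (cylinder \<Omega> 0 T) a b c q \<alpha>)
           (H2_0 \<Omega> T) v_min \<longrightarrow>
         (\<forall>\<tau>\<in>{0<..<T}.
            time_exponent \<tau> T \<in> {0<..<1} \<and>
            H10_norm (cylinder \<Omega> \<tau> T) (\<lambda>z. v_min z - v_star z)
              \<le> C1 * (1 + H2_norm (cylinder \<Omega> 0 T) v_star) *
                exp (- (1 / 2 powr time_exponent \<tau> T * (ln (1 / \<delta>)) powr time_exponent \<tau> T)))))"
proof -
  let ?Q = "cylinder \<Omega> 0 T"
  have \<Omega>: "open \<Omega>" "bounded \<Omega>" using assms(1) by (auto simp: bounded_domain_def)
  note T = assms(3)
  have Q: "open ?Q" "bounded ?Q" by (intro open_cylinder bounded_cylinder \<Omega>)+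
  obtain C where C: "0 < C" and carleman: "\<And>a \<nu> u. diffusion_coeffs \<Omega> T \<mu>1 \<mu>2 K a \<Longrightarrow> \<nu>0 \<le> \<nu> \<Longrightarrow>
      u \<in> H2 ?Q \<Longrightarrow> zero_lateral_trace \<Omega> T u \<Longrightarrow>
      (\<integral>z. (dt ?Q u z - L_op ?Q a u z)\<^sup>2 * exp (2 * (snd z + 1) powr \<nu>) \<partial>lebesgue_on ?Q)
            \<ge> C * sqrt \<nu> * (\<integral>z. (norm (grad ?Q u z))\<^sup>2 * exp (2 * (snd z + 1) powr \<nu>) \<partial>lebesgue_on ?Q)
              + C * \<nu>\<^sup>2 * (\<integral>z. (u z)\<^sup>2 * exp (2 * (snd z + 1) powr \<nu>) \<partial>lebesgue_on ?Q)
              - C * exp (3 * (T + 1) powr \<nu>) * (L2_norm \<Omega> (time_trace \<Omega> T u T))\<^sup>2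
              - C * (grad_time_trace_norm \<Omega> T u 0)\<^sup>2"
    using assms(8) unfolding carleman_estimate_def Let_def by blast
  \<comment> \<open>The second number is the threshold from which \<open>A\<close> is absorbed, \<open>C\<close> being the Carleman constant.\<close>
  define \<nu>2 where "\<nu>2 = max \<nu>1 ((4 * Cbar\<^sup>2 / C)\<^sup>2)"
  \<comment> \<open>The constant of the trace inequality for the gradient at time \<open>0\<close>.\<close>
  define D where "D = 4 / T + 4 * T"
  \<comment> \<open>With \<open>m\<close> the norm of \<open>v_star\<close>, both \<open>\<parallel>P w\<parallel>\<^sup>2 / \<delta>\<close> and \<open>\<parallel>w\<parallel>\<^sup>2\<close> will be at most \<open>4 (1 + m\<^sup>2)\<close>.\<close>
  define C1 where "C1 = sqrt (16 / C + 8 * D)"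
  have D: "0 < D" using T by (simp add: D_def add_pos_pos)
  have C1: "0 < C1" unfolding C1_def using C D by (simp add: add_pos_pos)
  have main: "H10_norm (cylinder \<Omega> \<tau> T) (\<lambda>z. v z - v_star z)
      \<le> C1 * (1 + H2_norm ?Q v_star) *
        exp (- (1 / 2 powr time_exponent \<tau> T * (ln (1 / \<delta>)) powr time_exponent \<tau> T))"
    if a: "diffusion_coeffs \<Omega> T \<mu>1 \<mu>2 K a" and lo: "lower_order_coeffs \<Omega> T Cbar b c p"
      and \<delta>0: "\<delta>0 < 1" "\<nu>2 \<le> carleman_parameter T \<delta>0" and \<delta>: "0 < \<delta>" "\<delta> < \<delta>0"
      and qs: "q_star \<in> L2_on ?Q" and vs: "v_star \<in> H2_0 \<Omega> T"
      and eq: "AE z in lebesgue_on ?Q. dt ?Q v_star z = L_op ?Q a v_star z + A_op ?Q b c v_star z + q_star z"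
      and q: "q \<in> L2_on ?Q" "L2_norm ?Q (\<lambda>z. q z - q_star z) < \<delta>"
      and min: "unique_minimizer ?Q (J_functional ?Q a b c q (\<delta>\<^sup>2)) (H2_0 \<Omega> T) v"
      and \<tau>: "0 < \<tau>" "\<tau> < T"
    for a b c p \<delta>0 \<delta> q_star v_star q v \<tau>
  proof -
    define \<nu> where "\<nu> = carleman_parameter T \<delta>"
    define w where "w = (\<lambda>z. v z - v_star z)"
    define m where "m = H2_norm ?Q v_star"
    have \<nu>2\<nu>: "\<nu>2 \<le> \<nu>" unfolding \<nu>_def using carleman_parameter_antimono[of \<delta> \<delta>0 T] \<delta>0 \<delta> T by simp
    then have \<nu>: "\<nu>0 \<le> \<nu>" "1 \<le> \<nu>" "(4 * Cbar\<^sup>2 / C)\<^sup>2 \<le> \<nu>"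
      using assms(7,9) by (auto simp: \<nu>2_def)
    have ac: "continuous_on (closure ?Q) (a i j)" for i j
      using a by (auto simp: diffusion_coeffs_def C1_closure_def)
    have bc: "continuous_on (closure ?Q) (b j)" "continuous_on (closure ?Q) c" for j
      using lo by (auto simp: lower_order_coeffs_def)
    have minv: "is_arg_min (J_functional ?Q a b c q (\<delta>\<^sup>2)) (\<lambda>v. v \<in> H2_0 \<Omega> T) v"
      using min by (simp add: unique_minimizer_def)
    then have v0: "v \<in> H2_0 \<Omega> T" by (simp add: is_arg_min_def)
    have H: "v \<in> H2 ?Q" "v_star \<in> H2 ?Q" using v0 vs by (auto simp: H2_0_def)
    have wH: "w \<in> H2 ?Q" unfolding w_def by (rule H2_diff[OF Q H])
    have eq': "AE z in lebesgue_on ?Q. evolution_op ?Q a b c v_star z = q_star z"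
      using eq by eventually_elim (simp add: evolution_op_def)
    note bounds = minimizer_bounds[OF \<Omega> ac bc \<delta>(1) qs q(1) vs eq' q(2) minv, folded w_def m_def]
    have lat: "zero_lateral_trace \<Omega> T w"
    proof -
      have "lateral \<Omega> T \<in> sets borel"
        unfolding lateral_def by (intro borel_Times borel_closed borel_open) auto
      then show ?thesis
        using v0 vs unfolding w_def zero_lateral_trace_def
        by (intro has_boundary_trace_zero_diff Q) (auto simp: H2_0_def zero_lateral_trace_def)
    qed
    have "has_time_trace \<Omega> T w T (\<lambda>_. 0)"
      unfolding w_def using v0 vs by (intro has_time_trace_zero_diff) (auto simp: H2_0_def)
    then have "(L2_norm \<Omega> (time_trace \<Omega> T w T))\<^sup>2 \<le> 2 * (L2_norm \<Omega> (\<lambda>_. 0))\<^sup>2"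
      by (intro L2_norm_time_trace_le T) auto
    then have tr0: "(L2_norm \<Omega> (time_trace \<Omega> T w T))\<^sup>2 = 0"
      using zero_le_power2[of "L2_norm \<Omega> (time_trace \<Omega> T w T)"] L2_norm_sq[of \<Omega> "\<lambda>_. 0"] by simp
    have Csq: "4 * Cbar\<^sup>2 \<le> C * sqrt \<nu>"
    proof -
      have "4 * Cbar\<^sup>2 / C \<le> sqrt \<nu>" using \<nu>(3) by (rule real_le_rsqrt)
      then show ?thesis using C by (simp add: field_simps)
    qed
    have "exp (2 * (\<tau> + 1) powr \<nu>) * (H10_norm (cylinder \<Omega> \<tau> T) w)\<^sup>2 \<le>
        4 / C * exp (2 * (T + 1) powr \<nu>) * (L2_norm ?Q (evolution_op ?Q a b c w))\<^sup>2 +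
        2 * (grad_time_trace_norm \<Omega> T w 0)\<^sup>2"
      by (rule carleman_imp_H10_bound[OF \<Omega> T \<tau> lo ac wH C \<nu>(2) Csq])
         (use carleman[OF a \<nu>(1) wH lat] tr0 in simp)
    also have "\<dots> \<le> 4 / C * (4 * (1 + m\<^sup>2)) + 2 * (D * (4 * (1 + m\<^sup>2)))"
    proof (intro add_mono mult_left_mono)
      have E: "exp (2 * (T + 1) powr \<nu>) = 1 / \<delta>"
      proof -
        have "time_exponent T T = 1" using T by (simp add: time_exponent_def)
        then have "(T + 1) powr \<nu> = ln (1 / \<delta>) / 2"
          unfolding \<nu>_def using carleman_parameter_powr[of \<delta> T T] \<delta> \<delta>0 T by simp
        then have "2 * (T + 1) powr \<nu> = ln (1 / \<delta>)" by simp
        moreover have "exp (ln (1 / \<delta>)) = 1 / \<delta>" using \<delta> by (intro exp_ln) simp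
        ultimately show ?thesis by simp
      qed
      have "1 / \<delta> * (L2_norm ?Q (evolution_op ?Q a b c w))\<^sup>2 \<le> 1 / \<delta> * (4 * \<delta>\<^sup>2 * (1 + m\<^sup>2))"
        using bounds(1) \<delta> by (intro mult_left_mono) auto
      also have "\<dots> = \<delta> * (4 * (1 + m\<^sup>2))" using \<delta> by (simp add: power2_eq_square)
      also have "\<dots> \<le> 1 * (4 * (1 + m\<^sup>2))" using \<delta> \<delta>0 by (intro mult_right_mono) auto
      finally have "exp (2 * (T + 1) powr \<nu>) * (L2_norm ?Q (evolution_op ?Q a b c w))\<^sup>2 \<le> 4 * (1 + m\<^sup>2)"
        by (simp add: E)
      then have "4 / C * (exp (2 * (T + 1) powr \<nu>) * (L2_norm ?Q (evolution_op ?Q a b c w))\<^sup>2) \<le> 4 / C * (4 * (1 + m\<^sup>2))"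
        using C by (intro mult_left_mono) auto
      then show "4 / C * exp (2 * (T + 1) powr \<nu>) * (L2_norm ?Q (evolution_op ?Q a b c w))\<^sup>2 \<le> 4 / C * (4 * (1 + m\<^sup>2))"
        by (simp add: mult.assoc)
      have "(grad_time_trace_norm \<Omega> T w 0)\<^sup>2 \<le> D * (H2_norm ?Q w)\<^sup>2"
        unfolding D_def by (rule grad_time_trace_norm_le[OF \<Omega> T wH])
      also have "\<dots> \<le> D * (4 * (1 + m\<^sup>2))" using bounds(2) D by (intro mult_left_mono) auto
      finally show "(grad_time_trace_norm \<Omega> T w 0)\<^sup>2 \<le> D * (4 * (1 + m\<^sup>2))" .
    qed simp
    also have "\<dots> = C1\<^sup>2 * (1 + m\<^sup>2)"
      using C D by (simp add: C1_def field_simps)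
    also have "\<dots> \<le> C1\<^sup>2 * (1 + m)\<^sup>2"
      using H2_norm_nonneg[of ?Q v_star] by (intro mult_left_mono) (auto simp: m_def power2_sum)
    finally have "exp (2 * (\<tau> + 1) powr \<nu>) * (H10_norm (cylinder \<Omega> \<tau> T) w)\<^sup>2 \<le> (C1 * (1 + m))\<^sup>2"
      by (simp add: power_mult_distrib)
    then have "(exp ((\<tau> + 1) powr \<nu>) * H10_norm (cylinder \<Omega> \<tau> T) w)\<^sup>2 \<le> (C1 * (1 + m))\<^sup>2"
      by (simp add: power_mult_distrib exp_double)
    then have "exp ((\<tau> + 1) powr \<nu>) * H10_norm (cylinder \<Omega> \<tau> T) w \<le> C1 * (1 + m)"
      by (rule power2_le_imp_le) (use C1 H2_norm_nonneg[of ?Q v_star] in \<open>simp add: m_def\<close>)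
    then have "H10_norm (cylinder \<Omega> \<tau> T) w \<le> C1 * (1 + m) * exp (- ((\<tau> + 1) powr \<nu>))"
      by (simp add: exp_minus field_simps)
    then show ?thesis
      unfolding \<nu>_def w_def m_def using carleman_parameter_powr[of \<delta> T \<tau>] \<delta> \<delta>0 T \<tau> by simp
  qed
  show ?thesis
  proof (rule exI[of _ \<nu>2], rule exI[of _ C1], intro conjI allI impI ballI, goal_cases)
    case 1
    show ?case by (simp add: \<nu>2_def)
  next
    case (5 a b c p \<delta>0 \<delta> \<alpha> q_star v_star q v \<tau>)
    then show ?case by (intro time_exponent_bounds) auto
  next
    case (6 a b c p \<delta>0 \<delta> \<alpha> q_star v_star q v \<tau>)
    then show ?case
      by (intro main[of a b c p \<delta>0 \<delta> q_star v_star q v \<tau>, unfolded carleman_parameter_def]) auto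
  qed (use assms(7,9) C1 in auto)
qed

end
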